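(* Let $\mathfrak g$ be $\mathfrak{osp}(2\mathbf n+1|2\mathbf m)$, $\mathfrak{osp}(2\mathbf n|2\mathbf m)$ or $\mathfrak{spo}(2\mathbf n|2\mathbf m)$, with $R$, $S=PR$, $\rho_i$, $\kappa_i$, $i'$ as in the context, let $\lambda\in\mathbb C^\times$, and let $m$ be an integer with $1\le m\le \mathbf m$. Then each of the following even matrices $K$ satisfies the graded reflection equation $$S\,K_2\,S\,K_2=K_2\,S\,K_2\,S\quad\text{in }\mathrm{End}(V)\otimes\mathrm{End}(V),\qquad K_2=1\otimes K:$$ (A) $A=\sum_{i=1}^m \lambda\bigl(1-\kappa_m\kappa_{m'}q^{-2\rho_m}\bigr)e_{ii}+\sum_{m<i<m'}\lambda e_{ii}+\sum_{i\le m}\bigl(y_ie_{i,i'}+y_{i'}e_{i',i}\bigr)$, where $y_iy_{i'}=\kappa_m\kappa_{m'}\lambda^2q^{-2\rho_m}$ for all $i\le m$; (B) for $m$ even, $B=\sum_{i=1}^m\lambda\bigl(1+\kappa_{m-1}\kappa_{m'+1}q^{-2(\rho_m+1)}\bigr)e_{ii}+\sum_{m<i<m'}\lambda e_{ii}+\sum_{i\le m,\ i\text{ odd}}\Bigl(z_i(e_{i,i'-1}-e_{i+1,i'})+z_{i'-1}(e_{i'-1,i}-e_{i',i+1})\Bigr)$, where $z_iz_{i'-1}=-\kappa_{m-1}\kappa_{m'+1}\lambda^2q^{-2(\rho_m+1)}$ for all odd $i\le m$; (C) for $\mathfrak g=\mathfrak{osp}(2|2M)$ with $M$ even and $n=M+1$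 (so $\dim V=2n$, $i'=2n+1-i$): $C=\sum_{1\le i\le 2n-1,\ i\text{ odd},\ i\ne n}x_i(e_{i,i'-1}-e_{i+1,i'})+x_ne_{n,n'}+x_{n'}e_{n',n}$, where $x_ix_{i'-1}=x_nx_{n'}$ for all odd $i\neq n$.
   Context: $V=\mathbb C^{N|2\mathbf m}$ has homogeneous basis $v_1,\dots,v_{N+2\mathbf m}$ ($N=2\mathbf n+1$ or $2\mathbf n$) with grading $|i|:=|v_i|=1$ if $i\le\mathbf m$ or $i>\mathbf m+N$ and $|i|=0$ otherwise; $i'=N+2\mathbf m+1-i$. $e_{ij}$ are matrix units, $|e_{ij}|=|i|+|j|$, and all tensor products are $\mathbb Z_2$-graded: $(a\otimes b)(c\otimes d)=(-1)^{|b||c|}ac\otimes bd$. $q\in\mathbb C^\times$ is not a root of unity, $\omega=q-q^{-1}$. The R-matrix is $$R=\sum_{i,j}q^{(-1)^{|j|}(\delta_{ij}-\delta_{ij'})}e_{ii}\otimes e_{jj}+\omega\sum_{j<i}\Bigl((-1)^{|j|}e_{ij}\otimes e_{ji}-(-1)^{|i|+|j|+|i||j|}\kappa_i\kappa_jq^{\rho_i-\rho_j}e_{ij}\otimes e_{i'j'}\Bigr),$$ $P=\sum_{i,j}(-1)^{|j|}e_{ij}\otimes e_{ji}$ is the graded flip, and $S=PR$. Here $(\rho_i)$ is: for $\mathfrak{osp}(2\mathbf n+1|2\mathbf m)$, with $k=\frac{2\mathbf n+1}2$, $(k-\mathbf m,\dots,k-1;\,k-1,\dots,\tfrac12,0,-\tfrac12,\dots,1-k;\,1-k,\dots,\mathbf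 m-k)$; for $\mathfrak{osp}(2\mathbf n|2\mathbf m)$, $(\mathbf n-\mathbf m,\dots,\mathbf n-1;\,\mathbf n-1,\dots,1,0,0,-1,\dots,1-\mathbf n;\,1-\mathbf n,\dots,\mathbf m-\mathbf n)$; for $\mathfrak{spo}(2\mathbf n|2\mathbf m)$, $(\mathbf n-\mathbf m+1,\dots,\mathbf n;\,\mathbf n,\dots,1,-1,\dots,1-\mathbf n;\,1-\mathbf n,\dots,\mathbf m-\mathbf n-1)$ (semicolons separate the first $\mathbf m$, the middle $N$ and the last $\mathbf m$ entries). $(\kappa_i)=(-1,\dots,-1;1,\dots,1;1,\dots,1)$ for $\mathfrak{osp}$ and $(-1,\dots,-1;1,\dots,1,-1,\dots,-1;-1,\dots,-1)$ (middle block: $\mathbf n$ ones then $\mathbf n$ minus ones) for $\mathfrak{spo}(2\mathbf n|2\mathbf m)$. This $R$ is (up to scalar) the image of the universal R-matrix of the quantum supergroup $U_q(\mathfrak g)$ in its natural representation on $V$, with the grading above.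
   Formalization: For spo(2n|2m) the stated list of ρ_i is two entries too short; it is corrected to (n−m+1,…,n; n,…,1,−1,…,−n; −n,…,m−n−1), so that ρ_{i'} = −ρ_i. Half-integer powers of q are taken with respect to an arbitrary fixed square root of q. *)

theory Defs
  imports Complex_Main
begin

datatype galg = OspOdd | OspEven | Spo

definition NN :: "galg \<Rightarrow> nat \<Rightarrow> nat" where
  "NN g nb = (if g = OspOdd then 2 * nb + 1 else 2 * nb)"

definition dimV :: "galg \<Rightarrow> nat \<Rightarrow> nat \<Rightarrow> nat" where
  "dimV g nb mb = NN g nb + 2 * mb"

text \<open>Grading |i| of the basis vector v_i (1-based indices), as 0/1.\<close>
definition par :: "galg \<Rightarrow> nat \<Rightarrow> nat \<Rightarrow> nat \<Rightarrow> nat" where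
  "par g nb mb i = (if i \<le> mb \<or> mb + NN g nb < i then 1 else 0)"

definition pr :: "galg \<Rightarrow> nat \<Rightarrow> nat \<Rightarrow> nat \<Rightarrow> nat" where
  "pr g nb mb i = dimV g nb mb + 1 - i"

text \<open>The list (2 rho_1, ..., 2 rho_{N+2m}) of DOUBLED rho-values (integers), so that
  q^(rho_i) = s^(2 rho_i) for a fixed square root s of q.\<close>
definition rho2_list :: "galg \<Rightarrow> nat \<Rightarrow> nat \<Rightarrow> int list" where
  "rho2_list g nb mb = (case g of
     OspOdd \<Rightarrow>
       map (\<lambda>t. 2 * int nb + 1 - 2 * int mb + 2 * int t) [0..<mb]
       @ map (\<lambda>t. 2 * int nb - 1 - 2 * int t) [0..<nb] @ [0]
       @ map (\<lambda>t. - (2 * int t + 1)) [0..<nb]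
       @ map (\<lambda>t. 1 - 2 * int nb + 2 * int t) [0..<mb]
   | OspEven \<Rightarrow>
       map (\<lambda>t. 2 * (int nb - int mb + int t)) [0..<mb]
       @ map (\<lambda>t. 2 * (int nb - 1 - int t)) [0..<nb]
       @ map (\<lambda>t. - 2 * int t) [0..<nb]
       @ map (\<lambda>t. 2 * (1 - int nb + int t)) [0..<mb]
   | Spo \<Rightarrow>
       map (\<lambda>t. 2 * (int nb - int mb + 1 + int t)) [0..<mb]
       @ map (\<lambda>t. 2 * (int nb - int t)) [0..<nb]
       @ map (\<lambda>t. - 2 * (int t + 1)) [0..<nb]
       @ map (\<lambda>t. 2 * (int t - int nb)) [0..<mb])"

definition rho2 :: "galg \<Rightarrow> nat \<Rightarrow> nat \<Rightarrow> nat \<Rightarrow> int" where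
  "rho2 g nb mb i = rho2_list g nb mb ! (i - 1)"

definition kappa :: "galg \<Rightarrow> nat \<Rightarrow> nat \<Rightarrow> nat \<Rightarrow> complex" where
  "kappa g nb mb i = (if i \<le> mb then -1
      else if g = Spo \<and> mb + nb < i then -1 else 1)"

text \<open>Elements of End(V) are matrices nat => nat => complex (entries indexed 1..dim V);
  elements of End(V) \<otimes> End(V) are X :: nat => nat => nat => nat => complex,
  X i j k l being the coefficient of e_ij \<otimes> e_kl.\<close>

text \<open>Graded product: (e_ij \<otimes> e_kl)(e_ab \<otimes> e_cd) = (-1)^(|e_kl| |e_ab|) \<delta>_ja \<delta>_lc e_ib \<otimes> e_kd.\<close>
definition gmul :: "nat \<Rightarrow> (nat \<Rightarrow> nat) \<Rightarrow> (nat \<Rightarrow> nat \<Rightarrow> nat \<Rightarrow> nat \<Rightarrow> complex)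
    \<Rightarrow> (nat \<Rightarrow> nat \<Rightarrow> nat \<Rightarrow> nat \<Rightarrow> complex) \<Rightarrow> (nat \<Rightarrow> nat \<Rightarrow> nat \<Rightarrow> nat \<Rightarrow> complex)" where
  "gmul D p X Y = (\<lambda>i b k d. \<Sum>j\<in>{1..D}. \<Sum>l\<in>{1..D}.
      (-1) ^ ((p k + p l) * (p j + p b)) * X i j k l * Y j b l d)"

text \<open>The R-matrix, with q = s^2 and q^(x) := s^(2x) for half-integers x.\<close>
definition Rmat :: "galg \<Rightarrow> nat \<Rightarrow> nat \<Rightarrow> complex \<Rightarrow> nat \<Rightarrow> nat \<Rightarrow> nat \<Rightarrow> nat \<Rightarrow> complex" where
  "Rmat g nb mb s = (\<lambda>i j k l.
     let q = s\<^sup>2; \<omega> = q - inverse q; p = par g nb mb; c = pr g nb mb in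
       (if i = j \<and> k = l then
          q powi ((-1) ^ p k * ((if i = k then 1 else 0) - (if i = c k then 1 else 0)))
        else 0)
     + (if j < i \<and> k = j \<and> l = i then \<omega> * (-1) ^ p j else 0)
     - (if j < i \<and> k = c i \<and> l = c j then
          \<omega> * (-1) ^ (p i + p j + p i * p j) * kappa g nb mb i * kappa g nb mb j
            * s powi (rho2 g nb mb i - rho2 g nb mb j)
        else 0))"

definition Pmat :: "galg \<Rightarrow> nat \<Rightarrow> nat \<Rightarrow> nat \<Rightarrow> nat \<Rightarrow> nat \<Rightarrow> nat \<Rightarrow> complex" where
  "Pmat g nb mb = (\<lambda>i j k l. if k = j \<and> l = i then (-1) ^ par g nb mb j else 0)"

definition Smat :: "galg \<Rightarrow> nat \<Rightarrow> nat \<Rightarrow> complex \<Rightarrow> nat \<Rightarrow> nat \<Rightarrow> nat \<Rightarrow> nat \<Rightarrow> complex" where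
  "Smat g nb mb s = gmul (dimV g nb mb) (par g nb mb) (Pmat g nb mb) (Rmat g nb mb s)"

definition K2 :: "(nat \<Rightarrow> nat \<Rightarrow> complex) \<Rightarrow> nat \<Rightarrow> nat \<Rightarrow> nat \<Rightarrow> nat \<Rightarrow> complex" where
  "K2 K = (\<lambda>i j k l. if i = j then K k l else 0)"

definition reflection_eq :: "galg \<Rightarrow> nat \<Rightarrow> nat \<Rightarrow> complex \<Rightarrow> (nat \<Rightarrow> nat \<Rightarrow> complex) \<Rightarrow> bool" where
  "reflection_eq g nb mb s K \<longleftrightarrow>
     (let D = dimV g nb mb; mu = gmul D (par g nb mb); S = Smat g nb mb s; Q = K2 K in
      \<forall>i\<in>{1..D}. \<forall>j\<in>{1..D}. \<forall>k\<in>{1..D}. \<forall>l\<in>{1..D}.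
        mu (mu (mu S Q) S) Q i j k l = mu (mu (mu Q S) Q) S i j k l)"

definition even_mat :: "galg \<Rightarrow> nat \<Rightarrow> nat \<Rightarrow> (nat \<Rightarrow> nat \<Rightarrow> complex) \<Rightarrow> bool" where
  "even_mat g nb mb K \<longleftrightarrow>
     (\<forall>k\<in>{1..dimV g nb mb}. \<forall>l\<in>{1..dimV g nb mb}.
        K k l \<noteq> 0 \<longrightarrow> par g nb mb k = par g nb mb l)"

definition emat :: "nat \<Rightarrow> nat \<Rightarrow> nat \<Rightarrow> nat \<Rightarrow> complex" where
  "emat a b = (\<lambda>k l. if k = a \<and> l = b then 1 else 0)"

text \<open>Matrix (A). m is the integer 1 \<le> m \<le> mb; q^(-2 rho_m) = s^(-4 rho_m).\<close>
definition KA :: "galg \<Rightarrow> nat \<Rightarrow> nat \<Rightarrow> complex \<Rightarrow> nat \<Rightarrow> complex \<Rightarrow> (nat \<Rightarrow> complex)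
    \<Rightarrow> nat \<Rightarrow> nat \<Rightarrow> complex" where
  "KA g nb mb s m lam y = (\<lambda>k l. let c = pr g nb mb; \<kappa> = kappa g nb mb in
       (\<Sum>i\<in>{1..m}. lam * (1 - \<kappa> m * \<kappa> (c m) * s powi (- 2 * rho2 g nb mb m)) * emat i i k l)
     + (\<Sum>i\<in>{m<..<c m}. lam * emat i i k l)
     + (\<Sum>i\<in>{1..m}. y i * emat i (c i) k l + y (c i) * emat (c i) i k l))"

text \<open>Matrix (B); q^(-2(rho_m+1)) = s^(-2(2 rho_m + 2)).\<close>
definition KB :: "galg \<Rightarrow> nat \<Rightarrow> nat \<Rightarrow> complex \<Rightarrow> nat \<Rightarrow> complex \<Rightarrow> (nat \<Rightarrow> complex)
    \<Rightarrow> nat \<Rightarrow> nat \<Rightarrow> complex" where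
  "KB g nb mb s m lam z = (\<lambda>k l. let c = pr g nb mb; \<kappa> = kappa g nb mb in
       (\<Sum>i\<in>{1..m}. lam * (1 + \<kappa> (m - 1) * \<kappa> (c m + 1) * s powi (- 2 * (rho2 g nb mb m + 2)))
          * emat i i k l)
     + (\<Sum>i\<in>{m<..<c m}. lam * emat i i k l)
     + (\<Sum>i\<in>{i\<in>{1..m}. odd i}.
          z i * (emat i (c i - 1) k l - emat (i + 1) (c i) k l)
        + z (c i - 1) * (emat (c i - 1) i k l - emat (c i) (i + 1) k l)))"

definition KC :: "nat \<Rightarrow> (nat \<Rightarrow> complex) \<Rightarrow> nat \<Rightarrow> nat \<Rightarrow> complex" where
  "KC M x = (\<lambda>k l. let n = M + 1; c = pr OspEven 1 M in
       (\<Sum>i\<in>{i\<in>{1..2 * n - 1}. odd i \<and> i \<noteq> n}.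
          x i * (emat i (c i - 1) k l - emat (i + 1) (c i) k l))
     + x n * emat n (c n) k l + x (c n) * emat (c n) n k l)"

end

theory Submission
  imports Defs
begin

text \<open>
  Letting \<open>End V \<otimes> End V\<close> act on tensors \<open>F x y\<close> with the Koszul sign turns the graded product into
  composition of operators. In these coordinates \<open>S\<close> exchanges the two indices up to a factor, adds
  \<open>(q - 1/q) F x y\<close> for \<open>x < y\<close>, and adds a rank one term coupling all entries \<open>F j j'\<close>, while \<open>K\<close> acts on
  the second index by a diagonal matrix plus the involution \<open>j \<mapsto> (\<sigma> j)'\<close>, where \<open>\<sigma>\<close> is the identity in
  case (A) and exchanges neighbours \<open>2k - 1, 2k\<close> in cases (B) and (C).

  Away from the entries \<open>f j = F j j'\<close> and \<open>g j = F j (\<sigma> j)\<close> the equation only involves eight entries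
  and is a Hecke type identity. On the span of \<open>f\<close> and \<open>g\<close> it becomes an identity of two by two block
  matrices. All four blocks follow from closed formulas for \<open>S A' S\<close>, with \<open>A'\<close> diagonal, on the rows and
  columns where \<open>K\<close> is not scalar. These formulas amount to the telescoping evaluation of
  \<open>\<Sum>k<z. \<kappa>\<^sub>k \<kappa>\<^sub>k\<^sub>' q\<^sup>-\<^sup>2\<^sup>\<rho>\<^sub>k\<close>, which is where the values of \<open>\<rho>\<close> and \<open>\<kappa>\<close> enter.
\<close>

section \<open>The crossing matrix\<close>

text \<open>The reflection equation says that \<open>K\<close> commutes with \<open>S K S\<close>,
  so sandwiches of a diagonal matrix between two copies of \<open>S\<close> are the central objects.
  The three families differ only in \<open>si\<close>, in the size of the outer blocks and in the
  constants, and the constants are forced by the telescoped sum. Write \<open>G z\<close> for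
  \<open>dd z z' * rr z\<close>, plus \<open>w\<close> once \<open>z\<close> lies beyond its mirror
  image; then \<open>G (z + 1) - G z = w * rr z\<close>. The sandwich formulas need
  \<open>hh z = lam * G z - (lam - mu) * th\<close> on the middle block, while
  \<open>hh (m + 1) = 0\<close>; hence \<open>lam * G (m + 1) = (lam - mu) * th\<close>. As
  \<open>G (m + 1) = - rr m / q\<close> in the odd block, this means
  \<open>mu = lam * (1 - rr m)\<close> for \<open>th = -1/q\<close> and
  \<open>mu = lam * (1 + rr m / q^2)\<close> for \<open>th = q\<close>: the diagonals of (A) and
  (B). The quadratic relation \<open>p = lam * (lam - mu)\<close> then yields the prescribed
  products of antidiagonal coefficients. In case (C) the middle block is empty and
  \<open>mu = 0\<close>, so \<open>hh\<close> vanishes and only the products being constant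
  matters.\<close>

text \<open>
  Indices run over \<open>{1..D}\<close> with \<open>x' = D + 1 - x\<close>; \<open>od\<close> marks the odd ones, \<open>si\<close> is \<open>\<sigma>\<close>, and
  \<open>psi, phi\<close> stand for \<open>\<kappa> q\<^sup>\<rho>\<close> and \<open>\<kappa> q\<^sup>-\<^sup>\<rho>\<close>. The common eigenvalue \<open>th\<close> of \<open>T\<close> below on these
  two vectors is \<open>-1/q\<close> in case (A) and \<open>q\<close> in cases (B) and (C).
\<close>

locale crossing_matrix =
  fixes D m :: nat and si :: "nat \<Rightarrow> nat" and od :: "nat \<Rightarrow> bool"
    and q w th mu lam :: complex and psi phi :: "nat \<Rightarrow> complex"
  assumes q_nz: "q \<noteq> 0" and w_eq: "w = q - inverse q" and m_le: "2 * m \<le> D"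
    and si_top: "\<lbrakk>1 \<le> x; x \<le> m\<rbrakk> \<Longrightarrow> 1 \<le> si x \<and> si x \<le> m"
    and si_mid: "\<lbrakk>m < x; x \<le> D - m\<rbrakk> \<Longrightarrow> si x = x"
    and si_si: "\<lbrakk>1 \<le> x; x \<le> D\<rbrakk> \<Longrightarrow> si (si x) = x"
    and si_pm: "\<lbrakk>1 \<le> x; x \<le> D\<rbrakk> \<Longrightarrow> si (D + 1 - x) = D + 1 - si x"
    and si_mono: "\<lbrakk>1 \<le> x; y \<le> D; x < y; y \<noteq> si x\<rbrakk> \<Longrightarrow> si x < si y"
    and od_pm: "\<lbrakk>1 \<le> x; x \<le> D\<rbrakk> \<Longrightarrow> od (D + 1 - x) = od x"
    and od_si: "\<lbrakk>1 \<le> x; x \<le> D\<rbrakk> \<Longrightarrow> od (si x) = od x"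
    and swap_od: "\<lbrakk>1 \<le> x; x \<le> D; si x \<noteq> x\<rbrakk> \<Longrightarrow> od x \<and> th = q"
    and fix_th: "\<lbrakk>1 \<le> x; x \<le> m; si x = x\<rbrakk> \<Longrightarrow> th = (if od x then - inverse q else q)"
    and phi_psi: "\<lbrakk>1 \<le> x; x \<le> D\<rbrakk> \<Longrightarrow> phi x * psi x = 1"
    and phi_si: "\<lbrakk>1 \<le> x; x < si x; si x \<le> D\<rbrakk> \<Longrightarrow> phi x = th * phi (si x)"
begin

abbreviation pm :: "nat \<Rightarrow> nat" where "pm x \<equiv> D + 1 - x"

definition outer :: "nat \<Rightarrow> bool" where "outer x \<longleftrightarrow> x \<le> m \<or> D - m < x"

definition al :: "nat \<Rightarrow> complex" where
  "al x = (if x \<le> m then mu else if x \<le> D - m then lam else 0)"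

text \<open>The coefficient with which \<open>S\<close> exchanges \<open>F x y\<close> and
  \<open>F y x\<close>: the sign of the graded flip times the diagonal factor of \<open>R\<close>.
  At a middle index \<open>x = pm x\<close> the two Kronecker deltas in the exponent cancel, so the
  factor is 1 there.\<close>

definition dd :: "nat \<Rightarrow> nat \<Rightarrow> complex" where
  "dd x y = (if od x \<and> od y then -1 else 1)
     * (if x = y \<and> x \<noteq> pm x then if od x then inverse q else q
        else if y = pm x \<and> x \<noteq> y then if od x then q else inverse q else 1)"

text \<open>For the actual weights this is \<open>\<kappa>\<^sub>x \<kappa>\<^sub>x\<^sub>' q^(-2
  \<rho>\<^sub>x)\<close>, because \<rho> changes sign under \<open>pm\<close>.\<close>

definition rr :: "nat \<Rightarrow> complex" where "rr x = phi x * psi (pm x)"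

text \<open>The contraction of the two rank one terms in \<open>S A' S\<close>, where
  \<open>A'\<close> has diagonal \<open>al (pm k)\<close>. The cut-offs in the two factors combine
  to a sum over \<open>k < z\<close> with \<open>z\<close> the smaller of the two limits.\<close>

definition hh :: "nat \<Rightarrow> complex" where
  "hh z = w * (\<Sum>k\<in>{1..<z}. rr k * al (pm k))"

text \<open>
  \<open>Sf\<close> and \<open>T\<close> are the matrices of \<open>S\<close> on the entries \<open>F j j'\<close> and, after a change of sign of half of
  the basis, on the entries \<open>F j (si j)\<close>.
\<close>

definition Sf :: "nat \<Rightarrow> nat \<Rightarrow> complex" where
  "Sf j i = (if i = pm j then dd j i else 0) + (if i = j \<and> j < pm j then w else 0)
     - (if i < pm j then w * psi (pm j) * phi i else 0)"

definition T :: "nat \<Rightarrow> nat \<Rightarrow> complex" where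
  "T j i = (if outer j then (if i = si j then if si j = j then th else 1 else 0)
     + (if i = j \<and> j < si j then w else 0) else 0)"

lemma hh_top: "z \<le> m + 1 \<Longrightarrow> hh z = 0"
  unfolding hh_def using m_le by (auto intro!: sum.neutral simp: al_def)

lemma si_range: "\<lbrakk>1 \<le> x; x \<le> D\<rbrakk> \<Longrightarrow> 1 \<le> si x \<and> si x \<le> D"
proof -
  assume x: "1 \<le> x" "x \<le> D"
  consider "x \<le> m" | "m < x" "x \<le> D - m" | "pm x \<le> m" "1 \<le> pm x" using x by linarith
  then show ?thesis
  proof cases
    case 1 then show ?thesis using si_top[of x] x m_le by auto
  next
    case 2 then show ?thesis using si_mid[of x] x by auto
  next
    case 3 
    have "si x = pm (si (pm x))" using si_pm[of "pm x"] x by simp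
    then show ?thesis using si_top[OF 3(2,1)] m_le by linarith
  qed
qed

lemma si_bot: "\<lbrakk>D - m < x; x \<le> D\<rbrakk> \<Longrightarrow> D - m < si x"
proof -
  assume x: "D - m < x" "x \<le> D"
  have "si x = pm (si (pm x))" using si_pm[of "pm x"] x by simp
  moreover have "1 \<le> si (pm x) \<and> si (pm x) \<le> m" by (rule si_top) (use x in auto)
  ultimately show ?thesis using m_le by linarith
qed

lemma si_le_m: "\<lbrakk>1 \<le> x; x \<le> D\<rbrakk> \<Longrightarrow> si x \<le> m \<longleftrightarrow> x \<le> m"
  using si_top[of x] si_mid[of x] si_bot[of x] m_le by (cases "x \<le> m"; cases "x \<le> D - m") auto

lemma outer_si: "\<lbrakk>1 \<le> x; x \<le> D\<rbrakk> \<Longrightarrow> outer (si x) \<longleftrightarrow> outer x"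
  using si_top[of x] si_mid[of x] si_bot[of x] m_le unfolding outer_def by (cases "x \<le> m"; cases "x \<le> D - m") auto

lemma outer_pm: "\<lbrakk>1 \<le> x; x \<le> D\<rbrakk> \<Longrightarrow> outer (pm x) \<longleftrightarrow> outer x"
  using m_le unfolding outer_def by auto

lemma dd_pm: "\<lbrakk>1 \<le> x; x \<le> D\<rbrakk> \<Longrightarrow> dd (pm x) x = dd x (pm x)"
  using od_pm[of x] unfolding dd_def by auto

lemma dd_sq: "\<lbrakk>1 \<le> x; x \<le> D; x \<noteq> pm x\<rbrakk> \<Longrightarrow> dd x (pm x) * dd x (pm x) + w * dd x (pm x) = 1"
  using od_pm[of x] q_nz unfolding dd_def w_eq by (auto simp: field_simps)

text \<open>Apply \<open>phi_si\<close> to the mirrored pair \<open>pm (si x) < pm x\<close> and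
  invert.\<close>

lemma psi_si: "\<lbrakk>1 \<le> x; x < si x; si x \<le> D\<rbrakk> \<Longrightarrow> psi (pm x) = th * psi (pm (si x))"
proof -
  assume x: "1 \<le> x" "x < si x" "si x \<le> D"
  let ?y = "pm (si x)"
  have y: "si ?y = pm x" "1 \<le> ?y" "?y < pm x" "pm x \<le> D" using x si_pm[of "si x"] si_si[of x] by auto
  have "phi ?y = th * phi (pm x)" using phi_si[of ?y] y by simp
  moreover have "phi ?y * psi ?y = 1" "phi (pm x) * psi (pm x) = 1" using phi_psi y x by auto
  ultimately show ?thesis
    by (smt (verit) mult.assoc mult.commute mult.left_neutral)
qed

section \<open>Eigenvectors and the Hecke relation of \<open>T\<close>\<close>

lemma sum_T:
  assumes "1 \<le> j" "j \<le> D" "outer j"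
  shows "(\<Sum>k\<in>{1..D}. T j k * f k) = (if si j = j then th * f j else f (si j) + (if j < si j then w * f j else 0))"
proof -
  have "T j k * f k = (if k = si j then (if si j = j then th else 1) * f k else 0) + (if k = j then (if j < si j then w else 0) * f k else 0)" for k
    unfolding T_def using assms by (auto simp: algebra_simps)
  then show ?thesis using assms si_range[of j] by (simp add: sum.distrib)
qed

lemma T_sym: "\<lbrakk>1 \<le> j; j \<le> D; 1 \<le> i; i \<le> D\<rbrakk> \<Longrightarrow> T j i = T i j"
  unfolding T_def using si_si[of i] si_si[of j] outer_si[of i] outer_si[of j] by auto

lemma sum_T':
  assumes "1 \<le> i" "i \<le> D" "outer i"
  shows "(\<Sum>k\<in>{1..D}. f k * T k i) = (if si i = i then th * f i else f (si i) + (if i < si i then w * f i else 0))"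
proof -
  have "(\<Sum>k\<in>{1..D}. f k * T k i) = (\<Sum>k\<in>{1..D}. T i k * f k)"
    by (rule sum.cong) (use assms T_sym in auto)
  then show ?thesis using sum_T[OF assms] by simp
qed

text \<open>On a swapped pair \<open>T\<close> has rows \<open>(w, 1)\<close> and
  \<open>(1, 0)\<close>, with eigenvalues \<open>q\<close> and \<open>-1/q\<close>. By
  \<open>psi_si\<close> the weights are proportional to \<open>(q, 1)\<close>, an eigenvector for
  \<open>th = q\<close>.\<close>

lemma T_psi:
  assumes "1 \<le> j" "j \<le> D" "outer j"
  shows "(\<Sum>k\<in>{1..D}. T j k * psi (pm k)) = th * psi (pm j)"
proof -
  consider "si j = j" | "j < si j" | "si j < j" by linarith
  then show ?thesis
  proof cases
    case 1 then show ?thesis using sum_T[OF assms] by simp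
  next
    case 2
    then have "psi (pm j) = th * psi (pm (si j))" "th = q" using psi_si[of j] si_range[of j] swap_od[of j] assms by auto
    then show ?thesis unfolding sum_T[OF assms] using 2 q_nz by (simp add: w_eq field_simps)
  next
    case 3
    then have "psi (pm (si j)) = th * psi (pm j)" using psi_si[of "si j"] si_range[of j] si_si[of j] assms by auto
    then show ?thesis using sum_T[OF assms] 3 by simp
  qed
qed

text \<open>The Hecke relation \<open>(T - q) (T + 1/q) = 0\<close>; the scalar \<open>th\<close> on
  a fixed index is one of the two roots.\<close>

lemma T_sq:
  assumes "1 \<le> j" "j \<le> D" "outer j"
  shows "(\<Sum>k\<in>{1..D}. T j k * T k i) = w * T j i + (if i = j then 1 else 0)"
proof -
  have th: "th * th = w * th + 1"
  proof (cases "si j = j")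
    case True
    have "th = - inverse q \<or> th = q"
      using fix_th[of j] fix_th[of "pm j"] si_pm[of j] True assms unfolding outer_def by (cases "j \<le> m"; auto split: if_splits)
    then show ?thesis
    proof
      assume a: "th = - inverse q"
      show ?thesis unfolding a w_eq using q_nz by (simp add: field_simps)
    next
      assume a: "th = q"
      show ?thesis unfolding a w_eq using q_nz by (simp add: field_simps)
    qed
  next
    case False
    then have "th = q" using swap_od assms by auto
    then show ?thesis using q_nz unfolding w_eq by (auto simp: field_simps)
  qed
  show ?thesis unfolding sum_T[OF assms] unfolding T_def using th si_si[of j] outer_si[of j] assms by auto
qed

section \<open>Sandwich formulas for the crossing matrix\<close>

lemma sum_Sf_row:
  assumes "1 \<le> j" "j \<le> D"
  shows "(\<Sum>k\<in>{1..D}. Sf j k * f k) = dd j (pm j) * f (pm j) + (if j < pm j then w * f j else 0)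
     - w * psi (pm j) * (\<Sum>k\<in>{1..<pm j}. phi k * f k)"
proof -
  have "Sf j k * f k = (if k = pm j then dd j k * f k else 0) + (if k = j then (if j < pm j then w else 0) * f k else 0)
     - w * psi (pm j) * (if k \<in> {1..<pm j} then phi k * f k else 0)" if "k \<in> {1..D}" for k
    unfolding Sf_def using that by (auto simp: algebra_simps)
  then have "(\<Sum>k\<in>{1..D}. Sf j k * f k) = (\<Sum>k\<in>{1..D}. (if k = pm j then dd j k * f k else 0) + (if k = j then (if j < pm j then w else 0) * f k else 0)
     - w * psi (pm j) * (if k \<in> {1..<pm j} then phi k * f k else 0))" by (rule sum.cong[OF refl])
  also have "\<dots> = dd j (pm j) * f (pm j) + (if j < pm j then w * f j else 0)
     - w * psi (pm j) * (\<Sum>k\<in>{1..D}. if k \<in> {1..<pm j} then phi k * f k else 0)"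
    using assms by (simp only: sum.distrib sum_subtractf sum_distrib_left[symmetric]) auto
  also have "(\<Sum>k\<in>{1..D}. if k \<in> {1..<pm j} then phi k * f k else 0) = (\<Sum>k\<in>{1..<pm j}. phi k * f k)"
    by (rule sum.mono_neutral_cong_right) (use assms in auto)
  finally show ?thesis .
qed

text \<open>The inner sum met when a row of \<open>Sf\<close> is applied to \<open>A' Sf\<close>.
  The antidiagonal and diagonal parts of \<open>Sf\<close> contribute only if their index lies below
  the cut-off \<open>y\<close>; the rank one part contributes \<open>hh\<close> at the smaller
  cut-off.\<close>

lemma sum_phi_Sf:
  assumes "1 \<le> i" "i \<le> D" "y \<le> D"
  shows "(\<Sum>k\<in>{1..<y}. phi k * (al (pm k) * Sf k i)) =
      (if pm i < y then phi (pm i) * al i * dd i (pm i) else 0)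
    + (if i < pm i \<and> i < y then w * phi i * al (pm i) else 0) - phi i * hh (min y (pm i))"
proof -
  have "phi k * (al (pm k) * Sf k i) = (if k = pm i then phi (pm i) * al i * dd i (pm i) else 0)
    + (if k = i then (if i < pm i then w * phi i * al (pm i) else 0) else 0) - phi i * w * (if k < pm i then rr k * al (pm k) else 0)"
    if "k \<in> {1..<y}" for k
  proof -
    have e: "i = pm k \<longleftrightarrow> k = pm i" "i < pm k \<longleftrightarrow> k < pm i" using that assms by auto
    have d: "dd (pm i) i = dd i (pm i)" "al (pm (pm i)) = al i" using dd_pm[of i] assms by auto
    show ?thesis unfolding Sf_def e rr_def using d by (auto simp: algebra_simps)
  qed
  then have "(\<Sum>k\<in>{1..<y}. phi k * (al (pm k) * Sf k i)) = (\<Sum>k\<in>{1..<y}. (if k = pm i then phi (pm i) * al i * dd i (pm i) else 0)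
    + (if k = i then (if i < pm i then w * phi i * al (pm i) else 0) else 0) - phi i * w * (if k < pm i then rr k * al (pm k) else 0))"
    by (rule sum.cong[OF refl])
  also have "\<dots> = (if pm i < y then phi (pm i) * al i * dd i (pm i) else 0)
    + (if i < pm i \<and> i < y then w * phi i * al (pm i) else 0) - phi i * w * (\<Sum>k\<in>{1..<y}. if k < pm i then rr k * al (pm k) else 0)"
    using assms by (simp only: sum.distrib sum_subtractf sum_distrib_left[symmetric]) (auto)
  also have "(\<Sum>k\<in>{1..<y}. if k < pm i then rr k * al (pm k) else 0) = (\<Sum>k\<in>{1..<min y (pm i)}. rr k * al (pm k))"
    by (rule sum.mono_neutral_cong_right) auto
  finally show ?thesis by (simp add: hh_def mult.assoc)
qed

text \<open>A bottom row of \<open>Sf\<close> only reaches columns \<open>k \<le> m\<close>, where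
  \<open>al (pm k) = 0\<close>.\<close>

lemma sandwich_row_bottom:
  assumes j: "D - m < j" "j \<le> D"
  shows "(\<Sum>k\<in>{1..D}. Sf j k * (al (pm k) * f k)) = 0"
proof (rule sum.neutral, rule ballI)
  fix k assume k: "k \<in> {1..D}"
  have "pm j \<le> m" "\<not> j < pm j" using j m_le by linarith+
  then have "Sf j k = 0 \<or> D - m < pm k" unfolding Sf_def using k m_le by auto
  then show "Sf j k * (al (pm k) * f k) = 0" unfolding al_def using m_le by auto
qed

lemma T_Sf_bottom:
  assumes j: "D - m < j" "j \<le> D" and i: "1 \<le> i" "i \<le> D"
  shows "al (pm i) * (\<Sum>k\<in>{1..D}. T j k * Sf k i) = 0"
proof -
  have b: "1 \<le> j" "outer j" using j m_le unfolding outer_def by auto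
  have s: "D - m < si j" "si j \<le> D" using si_bot[OF j] si_range[of j] b j by auto
  have "Sf k i = 0 \<or> al (pm i) = 0" if "D - m < k" "k \<le> D" for k
  proof -
    have "pm k \<le> m" "\<not> k < pm k" using that m_le by linarith+
    then show ?thesis unfolding Sf_def al_def using i m_le by auto
  qed
  from this[OF s] this[OF j] show ?thesis unfolding sum_T[OF b(1) j(2) b(2)] by auto
qed

text \<open>For these rows and columns the antidiagonal is never met and the cut-off always holds.
  So \<open>Sf\<close> is \<open>w\<close> times the identity minus a rank one matrix whose left
  vector \<open>T\<close> multiplies by \<open>th\<close>.\<close>

lemma T_Sf_row:
  assumes j: "1 \<le> j" "j \<le> m" and i: "1 \<le> i" "i \<le> D - m"
  shows "(\<Sum>k\<in>{1..D}. T j k * Sf k i) = w * T j i - w * th * psi (pm j) * phi i"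
proof -
  have o: "outer j" "j \<le> D" using j m_le unfolding outer_def by auto
  have Sfk: "Sf k i = (if i = k then w else 0) - w * phi i * psi (pm k)" if "1 \<le> k" "k \<le> m" for k
    using that i m_le unfolding Sf_def by auto
  have "(\<Sum>k\<in>{1..D}. T j k * Sf k i) = (\<Sum>k\<in>{1..D}. T j k * ((if k = i then w else 0) - w * phi i * psi (pm k)))"
  proof (rule sum.cong[OF refl])
    fix k assume "k \<in> {1..D}"
    show "T j k * Sf k i = T j k * ((if k = i then w else 0) - w * phi i * psi (pm k))"
    proof (cases "1 \<le> k \<and> k \<le> m")
      case True then show ?thesis using Sfk[of k] by auto
    next
      case False then show ?thesis using si_top[OF j] j unfolding T_def by auto
    qed
  qed
  also have "\<dots> = (\<Sum>k\<in>{1..D}. if k = i then w * T j i else 0) - w * phi i * (\<Sum>k\<in>{1..D}. T j k * psi (pm k))"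
    unfolding sum_distrib_left sum_subtractf[symmetric] by (rule sum.cong) (auto simp: algebra_simps)
  also have "\<dots> = w * T j i - w * th * psi (pm j) * phi i" 
    unfolding T_psi[OF j(1) o(2,1)] using i m_le by auto
  finally show ?thesis .
qed

lemma sandwich_row_top:
  assumes h_bot: "\<And>z. \<lbrakk>D - m < z; z \<le> D\<rbrakk> \<Longrightarrow> hh z = mu * (dd z (pm z) * rr z + th)"
    and h_mid: "\<And>z. \<lbrakk>m < z; z \<le> D - m\<rbrakk> \<Longrightarrow>
      hh z = lam * (dd z (pm z) * rr z + (if pm z < z then w else 0)) - (lam - mu) * th"
    and j: "1 \<le> j" "j \<le> m" and i: "1 \<le> i" "i \<le> D"
  shows "(\<Sum>k\<in>{1..D}. Sf j k * (al (pm k) * Sf k i))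
    = (al (pm i) - mu) * (\<Sum>k\<in>{1..D}. T j k * Sf k i) + mu * (w * T j i + (if i = j then 1 else 0))"
proof -
  have jD: "j \<le> D" "1 \<le> pm j" "pm j \<le> D" "j < pm j" "D - m < pm j" using j m_le by auto
  have a: "al j = mu" "al (pm j) = 0" using j m_le unfolding al_def by auto
  have lhs: "(\<Sum>k\<in>{1..D}. Sf j k * (al (pm k) * Sf k i)) = dd j (pm j) * mu * Sf (pm j) i
     - w * psi (pm j) * (\<Sum>k\<in>{1..<pm j}. phi k * (al (pm k) * Sf k i))"
    unfolding sum_Sf_row[OF j(1) jD(1)] using a jD by simp
  have Sfp: "Sf (pm j) i = (if i = j then dd j (pm j) else 0) - (if i < j then w * psi j * phi i else 0)"
    unfolding Sf_def using jD dd_pm[of j] j by auto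
  have inv: "phi x * (psi x * c) = c" if "1 \<le> x" "x \<le> D" for x c using phi_psi[OF that] by (simp add: mult.assoc[symmetric])
  consider "D - m < i" | "m < i" "i \<le> D - m" | "i \<le> m" by linarith
  then show ?thesis
  proof cases
    \<comment> \<open>In a bottom column the sum ends where \<open>hh\<close> is still zero, and
      both sides vanish.\<close>
    case 1
    have "\<not> i < pm i" "i \<noteq> j" "\<not> i < j" "al i = 0" "al (pm i) = mu" "T j i = 0" "min (pm j) (pm i) \<le> m + 1"
      using 1 i j m_le si_top[OF j] unfolding al_def T_def by auto
    then show ?thesis unfolding lhs Sfp sum_phi_Sf[OF i jD(3)] by (simp add: hh_top)
  next
    case 2
    have f: "i \<noteq> j" "\<not> i < j" "pm i < pm j" "i < pm j" "al i = lam" "al (pm i) = lam" "T j i = 0" "min (pm j) (pm i) = pm i"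
      using 2 i j m_le si_top[OF j] unfolding al_def T_def by auto
    \<comment> \<open>The value of \<open>hh\<close> at \<open>pm i\<close> cancels the antidiagonal
      and diagonal contributions and leaves only \<open>(lam - mu) * th\<close>.\<close>
    have h0: "hh (pm i) = lam * (dd i (pm i) * rr (pm i) + (if i < pm i then w else 0)) - (lam - mu) * th"
      using h_mid[of "pm i"] 2 i dd_pm[OF i] by simp
    have "phi i * hh (pm i) = lam * (dd i (pm i) * (phi i * rr (pm i)) + phi i * (if i < pm i then w else 0)) - (lam - mu) * th * phi i"
      unfolding h0 by (simp only: algebra_simps)
    moreover have "phi i * rr (pm i) = phi (pm i)" unfolding rr_def using inv[of i] i by (simp add: mult.left_commute)
    ultimately have h: "phi i * hh (pm i) = lam * (dd i (pm i) * phi (pm i) + (if i < pm i then w * phi i else 0)) - (lam - mu) * th * phi i"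
      by (simp add: algebra_simps)
    have "(\<Sum>k\<in>{1..<pm j}. phi k * (al (pm k) * Sf k i)) = (lam - mu) * th * phi i"
      unfolding sum_phi_Sf[OF i jD(3)] using f h by (auto simp: algebra_simps)
    from f this show ?thesis unfolding lhs Sfp T_Sf_row[OF j i(1) 2(2)] by (simp only: if_False) (simp add: algebra_simps)
  next
    case 3
    have f: "i < pm i" "i < pm j" "al i = mu" "al (pm i) = 0" using 3 i j m_le unfolding al_def by auto
    have iD: "i \<le> D - m" using 3 m_le by simp
    have h: "hh (pm x) = mu * (dd x (pm x) * (phi (pm x) * psi x) + th)" if "1 \<le> x" "x \<le> m" for x
      using h_bot[of "pm x"] that m_le dd_pm[of x] unfolding rr_def by auto
    have hi: "phi i * hh (pm i) = mu * (dd i (pm i) * phi (pm i) + th * phi i)"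
      unfolding h[OF i(1) 3] using inv[of i] i by (simp add: algebra_simps)
    have hj: "psi (pm j) * hh (pm j) = mu * (dd j (pm j) * psi j + th * psi (pm j))"
      unfolding h[OF j] using inv[of "pm j"] jD by (simp add: algebra_simps)
    \<comment> \<open>The order of \<open>i\<close> and \<open>j\<close> decides which of
      \<open>pm i\<close>, \<open>pm j\<close> is the effective cut-off. On the diagonal the
      antidiagonal entry also meets itself, and \<open>dd_sq\<close> produces the identity
      term.\<close>
    consider "i = j" | "i < j" | "j < i" by linarith
    then show ?thesis
    proof cases
      case 1
      have "dd j (pm j) * dd j (pm j) + w * dd j (pm j) = 1" using dd_sq[of j] jD j by simp
      then have d: "dd j (pm j) * (dd j (pm j) * mu) + w * (dd j (pm j) * mu) = mu" by algebra
      have e: "psi (pm j) * (phi j * hh (pm j)) = mu * (dd j (pm j) + th * psi (pm j) * phi j)"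
        using hj inv[of j] j jD by (simp add: algebra_simps)
      show ?thesis unfolding lhs Sfp sum_phi_Sf[OF i jD(3)] T_Sf_row[OF j i(1) iD] using f 1 d e by (simp add: algebra_simps)
    next
      case 2
      then have k: "\<not> pm i < pm j" "min (pm j) (pm i) = pm j" "i \<noteq> j" using jD by auto
      have e: "psi (pm j) * (phi i * hh (pm j)) = mu * (dd j (pm j) * psi j + th * psi (pm j)) * phi i"
        using hj by (simp add: algebra_simps)
      show ?thesis unfolding lhs Sfp sum_phi_Sf[OF i jD(3)] T_Sf_row[OF j i(1) iD] using f 2 k e by (simp add: algebra_simps)
    next
      case 3
      then have k: "pm i < pm j" "min (pm j) (pm i) = pm i" "i \<noteq> j" "\<not> i < j" using i by auto
      show ?thesis unfolding lhs Sfp sum_phi_Sf[OF i jD(3)] T_Sf_row[OF j i(1) iD] using f k hi by (simp add: algebra_simps)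
    qed
  qed
qed

text \<open>With \<open>A = diag al\<close>, \<open>A' = diag (al o pm)\<close> and
  \<open>T_sq\<close> this reads \<open>Sf A' Sf + A T Sf = T Sf A' + A T T\<close> on outer rows,
  the form in which the blocks of the reflection equation use it.\<close>

lemma sandwich_row:
  assumes h_bot: "\<And>z. \<lbrakk>D - m < z; z \<le> D\<rbrakk> \<Longrightarrow> hh z = mu * (dd z (pm z) * rr z + th)"
    and h_mid: "\<And>z. \<lbrakk>m < z; z \<le> D - m\<rbrakk> \<Longrightarrow>
      hh z = lam * (dd z (pm z) * rr z + (if pm z < z then w else 0)) - (lam - mu) * th"
    and j: "1 \<le> j" "j \<le> D" "outer j" and i: "1 \<le> i" "i \<le> D"
  shows "(\<Sum>k\<in>{1..D}. Sf j k * (al (pm k) * Sf k i))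
    = (al (pm i) - al j) * (\<Sum>k\<in>{1..D}. T j k * Sf k i) + al j * (w * T j i + (if i = j then 1 else 0))"
proof (cases "j \<le> m")
  case True
  then have "al j = mu" unfolding al_def by simp
  then show ?thesis using sandwich_row_top[OF h_bot h_mid j(1) True i] by simp
next
  case False
  then have b: "D - m < j" using j unfolding outer_def by simp
  have "al j = 0" using b False unfolding al_def by simp
  then show ?thesis using T_Sf_bottom[OF b j(2) i] sandwich_row_bottom[OF b j(2)] by simp
qed

text \<open>Transposing \<open>Sf\<close> exchanges \<open>psi\<close> and \<open>phi\<close>, so that column formulas follow from row formulas.\<close>

lemma crossing_matrix_transpose:
  "crossing_matrix D m si od q w th (\<lambda>x. phi (pm x)) (\<lambda>x. psi (pm x))"
proof (unfold_locales, goal_cases)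
  case (13 x) then show ?case using phi_psi[of "pm x"] by (simp add: mult.commute)
next
  case (14 x) then show ?case using psi_si[of x] by simp
qed (use q_nz w_eq m_le si_top si_mid si_si si_pm si_mono od_pm od_si swap_od fix_th in auto)

lemma T_phi:
  assumes "1 \<le> i" "i \<le> D" "outer i"
  shows "(\<Sum>k\<in>{1..D}. phi k * T k i) = th * phi i"
proof -
  interpret tr: crossing_matrix D m si od q w th mu lam "\<lambda>x. phi (pm x)" "\<lambda>x. psi (pm x)"
    by (rule crossing_matrix_transpose)
  have "(\<Sum>k\<in>{1..D}. phi k * T k i) = (\<Sum>k\<in>{1..D}. T i k * phi (pm (pm k)))"
    by (rule sum.cong[OF refl]) (use assms T_sym in auto)
  then show ?thesis using tr.T_psi[OF assms] assms by simp
qed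

text \<open>\<open>rr\<close> and \<open>hh\<close> are unchanged by the transposition, so both
  hypotheses carry over to the transposed data.\<close>

lemma sandwich_column:
  assumes h_bot: "\<And>z. \<lbrakk>D - m < z; z \<le> D\<rbrakk> \<Longrightarrow> hh z = mu * (dd z (pm z) * rr z + th)"
    and h_mid: "\<And>z. \<lbrakk>m < z; z \<le> D - m\<rbrakk> \<Longrightarrow>
      hh z = lam * (dd z (pm z) * rr z + (if pm z < z then w else 0)) - (lam - mu) * th"
    and j: "1 \<le> j" "j \<le> D" and i: "1 \<le> i" "i \<le> D" "outer i"
  shows "(\<Sum>k\<in>{1..D}. Sf j k * (al (pm k) * Sf k i))
    = (al (pm j) - al i) * (\<Sum>k\<in>{1..D}. Sf j k * T k i) + al i * (w * T j i + (if i = j then 1 else 0))"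
proof -
  interpret tr: crossing_matrix D m si od q w th mu lam "\<lambda>x. phi (pm x)" "\<lambda>x. psi (pm x)"
    by (rule crossing_matrix_transpose)
  have rr: "tr.rr z = rr z" if "1 \<le> z" "z \<le> D" for z unfolding tr.rr_def rr_def using that by simp
  have hh: "tr.hh z = hh z" if "z \<le> D" for z
    unfolding tr.hh_def hh_def using rr that by (intro arg_cong2[where f = "(*)"] sum.cong refl) auto
  have Sf: "tr.Sf x y = Sf y x" if "1 \<le> x" "x \<le> D" "1 \<le> y" "y \<le> D" for x y
    unfolding tr.Sf_def Sf_def using that dd_pm[of x] by auto
  have "(\<Sum>k\<in>{1..D}. tr.Sf i k * (al (pm k) * tr.Sf k j))
    = (al (pm j) - al i) * (\<Sum>k\<in>{1..D}. T i k * tr.Sf k j) + al i * (w * T i j + (if j = i then 1 else 0))"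
    by (rule tr.sandwich_row) (use h_bot h_mid hh rr i j in auto)
  moreover have "(\<Sum>k\<in>{1..D}. tr.Sf i k * (al (pm k) * tr.Sf k j)) = (\<Sum>k\<in>{1..D}. Sf j k * (al (pm k) * Sf k i))"
    by (rule sum.cong) (use Sf i j in auto)
  moreover have "(\<Sum>k\<in>{1..D}. T i k * tr.Sf k j) = (\<Sum>k\<in>{1..D}. Sf j k * T k i)"
    by (rule sum.cong) (use Sf T_sym i j in auto)
  ultimately show ?thesis using T_sym[OF i(1,2) j] by auto
qed

section \<open>Commutation of \<open>T\<close> with the crossing matrix\<close>

lemma less_si: "\<lbrakk>1 \<le> x; y \<le> D; x < y; y \<noteq> si x\<rbrakk> \<Longrightarrow> x < si y"
proof (rule ccontr)
  assume a: "1 \<le> x" "y \<le> D" "x < y" "y \<noteq> si x" "\<not> x < si y"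
  have r: "1 \<le> si y" "si y \<le> D" "si (si y) = y" "si (si x) = x" using si_range[of y] si_si[of y] si_si[of x] a by auto
  have "si y \<noteq> x" using a(4) r(3) by metis
  then have "si y < x" using a by auto
  then have "si (si y) < si x" using si_mono[of "si y" x] a r by auto
  moreover have "si x < si y" using si_mono a by auto
  ultimately show False using r a by auto
qed

lemma si_less: "\<lbrakk>1 \<le> x; y \<le> D; x < y; y \<noteq> si x\<rbrakk> \<Longrightarrow> si x < y"
proof -
  assume a: "1 \<le> x" "y \<le> D" "x < y" "y \<noteq> si x"
  have r: "1 \<le> si y" "si y \<le> D" "si (si y) = y" "1 \<le> si x" "si (si x) = x" using si_range[of y] si_range[of x] si_si[of y] si_si[of x] a by auto
  have "si x < si y" using si_mono a by auto
  moreover have "si y \<noteq> si (si x)" using r a by auto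
  ultimately show ?thesis using less_si[of "si x" "si y"] r by auto
qed

text \<open>Away from the columns \<open>pm j\<close> and \<open>pm (si j)\<close> the entries
  involved form a multiple of the identity minus a rank one matrix, and \<open>T\<close> multiplies
  both vectors of the latter by the same \<open>th\<close>. In those two columns antidiagonal
  entries appear; for a swapped pair they are \<open>- q\<close>, and they either agree on both
  sides or are balanced by a jump of the cut-off.\<close>

lemma T_Sf_comm:
  assumes j: "1 \<le> j" "j \<le> D" "outer j" and i: "1 \<le> i" "i \<le> D" "outer i"
  shows "(\<Sum>k\<in>{1..D}. T j k * Sf k i) = (\<Sum>k\<in>{1..D}. Sf j k * T k i)"
proof -
  note [[linarith_split_limit = 3, linarith_neq_limit = 1]]
  let ?t = "si j"
  have t: "1 \<le> ?t" "?t \<le> D" "si ?t = j" "si (pm j) = pm ?t" "si (pm ?t) = pm j"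
    using si_range[of j] si_si[of j] si_pm[of j] si_pm[of ?t] j by auto
  have top: "pm x \<noteq> si y \<and> pm x \<noteq> y \<and> si y \<noteq> pm x" if "outer x" "x \<le> m \<longleftrightarrow> y \<le> m" "1 \<le> x" "x \<le> D" "1 \<le> y" "y \<le> D" for x y
  proof -
    have "si y \<le> m \<longleftrightarrow> x \<le> m" using si_le_m[of y] that(2,5,6) by blast
    moreover have "pm x \<le> m \<longleftrightarrow> \<not> x \<le> m" using that(1,3,4) m_le unfolding outer_def by linarith
    ultimately show ?thesis using that(2) by metis
  qed
  have ot: "outer ?t" "?t \<le> m \<longleftrightarrow> j \<le> m" using outer_si[of j] si_le_m[of j] j by auto
  have nt: "pm j \<noteq> ?t" "pm j \<noteq> j" "pm ?t \<noteq> ?t" "pm ?t \<noteq> j"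
    using top[OF j(3) refl j(1,2) j(1,2)] top[OF ot(1) refl t(1,2) t(1,2)] top[OF ot t(1,2) j(1,2)] unfolding t(3) by blast+
  have ord: "pm j < pm ?t \<longleftrightarrow> ?t < j" "pm ?t < pm j \<longleftrightarrow> j < ?t" "pm ?t = pm j \<longleftrightarrow> ?t = j" "pm j = pm ?t \<longleftrightarrow> j = ?t"
    using j(1,2) t(1,2) by linarith+
  have de: "Sf x (pm x) = - q" if "od x" "od (pm x)" "pm x \<noteq> x" for x
    unfolding Sf_def dd_def using that(1) by (simp only: that(2) that(3) that(3)[symmetric] less_irrefl if_True if_False simp_thms) simp
  consider (gen) "i \<noteq> pm j" "i \<noteq> pm ?t" | (f) "?t = j" "i = pm j" | (B) "?t \<noteq> j" "i = pm j" | (C) "?t \<noteq> j" "i = pm ?t" by metis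
  then show ?thesis
  proof cases
    case gen
    \<comment> \<open>One cut-off value serves all entries involved, since exchanging neighbours on
      either side does not change the comparison of \<open>i\<close> with
      \<open>pm j\<close>.\<close>
    define c :: complex where "c = (if i < pm j then 1 else 0)"
    have s: "1 \<le> si i" "si i \<le> D" "si (si i) = i" using si_range[of i] si_si[of i] i by auto
    have n: "si i \<noteq> pm j" "si i \<noteq> pm ?t" using gen s(3) t(4,5) by metis+
    have le: "pm j \<le> D" "pm ?t \<le> D" using j t(1) by auto
    have ij: "i < pm ?t \<longleftrightarrow> i < pm j"
    proof
      assume a: "i < pm ?t" show "i < pm j" using less_si[OF i(1) le(2) a n(2)[symmetric]] t(5) by simp
    next
      assume a: "i < pm j" show "i < pm ?t" using less_si[OF i(1) le(1) a n(1)[symmetric]] t(4) by simp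
    qed
    have si: "si i < pm j \<longleftrightarrow> i < pm j"
    proof
      assume a: "si i < pm j" show "i < pm j" using si_less[OF s(1) le(1) a] gen(1) s(3) by simp
    next
      assume a: "i < pm j" show "si i < pm j" using si_less[OF i(1) le(1) a n(1)[symmetric]] .
    qed
    have "(\<Sum>k\<in>{1..D}. T j k * Sf k i) = (\<Sum>k\<in>{1..D}. T j k * ((if k = i then if i < pm i then w else 0 else 0) - w * c * phi i * psi (pm k)))"
    proof (rule sum.cong[OF refl])
      fix k assume "k \<in> {1..D}"
      show "T j k * Sf k i = T j k * ((if k = i then if i < pm i then w else 0 else 0) - w * c * phi i * psi (pm k))"
      proof (cases "k = j \<or> k = ?t")
        case True then show ?thesis unfolding Sf_def c_def using gen ij by auto
      next
        case False then show ?thesis unfolding T_def by auto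
      qed
    qed
    also have "\<dots> = (\<Sum>k\<in>{1..D}. if k = i then (if i < pm i then w * T j i else 0) else 0) - w * c * phi i * (\<Sum>k\<in>{1..D}. T j k * psi (pm k))"
      unfolding sum_distrib_left sum_subtractf[symmetric] by (rule sum.cong) (auto simp: algebra_simps)
    also have "\<dots> = (if i < pm i then w * T j i else 0) - w * c * th * psi (pm j) * phi i"
      unfolding T_psi[OF j] using i by auto
    also have "(if i < pm i then w * T j i else 0) = (if j < pm j then w * T j i else 0)"
    proof (cases "i = j \<or> i = ?t")
      case True
      have "j < pm j \<longleftrightarrow> j \<le> m" "?t < pm ?t \<longleftrightarrow> ?t \<le> m" using j t(1,2) ot m_le unfolding outer_def by linarith+
      then show ?thesis using True ot(2) by auto
    next
      case False then show ?thesis unfolding T_def by auto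
    qed
    also have "(if j < pm j then w * T j i else 0) - w * c * th * psi (pm j) * phi i
        = (\<Sum>k\<in>{1..D}. if k = j then (if j < pm j then w * T j i else 0) else 0) - w * c * psi (pm j) * (\<Sum>k\<in>{1..D}. phi k * T k i)"
      unfolding T_phi[OF i] using j by auto
    also have "\<dots> = (\<Sum>k\<in>{1..D}. ((if k = j then if j < pm j then w else 0 else 0) - w * c * psi (pm j) * phi k) * T k i)"
      unfolding sum_distrib_left sum_subtractf[symmetric] by (rule sum.cong) (auto simp: algebra_simps)
    also have "\<dots> = (\<Sum>k\<in>{1..D}. Sf j k * T k i)"
    proof (rule sum.cong[OF refl])
      fix k assume k: "k \<in> {1..D}"
      show "((if k = j then if j < pm j then w else 0 else 0) - w * c * psi (pm j) * phi k) * T k i = Sf j k * T k i"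
      proof (cases "k = i \<or> k = si i")
        case True then show ?thesis unfolding Sf_def c_def using gen n si by auto
      next
        case False 
        have "si k \<noteq> i" using False k si_si[of k] by auto
        then show ?thesis using False unfolding T_def by auto
      qed
    qed
    finally show ?thesis .
  next
    case f
    then show ?thesis unfolding sum_T[OF j] sum_T'[OF i] using t by simp
  next
    case B
    have q: "od j" "th = q" using swap_od[of j] j B by auto
    have de: "Sf j (pm j) = - q" using de[of j] q od_pm[of j] j(1,2) nt(2) by metis
    have S1: "Sf ?t (pm j) = (if ?t < j then - w * psi (pm ?t) * phi (pm j) else 0)"
      unfolding Sf_def by (simp only: ord nt B(1) B(1)[symmetric] if_False simp_thms split: if_split) simp
    have S2: "Sf j (pm ?t) = (if j < ?t then - w * psi (pm j) * phi (pm ?t) else 0)"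
      unfolding Sf_def by (simp only: ord nt B(1) if_False simp_thms split: if_split) simp
    \<comment> \<open>The weights of a swapped pair differ by the factor \<open>q\<close>. So the
      rank one entry present on one side only is \<open>- w * q\<close>, which matches
      \<open>w\<close> times the antidiagonal entry \<open>- q\<close> on the other.\<close>
    have e1: "psi (pm j) * phi (pm ?t) = q" if "j < ?t"
      using phi_si[of "pm ?t"] phi_psi[of "pm j"] that t(1,2) j(1,2) q(2) unfolding t(5) by (simp add: algebra_simps)
    have e2: "psi (pm ?t) * phi (pm j) = q" if "?t < j"
      using phi_si[of "pm j"] phi_psi[of "pm ?t"] that t(1,2) j(1,2) q(2) unfolding t(4) by (simp add: algebra_simps)
    have "?t < j \<or> j < ?t" using B by auto
    then show ?thesis unfolding sum_T[OF j] sum_T'[OF i] unfolding B(2) t(4,5) S1 S2 de ord using B(1) e1 e2 by (elim disjE) (simp_all add: mult.assoc)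
  next
    case C
    have q: "od j" "od ?t" using swap_od[of j] od_si[of j] j C by auto
    have de: "Sf j (pm j) = - q" "Sf ?t (pm ?t) = - q"
      using de[of j] de[of ?t] q od_pm[of j] od_pm[of ?t] j(1,2) t(1,2) nt by metis+
    show ?thesis unfolding sum_T[OF j] sum_T'[OF i] unfolding C(2) t(4,5) de ord by simp
  qed
qed

end

section \<open>The reflection equation for ungraded operators\<close>

text \<open>On the span of an outer index and its partner \<open>pm (si x)\<close>, \<open>K\<close>
  is a two by two matrix with diagonal \<open>mu, 0\<close> and determinant \<open>- p\<close>; on
  the middle block it is the scalar \<open>lam\<close>. Thus \<open>lam_sq\<close> says that the
  middle scalar is a root of the characteristic polynomial \<open>t^2 - mu t - p\<close> of the
  outer blocks.\<close>

locale reflection_data = crossing_matrix +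
  fixes be :: "nat \<Rightarrow> complex" and p :: complex
  assumes be_mid: "\<lbrakk>m < x; x \<le> D - m\<rbrakk> \<Longrightarrow> be x = 0"
    and be_be: "\<lbrakk>1 \<le> x; x \<le> D; outer x\<rbrakk> \<Longrightarrow> be x * be (D + 1 - si x) = p"
    and be_si: "\<lbrakk>1 \<le> x; x \<le> D; si x \<noteq> x\<rbrakk> \<Longrightarrow> be (si x) = - be x"
    and lam_sq: "lam * lam = mu * lam + p"
    and h_bot: "\<lbrakk>D - m < z; z \<le> D\<rbrakk> \<Longrightarrow> hh z = mu * (dd z (D + 1 - z) * rr z + th)"
    and h_mid: "\<lbrakk>m < z; z \<le> D - m\<rbrakk> \<Longrightarrow>
      hh z = lam * (dd z (D + 1 - z) * rr z + (if D + 1 - z < z then w else 0)) - (lam - mu) * th"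
begin

section \<open>Block matrices in the coordinates \<open>f\<close> and \<open>g\<close>\<close>

definition SAS :: "nat \<Rightarrow> nat \<Rightarrow> complex" where
  "SAS j i = (\<Sum>k\<in>{1..D}. Sf j k * (al (pm k) * Sf k i))"
definition PP :: "nat \<Rightarrow> nat \<Rightarrow> complex" where
  "PP j i = (\<Sum>k\<in>{1..D}. T j k * Sf k i)"
definition QQ :: "nat \<Rightarrow> nat \<Rightarrow> complex" where
  "QQ j i = (\<Sum>k\<in>{1..D}. Sf j k * T k i)"
definition TT :: "nat \<Rightarrow> nat \<Rightarrow> complex" where
  "TT j i = (\<Sum>k\<in>{1..D}. T j k * T k i)"

definition apply_mat :: "(nat \<Rightarrow> nat \<Rightarrow> complex) \<Rightarrow> (nat \<Rightarrow> complex) \<Rightarrow> nat \<Rightarrow> complex" where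
  "apply_mat M v j = (\<Sum>i\<in>{1..D}. M j i * v i)"

lemma apply_mat_add: "apply_mat M (\<lambda>k. u k + v k) j = apply_mat M u j + apply_mat M v j"
  unfolding apply_mat_def by (simp add: sum.distrib distrib_left)

lemma apply_mat_comp:
  "apply_mat M (\<lambda>k. a k * apply_mat M' v k) j = apply_mat (\<lambda>j i. \<Sum>k\<in>{1..D}. M j k * (a k * M' k i)) v j"
  unfolding apply_mat_def sum_distrib_left sum_distrib_right by (subst sum.swap) (simp add: mult.assoc)

lemma apply_mat_comp_add:
  "apply_mat M (\<lambda>k. a k * apply_mat M1 u k + b k * apply_mat M2 v k) j
    = apply_mat (\<lambda>j i. \<Sum>k\<in>{1..D}. M j k * (a k * M1 k i)) u j
      + apply_mat (\<lambda>j i. \<Sum>k\<in>{1..D}. M j k * (b k * M2 k i)) v j"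
  by (simp only: apply_mat_add apply_mat_comp)

lemma apply_mat_cong: "(\<And>i. \<lbrakk>1 \<le> i; i \<le> D\<rbrakk> \<Longrightarrow> M j i = M' j i) \<Longrightarrow> apply_mat M v j = apply_mat M' v j"
  unfolding apply_mat_def by (rule sum.cong) auto

lemma T_diag:
  assumes "\<And>x. \<lbrakk>1 \<le> x; x \<le> D\<rbrakk> \<Longrightarrow> a (si x) = a x" "1 \<le> j" "j \<le> D"
  shows "T j i * a i = a j * T j i"
  using assms unfolding T_def by auto

lemma al_si: "\<lbrakk>1 \<le> x; x \<le> D\<rbrakk> \<Longrightarrow> al (si x) = al x"
  using si_le_m[of x] outer_si[of x] m_le unfolding al_def outer_def by auto

text \<open>Both indices of a swapped pair are odd, so \<open>S\<close> exchanges
  \<open>F j (si j)\<close> and \<open>F (si j) j\<close> with sign -1. Changing the sign of one of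
  the two coordinates turns this into the symmetric matrix \<open>T\<close>.\<close>

definition eps :: "nat \<Rightarrow> complex" where "eps x = (if si x < x then -1 else 1)"

lemma eps_si: "\<lbrakk>1 \<le> x; x \<le> D; si x \<noteq> x\<rbrakk> \<Longrightarrow> eps (si x) = - eps x"
  using si_si[of x] unfolding eps_def by auto

text \<open>\<open>bf\<close> and \<open>bg\<close> are the diagonal matrices by which
  \<open>K\<close> mixes the coordinates \<open>f\<close> and \<open>g\<close>. On a swapped pair
  the sign changes of \<open>be\<close> and \<open>eps\<close> cancel, so both are constant there
  and commute with \<open>T\<close>.\<close>

definition bf :: "nat \<Rightarrow> complex" where "bf x = eps x * be (pm x)"

definition bg :: "nat \<Rightarrow> complex" where "bg x = eps x * be (si x)"

lemma bf_si: "\<lbrakk>1 \<le> x; x \<le> D\<rbrakk> \<Longrightarrow> bf (si x) = bf x"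
proof (cases "si x = x")
  case False
  assume x: "1 \<le> x" "x \<le> D"
  have "pm (si x) \<noteq> pm x" using False x si_range[of x] by linarith
  then have "be (pm (si x)) = - be (pm x)" using be_si[of "pm x"] si_pm[of x] x by simp
  then show ?thesis using eps_si[OF x False] unfolding bf_def by simp
qed simp

lemma bg_si: "\<lbrakk>1 \<le> x; x \<le> D\<rbrakk> \<Longrightarrow> bg (si x) = bg x"
  using be_si[of x] eps_si[of x] si_si[of x] unfolding bg_def by (cases "si x = x") auto

lemma bf_mid: "\<not> outer x \<Longrightarrow> bf x = 0"
proof -
  assume "\<not> outer x"
  then have "m < pm x" "pm x \<le> D - m" using m_le unfolding outer_def by linarith+
  then show ?thesis using be_mid unfolding bf_def by simp
qed

lemma bf_bg: "\<lbrakk>1 \<le> x; x \<le> D; outer x\<rbrakk> \<Longrightarrow> bf x * bg x = p"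
proof -
  assume x: "1 \<le> x" "x \<le> D" "outer x"
  have "bf x * bg x = be (pm x) * be (si x)" unfolding bf_def bg_def eps_def by simp
  also have "be (si x) = be (pm (si (pm x)))" using si_pm[of x] si_range[of x] x by simp
  finally show ?thesis using be_be[of "pm x"] outer_pm[of x] x by simp
qed

lemma SAS_row: "\<lbrakk>1 \<le> j; j \<le> D; outer j; 1 \<le> i; i \<le> D\<rbrakk> \<Longrightarrow> SAS j i + al j * PP j i = al (pm i) * PP j i + al j * TT j i"
  unfolding TT_def T_sq SAS_def PP_def by (subst sandwich_row[OF h_bot h_mid]) (auto simp: algebra_simps)

lemma SAS_column: "\<lbrakk>1 \<le> j; j \<le> D; 1 \<le> i; i \<le> D; outer i\<rbrakk> \<Longrightarrow> SAS j i + al i * QQ j i = al (pm j) * QQ j i + al i * TT j i"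
proof -
  assume a: "1 \<le> j" "j \<le> D" "1 \<le> i" "i \<le> D" "outer i"
  have "TT j i = (\<Sum>k\<in>{1..D}. T i k * T k j)" unfolding TT_def
    by (rule sum.cong[OF refl]) (use T_sym a in auto)
  then have "TT j i = w * T i j + (if j = i then 1 else 0)" using T_sq a by simp
  then have "TT j i = w * T j i + (if i = j then 1 else 0)" using T_sym a by auto
  then show ?thesis unfolding SAS_def QQ_def using sandwich_column[OF h_bot h_mid a] by (simp add: algebra_simps)
qed

lemma PP_eq_QQ: "\<lbrakk>1 \<le> j; j \<le> D; outer j; 1 \<le> i; i \<le> D; outer i\<rbrakk> \<Longrightarrow> PP j i = QQ j i"
  unfolding PP_def QQ_def by (rule T_Sf_comm)

lemma T_b: "\<lbrakk>1 \<le> j; j \<le> D\<rbrakk> \<Longrightarrow> bf j * T j i = T j i * bf i"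
  and T_c: "\<lbrakk>1 \<le> j; j \<le> D\<rbrakk> \<Longrightarrow> bg j * T j i = T j i * bg i"
  and T_al: "\<lbrakk>1 \<le> j; j \<le> D\<rbrakk> \<Longrightarrow> al j * T j i = T j i * al i"
  using T_diag[of bf j i] T_diag[of bg j i] T_diag[of al j i] bf_si bg_si al_si by auto

lemma TT_b: "\<lbrakk>1 \<le> j; j \<le> D\<rbrakk> \<Longrightarrow> bf j * TT j i = TT j i * bf i"
  and TT_c: "\<lbrakk>1 \<le> j; j \<le> D\<rbrakk> \<Longrightarrow> bg j * TT j i = TT j i * bg i"
  and TT_al: "\<lbrakk>1 \<le> j; j \<le> D\<rbrakk> \<Longrightarrow> al j * TT j i = TT j i * al i"
proof -
  have *: "a j * TT j i = TT j i * a i" if "1 \<le> j" "j \<le> D" and a: "\<And>j i. \<lbrakk>1 \<le> j; j \<le> D\<rbrakk> \<Longrightarrow> a j * T j i = T j i * a i" for a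
  proof -
    have "a j * (T j k * T k i) = T j k * T k i * a i" if "k \<in> {1..D}" for k
    proof -
      have "a j * (T j k * T k i) = T j k * (a k * T k i)" using a[of j k] \<open>1 \<le> j\<close> \<open>j \<le> D\<close> by (simp add: mult.assoc[symmetric])
      also have "\<dots> = T j k * T k i * a i" using a[of k i] that by (simp add: mult.assoc)
      finally show ?thesis .
    qed
    then show ?thesis unfolding TT_def sum_distrib_left sum_distrib_right by (intro sum.cong) auto
  qed
  assume j: "1 \<le> j" "j \<le> D"
  show "bf j * TT j i = TT j i * bf i" "bg j * TT j i = TT j i * bg i" "al j * TT j i = TT j i * al i"
    using *[OF j] T_b T_c T_al by blast+
qed

lemma TT_mid: "\<lbrakk>1 \<le> j; j \<le> D; 1 \<le> i; i \<le> D; outer j \<noteq> outer i\<rbrakk> \<Longrightarrow> TT j i = 0"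
proof -
  assume a: "1 \<le> j" "j \<le> D" "1 \<le> i" "i \<le> D" "outer j \<noteq> outer i"
  have T0: "T x y = 0" if "1 \<le> x" "x \<le> D" "outer x \<noteq> outer y" for x y
  proof -
    have "outer x \<Longrightarrow> y \<noteq> x \<and> y \<noteq> si x" using that(3) outer_si[OF that(1,2)] by blast
    then show ?thesis unfolding T_def by simp
  qed
  show "TT j i = 0" unfolding TT_def
  proof (rule sum.neutral, rule ballI)
    fix k assume "k \<in> {1..D}"
    then show "T j k * T k i = 0" using T0[OF a(1,2), of k] T0[of k i] a(5) by (cases "outer k = outer j") (simp_all only: atLeastAtMost_iff mult_zero_left mult_zero_right simp_thms)
  qed
qed

lemma al_pm:
  assumes "1 \<le> x" "x \<le> D" "outer x"
  shows "al x = mu \<and> al (pm x) = 0 \<or> al x = 0 \<and> al (pm x) = mu"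
proof (cases "x \<le> m")
  case True
  then have "\<not> pm x \<le> m" "\<not> pm x \<le> D - m" using assms m_le by linarith+
  then show ?thesis unfolding al_def using True by (simp only: if_True if_False simp_thms)
next
  case False
  then have "pm x \<le> m" "\<not> x \<le> D - m" using assms m_le unfolding outer_def by linarith+
  then show ?thesis unfolding al_def using False by (simp only: if_True if_False simp_thms)
qed

lemma al_mid:
  assumes "1 \<le> x" "x \<le> D" "\<not> outer x"
  shows "al x = lam \<and> al (pm x) = lam"
proof -
  have "\<not> x \<le> m" "x \<le> D - m" "\<not> pm x \<le> m" "pm x \<le> D - m" using assms m_le unfolding outer_def by linarith+
  then show ?thesis unfolding al_def by (simp only: if_True if_False simp_thms)
qed

text \<open>Used for one outer and one middle index: the sandwich formula makes \<open>n\<close> a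
  multiple \<open>lam - a\<close> of \<open>Q\<close>, and \<open>lam_sq\<close> does the rest
  whether the outer index is at the top or at the bottom.\<close>

lemma mid_quadratic:
  assumes "n + a * Q = lam * Q" and "a = mu \<and> a' = 0 \<or> a = 0 \<and> a' = mu"
  shows "n * a' + Q * p = lam * n"
proof -
  have n: "n = (lam - a) * Q" using assms(1) by (simp add: algebra_simps)
  have p: "p = lam * lam - mu * lam" using lam_sq by simp
  show ?thesis unfolding n p using assms(2) by (elim disjE conjE) (simp_all add: algebra_simps)
qed

text \<open>On \<open>(f, g)\<close> the operator \<open>K\<close> has the blocks
  \<open>A', bf; bg, A\<close> and \<open>S\<close> is \<open>diag (Sf, T)\<close>, so
  \<open>S K S\<close> has the blocks \<open>SAS\<close>, \<open>QQ bf\<close>,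
  \<open>bg PP\<close>, \<open>TT A\<close>. This is the first block of its commutation with
  \<open>K\<close>. For outer indices it reduces to \<open>SAS\<close> commuting with
  \<open>A'\<close>: where \<open>A'\<close> takes different values at \<open>i\<close> and
  \<open>j\<close>, both terms of the sandwich formula vanish.\<close>

lemma block_ff:
  assumes j: "1 \<le> j" "j \<le> D" and i: "1 \<le> i" "i \<le> D"
  shows "SAS j i * al (pm i) + QQ j i * (bf i * bg i) = al (pm j) * SAS j i + bf j * bg j * PP j i"
proof (cases "outer i"; cases "outer j")
  assume o: "outer i" "outer j"
  have N: "SAS j i = (al (pm i) - al j) * PP j i + TT j i * al i"
    using SAS_row[OF j o(2) i] TT_al[OF j, of i] by (simp add: algebra_simps)
  have "SAS j i * al (pm i) = al (pm j) * SAS j i"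
  proof (cases "al (pm i) = al (pm j)")
    case False
    then have "al i = al (pm j)" "al j = al (pm i)" using al_pm[OF i o(1)] al_pm[OF j o(2)] by auto
    moreover have "TT j i = 0" using TT_al[OF j, of i] calculation False by auto
    ultimately show ?thesis unfolding N by simp
  qed simp
  then show ?thesis using bf_bg[OF i o(1)] bf_bg[OF j o(2)] PP_eq_QQ[OF j o(2) i o(1)] by simp
next
  assume o: "outer i" "\<not> outer j"
  have "SAS j i + al i * QQ j i = lam * QQ j i"
    using SAS_column[OF j i o(1)] TT_mid[OF j i] o al_mid[OF j o(2)] by simp
  from mid_quadratic[OF this al_pm[OF i o(1)]] show ?thesis
    using bf_bg[OF i o(1)] bf_mid[OF o(2)] al_mid[OF j o(2)] by simp
next
  assume o: "\<not> outer i" "outer j"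
  have "SAS j i + al j * PP j i = lam * PP j i"
    using SAS_row[OF j o(2) i] TT_mid[OF j i] o al_mid[OF i o(1)] by simp
  from mid_quadratic[OF this al_pm[OF j o(2)]] show ?thesis
    using bf_bg[OF j o(2)] bf_mid[OF o(1)] al_mid[OF i o(1)] by (simp add: algebra_simps)
next
  assume o: "\<not> outer i" "\<not> outer j"
  then show ?thesis using bf_mid al_mid i j by simp
qed

text \<open>The column formula for \<open>SAS\<close>, multiplied by \<open>bf i\<close>, which is
  zero on middle columns.\<close>

lemma block_fg:
  assumes j: "1 \<le> j" "j \<le> D" and i: "1 \<le> i" "i \<le> D"
  shows "SAS j i * bf i + QQ j i * bf i * al i = al (pm j) * (QQ j i * bf i) + bf j * (TT j i * al i)"
proof (cases "outer i")
  case True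
  have "SAS j i * bf i + QQ j i * bf i * al i = (SAS j i + al i * QQ j i) * bf i" by (simp add: algebra_simps)
  also have "\<dots> = al (pm j) * (QQ j i * bf i) + (TT j i * bf i) * al i"
    unfolding SAS_column[OF j i True] by (simp add: algebra_simps)
  finally show ?thesis unfolding TT_b[OF j, symmetric] by (simp add: mult.assoc)
next
  case False
  then show ?thesis using TT_b[OF j, of i] bf_mid[OF False] by auto
qed

text \<open>The row formula for \<open>SAS\<close>, multiplied by \<open>bg j\<close>; only outer
  rows occur because \<open>g\<close> is followed only there.\<close>

lemma block_gf:
  assumes j: "1 \<le> j" "j \<le> D" "outer j" and i: "1 \<le> i" "i \<le> D"
  shows "TT j i * al i * bg i + bg j * PP j i * al (pm i) = al j * (bg j * PP j i) + bg j * SAS j i"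
proof -
  have "TT j i * al i * bg i = bg j * (al j * TT j i)"
    using TT_al[OF j(1,2), of i] TT_c[OF j(1,2), of i] by (cases "TT j i = 0") auto
  then have "TT j i * al i * bg i + bg j * PP j i * al (pm i) = bg j * (al (pm i) * PP j i + al j * TT j i)" by (simp add: algebra_simps)
  also have "\<dots> = al j * (bg j * PP j i) + bg j * SAS j i" unfolding SAS_row[OF j i, symmetric] by (simp add: algebra_simps)
  finally show ?thesis .
qed

lemma apply_mat_products:
  assumes j: "1 \<le> j" "j \<le> D"
  shows "apply_mat (\<lambda>j i. \<Sum>k\<in>{1..D}. Sf j k * (bf k * T k i)) v j = apply_mat (\<lambda>j i. QQ j i * bf i) v j"
    and "apply_mat (\<lambda>j i. \<Sum>k\<in>{1..D}. T j k * (al k * T k i)) v j = apply_mat (\<lambda>j i. TT j i * al i) v j"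
    and "apply_mat (\<lambda>j i. \<Sum>k\<in>{1..D}. T j k * (bg k * Sf k i)) v j = apply_mat (\<lambda>j i. bg j * PP j i) v j"
proof -
  show "apply_mat (\<lambda>j i. \<Sum>k\<in>{1..D}. Sf j k * (bf k * T k i)) v j = apply_mat (\<lambda>j i. QQ j i * bf i) v j"
    unfolding QQ_def sum_distrib_right using T_b by (intro apply_mat_cong sum.cong) (auto simp: mult.assoc)
  show "apply_mat (\<lambda>j i. \<Sum>k\<in>{1..D}. T j k * (al k * T k i)) v j = apply_mat (\<lambda>j i. TT j i * al i) v j"
    unfolding TT_def sum_distrib_right using T_al by (intro apply_mat_cong sum.cong) (auto simp: mult.assoc)
  show "apply_mat (\<lambda>j i. \<Sum>k\<in>{1..D}. T j k * (bg k * Sf k i)) v j = apply_mat (\<lambda>j i. bg j * PP j i) v j"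
    unfolding PP_def sum_distrib_left by (intro apply_mat_cong sum.cong refl) (simp only: mult.assoc[symmetric] T_c[OF j])
qed

lemma block_reflection_f:
  assumes j: "1 \<le> j" "j \<le> D"
  shows "apply_mat Sf (\<lambda>k. al (pm k) * apply_mat Sf (\<lambda>i. al (pm i) * f i + bf i * g i) k
          + bf k * apply_mat T (\<lambda>i. al i * g i + bg i * f i) k) j
    = al (pm j) * apply_mat Sf (\<lambda>k. al (pm k) * apply_mat Sf f k + bf k * apply_mat T g k) j
      + bf j * apply_mat T (\<lambda>k. al k * apply_mat T g k + bg k * apply_mat Sf f k) j"
  unfolding apply_mat_comp_add apply_mat_products[OF j] SAS_def[symmetric]
  unfolding apply_mat_def sum_distrib_left sum.distrib[symmetric]
proof (rule sum.cong[OF refl], goal_cases)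
  case (1 i)
  then have i: "1 \<le> i" "i \<le> D" by auto
  have "SAS j i * (al (pm i) * f i + bf i * g i) + QQ j i * bf i * (al i * g i + bg i * f i)
     = (SAS j i * al (pm i) + QQ j i * (bf i * bg i)) * f i + (SAS j i * bf i + QQ j i * bf i * al i) * g i"
    by (simp only: algebra_simps)
  also have "\<dots> = al (pm j) * (SAS j i * f i + QQ j i * bf i * g i) + bf j * (TT j i * al i * g i + bg j * PP j i * f i)"
    unfolding block_ff[OF j i] block_fg[OF j i] by (simp only: algebra_simps)
  finally show ?case by (simp only: algebra_simps)
qed

lemma block_reflection_g:
  assumes j: "1 \<le> j" "j \<le> D" "outer j"
  shows "apply_mat T (\<lambda>k. al k * apply_mat T (\<lambda>i. al i * g i + bg i * f i) k
          + bg k * apply_mat Sf (\<lambda>i. al (pm i) * f i + bf i * g i) k) j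
    = al j * apply_mat T (\<lambda>k. al k * apply_mat T g k + bg k * apply_mat Sf f k) j
      + bg j * apply_mat Sf (\<lambda>k. al (pm k) * apply_mat Sf f k + bf k * apply_mat T g k) j"
  unfolding apply_mat_comp_add apply_mat_products[OF j(1,2)] SAS_def[symmetric]
  unfolding apply_mat_def sum_distrib_left sum.distrib[symmetric]
proof (rule sum.cong[OF refl], goal_cases)
  case (1 i)
  then have i: "1 \<le> i" "i \<le> D" by auto
  have gg: "bg j * PP j i * bf i = bg j * QQ j i * bf i" using PP_eq_QQ[OF j i] bf_mid[of i] by (cases "outer i") auto
  have ga: "TT j i * al i * al i = al j * (TT j i * al i)" using TT_al[OF j(1,2), of i] by auto
  have "TT j i * al i * (al i * g i + bg i * f i) + bg j * PP j i * (al (pm i) * f i + bf i * g i)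
     = (TT j i * al i * bg i + bg j * PP j i * al (pm i)) * f i + ((TT j i * al i) * al i + bg j * PP j i * bf i) * g i"
    by (simp only: algebra_simps)
  also have "\<dots> = al j * (TT j i * al i * g i + bg j * PP j i * f i) + bg j * (SAS j i * f i + QQ j i * bf i * g i)"
    unfolding block_gf[OF j i] gg ga by (simp only: algebra_simps)
  finally show ?case by (simp only: algebra_simps)
qed

section \<open>The operators \<open>S\<close> and \<open>K\<close> on tensors\<close>

definition Kop :: "(nat \<Rightarrow> nat \<Rightarrow> complex) \<Rightarrow> nat \<Rightarrow> nat \<Rightarrow> complex" where
  "Kop F x y = al y * F x y + be y * F x (pm (si y))"

definition Sop :: "(nat \<Rightarrow> nat \<Rightarrow> complex) \<Rightarrow> nat \<Rightarrow> nat \<Rightarrow> complex" where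
  "Sop F x y = dd x y * F y x + (if x < y then w * F x y else 0)
     - (if y = pm x then w * psi y * (\<Sum>j\<in>{1..<y}. phi j * F j (pm j)) else 0)"

definition fv :: "(nat \<Rightarrow> nat \<Rightarrow> complex) \<Rightarrow> nat \<Rightarrow> complex" where "fv F j = F j (pm j)"

definition gv :: "(nat \<Rightarrow> nat \<Rightarrow> complex) \<Rightarrow> nat \<Rightarrow> complex" where "gv F j = eps j * F j (si j)"

lemma fv_Kop: "\<lbrakk>1 \<le> j; j \<le> D\<rbrakk> \<Longrightarrow> fv (Kop F) j = al (pm j) * fv F j + bf j * gv F j"
proof -
  assume j: "1 \<le> j" "j \<le> D"
  have "pm (si (pm j)) = si j" using si_pm[of j] si_range[of j] j by simp
  then show ?thesis unfolding fv_def gv_def Kop_def bf_def eps_def by simp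
qed

lemma gv_Kop: "\<lbrakk>1 \<le> j; j \<le> D\<rbrakk> \<Longrightarrow> gv (Kop F) j = al j * gv F j + bg j * fv F j"
  unfolding fv_def gv_def Kop_def bg_def using si_si[of j] al_si[of j] by (simp add: algebra_simps)

lemma fv_Sop: "\<lbrakk>1 \<le> j; j \<le> D\<rbrakk> \<Longrightarrow> fv (Sop F) j = apply_mat Sf (fv F) j"
  unfolding fv_def Sop_def apply_mat_def by (subst sum_Sf_row) auto

lemma si_neq_pm: "\<lbrakk>1 \<le> j; j \<le> D; outer j\<rbrakk> \<Longrightarrow> si j \<noteq> pm j \<and> j \<noteq> pm j"
proof -
  assume j: "1 \<le> j" "j \<le> D" "outer j"
  have "pm j \<le> m \<longleftrightarrow> \<not> j \<le> m" using j m_le unfolding outer_def by linarith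
  then show ?thesis using si_le_m[OF j(1,2)] by metis
qed

lemma gv_Sop:
  assumes j: "1 \<le> j" "j \<le> D" "outer j"
  shows "gv (Sop F) j = apply_mat T (gv F) j"
proof (cases "si j = j")
  case True
  have th: "dd j j = th"
  proof (cases "j \<le> m")
    case True
    then show ?thesis using fix_th[of j] \<open>si j = j\<close> j si_neq_pm[OF j] unfolding dd_def by auto
  next
    case False
    then have b: "pm j \<le> m" "1 \<le> pm j" using j unfolding outer_def by auto
    then show ?thesis using fix_th[of "pm j"] si_pm[of j] od_pm[of j] \<open>si j = j\<close> j si_neq_pm[OF j] unfolding dd_def by auto
  qed
  show ?thesis unfolding apply_mat_def sum_T[OF j] gv_def Sop_def using True th si_neq_pm[OF j] by simp
next
  case False
  have "od j" "od (si j)" using swap_od[OF j(1,2) False] od_si[OF j(1,2)] by auto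
  then have dd: "dd j (si j) = -1" using False si_neq_pm[OF j] unfolding dd_def by simp
  have "eps (si j) = - eps j" by (rule eps_si[OF j(1,2) False])
  then show ?thesis unfolding apply_mat_def sum_T[OF j] gv_def Sop_def using False dd si_neq_pm[OF j] si_si[OF j(1,2)]
    by (simp add: algebra_simps)
qed

lemma apply_mat_vec: "(\<And>i. \<lbrakk>1 \<le> i; i \<le> D\<rbrakk> \<Longrightarrow> u i = v i) \<Longrightarrow> apply_mat M u j = apply_mat M v j"
  unfolding apply_mat_def by (rule sum.cong) auto

lemma apply_T_vec:
  assumes "\<And>i. \<lbrakk>1 \<le> i; i \<le> D; outer i\<rbrakk> \<Longrightarrow> u i = v i" "1 \<le> j" "j \<le> D"
  shows "apply_mat T u j = apply_mat T v j"
  unfolding apply_mat_def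
proof (rule sum.cong[OF refl])
  fix i assume i: "i \<in> {1..D}"
  show "T j i * u i = T j i * v i"
  proof (cases "outer i")
    case False
    then have "T j i = 0" using outer_si[of j] assms(2,3) unfolding T_def by auto
    then show ?thesis by simp
  qed (use assms(1)[of i] i in simp)
qed

lemma fv_KSK:
  assumes "1 \<le> k" "k \<le> D"
  shows "fv (Kop (Sop G)) k = al (pm k) * apply_mat Sf (fv G) k + bf k * apply_mat T (gv G) k"
  unfolding fv_Kop[OF assms] fv_Sop[OF assms] using gv_Sop[OF assms] bf_mid[of k] by (cases "outer k") simp_all

lemma gv_KSK:
  assumes "1 \<le> k" "k \<le> D" "outer k"
  shows "gv (Kop (Sop G)) k = al k * apply_mat T (gv G) k + bg k * apply_mat Sf (fv G) k"
  unfolding gv_Kop[OF assms(1,2)] fv_Sop[OF assms(1,2)] gv_Sop[OF assms] by simp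

lemma reflection_fv:
  assumes j: "1 \<le> j" "j \<le> D"
  shows "fv (Sop (Kop (Sop (Kop F)))) j = fv (Kop (Sop (Kop (Sop F)))) j"
proof -
  have "fv (Sop (Kop (Sop (Kop F)))) j = apply_mat Sf (\<lambda>k. al (pm k) * apply_mat Sf (fv (Kop F)) k + bf k * apply_mat T (gv (Kop F)) k) j"
    unfolding fv_Sop[OF j] by (rule apply_mat_vec) (rule fv_KSK)
  also have "\<dots> = apply_mat Sf (\<lambda>k. al (pm k) * apply_mat Sf (\<lambda>i. al (pm i) * fv F i + bf i * gv F i) k
     + bf k * apply_mat T (\<lambda>i. al i * gv F i + bg i * fv F i) k) j"
    using apply_mat_vec[of "fv (Kop F)" "\<lambda>i. al (pm i) * fv F i + bf i * gv F i", OF fv_Kop]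
      apply_mat_vec[of "gv (Kop F)" "\<lambda>i. al i * gv F i + bg i * fv F i", OF gv_Kop] by simp
  also have "\<dots> = al (pm j) * apply_mat Sf (\<lambda>k. al (pm k) * apply_mat Sf (fv F) k + bf k * apply_mat T (gv F) k) j
      + bf j * apply_mat T (\<lambda>k. al k * apply_mat T (gv F) k + bg k * apply_mat Sf (fv F) k) j"
    by (rule block_reflection_f[OF j])
  also have "\<dots> = fv (Kop (Sop (Kop (Sop F)))) j"
    unfolding fv_KSK[OF j] by (intro arg_cong2[where f = "(+)"] arg_cong2[where f = "(*)"] refl apply_mat_vec apply_T_vec[OF _ j] fv_KSK[symmetric] gv_KSK[symmetric])
  finally show ?thesis .
qed

lemma reflection_gv:
  assumes j: "1 \<le> j" "j \<le> D" "outer j"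
  shows "gv (Sop (Kop (Sop (Kop F)))) j = gv (Kop (Sop (Kop (Sop F)))) j"
proof -
  have "gv (Sop (Kop (Sop (Kop F)))) j = apply_mat T (\<lambda>k. al k * apply_mat T (gv (Kop F)) k + bg k * apply_mat Sf (fv (Kop F)) k) j"
    unfolding gv_Sop[OF j] by (rule apply_T_vec[OF _ j(1,2)]) (rule gv_KSK)
  also have "\<dots> = apply_mat T (\<lambda>k. al k * apply_mat T (\<lambda>i. al i * gv F i + bg i * fv F i) k
     + bg k * apply_mat Sf (\<lambda>i. al (pm i) * fv F i + bf i * gv F i) k) j"
    using apply_mat_vec[of "fv (Kop F)" "\<lambda>i. al (pm i) * fv F i + bf i * gv F i", OF fv_Kop]
      apply_mat_vec[of "gv (Kop F)" "\<lambda>i. al i * gv F i + bg i * fv F i", OF gv_Kop] by simp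
  also have "\<dots> = al j * apply_mat T (\<lambda>k. al k * apply_mat T (gv F) k + bg k * apply_mat Sf (fv F) k) j
      + bg j * apply_mat Sf (\<lambda>k. al (pm k) * apply_mat Sf (fv F) k + bf k * apply_mat T (gv F) k) j"
    by (rule block_reflection_g[OF j])
  also have "\<dots> = gv (Kop (Sop (Kop (Sop F)))) j"
    unfolding gv_KSK[OF j] by (intro arg_cong2[where f = "(+)"] arg_cong2[where f = "(*)"] refl apply_mat_vec apply_T_vec[OF _ j(1,2)] fv_KSK[symmetric] gv_KSK[symmetric])
  finally show ?thesis .
qed

section \<open>Entries outside the coordinates \<open>f\<close> and \<open>g\<close>\<close>

definition LL :: "nat \<Rightarrow> nat \<Rightarrow> complex" where "LL x y = (if x < y then w else 0)"

text \<open>The index that \<open>K\<close> couples with \<open>x\<close>; it is an involution that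
  preserves parity and exchanges the top and bottom blocks.\<close>

abbreviation tau :: "nat \<Rightarrow> nat" where "tau x \<equiv> pm (si x)"

lemma tau_range: "\<lbrakk>1 \<le> x; x \<le> D\<rbrakk> \<Longrightarrow> 1 \<le> tau x \<and> tau x \<le> D"
  using si_range[of x] by auto

lemma tau_tau: "\<lbrakk>1 \<le> x; x \<le> D\<rbrakk> \<Longrightarrow> tau (tau x) = x"
  using si_range[of x] si_pm[of "si x"] si_si[of x] by auto

lemma od_tau: "\<lbrakk>1 \<le> x; x \<le> D\<rbrakk> \<Longrightarrow> od (tau x) = od x"
  using si_range[of x] od_pm[of "si x"] od_si[of x] by auto

lemma Sop_off: "y \<noteq> pm x \<Longrightarrow> Sop F x y = dd x y * F y x + LL x y * F x y"
  unfolding Sop_def LL_def by simp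

lemma dd_off: "\<lbrakk>y \<noteq> pm x; y \<noteq> x\<rbrakk> \<Longrightarrow> dd x y = (if od x \<and> od y then -1 else 1)"
  unfolding dd_def by auto

lemma tau_top:
  assumes "1 \<le> x" "x \<le> m"
  shows "al x = mu \<and> al (tau x) = 0 \<and> D - m < tau x"
proof -
  have "\<not> tau x \<le> m" "D - m < tau x" using si_top[OF assms] m_le by linarith+
  then show ?thesis unfolding al_def using assms by simp
qed

lemma tau_bot:
  assumes "D - m < x" "x \<le> D"
  shows "al x = 0 \<and> al (tau x) = mu \<and> tau x \<le> m"
proof -
  have "tau x \<le> m" "\<not> x \<le> m" using si_bot[OF assms] assms m_le by linarith+
  then show ?thesis unfolding al_def using assms by simp
qed

lemma position_cases:
  assumes "1 \<le> x" "x \<le> D"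
  obtains (top) "x \<le> m" "al x = mu" "al (tau x) = 0" "D - m < tau x" "be x * be (tau x) = p"
    | (mid) "m < x" "x \<le> D - m" "al x = lam" "be x = 0"
    | (bot) "D - m < x" "al x = 0" "al (tau x) = mu" "tau x \<le> m" "be x * be (tau x) = p"
proof -
  consider "x \<le> m" | "m < x" "x \<le> D - m" | "D - m < x" by linarith
  then show ?thesis
  proof cases
    case 1 then show ?thesis using top tau_top[OF assms(1)] be_be[OF assms] unfolding outer_def by blast
  next
    case 2
    then have "al x = lam" unfolding al_def by simp
    then show ?thesis using mid be_mid 2 by blast
  next
    case 3 then show ?thesis using bot tau_bot[OF _ assms(2)] be_be[OF assms] unfolding outer_def by blast
  qed
qed

text \<open>Outside a swapped pair \<open>si\<close> preserves the order, and \<open>pm\<close>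
  reverses it.\<close>

lemma tau_less_iff:
  assumes x: "1 \<le> x" "x \<le> D" and y: "1 \<le> y" "y \<le> D" and n: "y \<noteq> x" "y \<noteq> si x"
  shows "tau y < tau x \<longleftrightarrow> x < y"
proof -
  have "x \<noteq> si y" using n(2) si_si[OF y] by metis
  then have "x < y \<longleftrightarrow> si x < si y" using si_mono[of x y] si_mono[of y x] x y n by (meson linorder_neqE_nat order_less_asym)
  then show ?thesis using si_range[OF x] si_range[OF y] by linarith
qed

lemma generic_tau:
  assumes x: "1 \<le> x" "x \<le> D" and y: "1 \<le> y" "y \<le> D"
    and n: "y \<noteq> x" "y \<noteq> si x" "y \<noteq> pm x" "y \<noteq> tau x"
  shows "tau y \<noteq> x" "tau y \<noteq> si x" "tau y \<noteq> pm x" "tau y \<noteq> tau x"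
proof -
  have t: "tau (si x) = pm x" "tau (pm x) = si x" using si_si[OF x] si_pm[OF x] si_range[OF x] by auto
  have i: "tau y \<noteq> z" if "y \<noteq> tau z" for z using tau_tau[OF y] that by metis
  show "tau y \<noteq> x" "tau y \<noteq> si x" "tau y \<noteq> pm x" using i n t by metis+
  show "tau y \<noteq> tau x" using i[of "tau x"] tau_tau[OF x] n(1) by metis
qed

text \<open>These expressions multiply \<open>F y x\<close>, \<open>F x (tau y)\<close>,
  \<open>F (tau y) x\<close>, \<open>F y (tau x)\<close> and \<open>F (tau y) (tau x)\<close> in the
  difference of the two sides of the reflection equation. The positions of \<open>x\<close> and
  \<open>y\<close> fix the diagonal entries of \<open>K\<close> and enough of the order comparisons;
  a middle index together with an outer one calls for \<open>lam_sq\<close>.\<close>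

lemma generic_coefficients:
  assumes x: "1 \<le> x" "x \<le> D" and y: "1 \<le> y" "y \<le> D"
    and n: "y \<noteq> x" "y \<noteq> si x" "y \<noteq> pm x" "y \<noteq> tau x"
  shows "al x * al x * LL y x + be x * be (tau x) * LL y (tau x) + LL x y * al x * al y
      = al x * al y * LL y x + al y * al y * LL x y + be y * be (tau y) * LL x (tau y)" (is ?E1)
    and "be y * (LL x y - LL x (tau y)) * (LL x y * al y + al (tau y) * LL x (tau y)) = 0" (is ?E2)
    and "be y * (LL x y * al x - al y * LL x y - al x * LL (tau y) x - LL x (tau y) * al (tau y)) = 0" (is ?E3)
    and "be x * (al x * LL y x + LL y (tau x) * al (tau x) + LL x y * al y - al y * LL y (tau x)) = 0" (is ?E4)
    and "be x * be y * (LL x y - LL (tau y) (tau x)) = 0" (is ?E5)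
proof -
  have ty: "1 \<le> tau y" "tau y \<le> D" using tau_range[OF y] by auto
  note gt = generic_tau[OF assms]
  show ?E5 unfolding LL_def using tau_less_iff[OF x y n(1,2)] by simp
  have l: "LL y (tau x) = LL x (tau y)" unfolding LL_def using tau_less_iff[OF x ty gt(1,2)] tau_tau[OF y] by simp
  have L: "LL u v = (if u < v then w else 0)" for u v by (rule LL_def)
  have Lw: "LL u v = w" if "u < v" for u v using that by (simp add: LL_def)
  have L0: "LL u v = 0" if "v < u" for u v using that by (simp add: LL_def)
  have p: "p = lam * lam - mu * lam" using lam_sq by simp
  have xy: "LL x y = w \<and> LL y x = 0 \<or> LL x y = 0 \<and> LL y x = w" using Lw[of x y] Lw[of y x] L0[of x y] L0[of y x] n(1) by linarith
  have xt: "LL x (tau y) = w \<and> LL (tau y) x = 0 \<or> LL x (tau y) = 0 \<and> LL (tau y) x = w"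
    using Lw[of x "tau y"] Lw[of "tau y" x] L0[of x "tau y"] L0[of "tau y" x] gt(1) by linarith
  have "?E1 \<and> ?E2 \<and> ?E3 \<and> ?E4"
  using x proof (cases rule: position_cases)
    case tx: top
    show ?thesis
    using y proof (cases rule: position_cases)
      case top
      have "x < tau y" using tx top m_le by linarith
      then have "LL x (tau y) = w" "LL (tau y) x = 0" using Lw L0 by auto
      then show ?thesis unfolding l tx top using xy by (elim disjE) (simp_all)
    next
      case mid
      have "x < y" "y < tau x" using tx mid by linarith+
      then have "LL x y = w" "LL y x = 0" "LL y (tau x) = w" using Lw L0 by auto
      then show ?thesis unfolding tx mid p by (simp add: algebra_simps)
    next
      case bot
      have "x < y" using tx bot m_le by linarith
      then have "LL x y = w" "LL y x = 0" using Lw L0 by auto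
      then show ?thesis unfolding l tx bot using xt by (elim disjE) (simp_all)
    qed
  next
    case mx: mid
    show ?thesis
    using y proof (cases rule: position_cases)
      case top
      have "y < x" "x < tau y" using mx top by linarith+
      then have "LL x y = 0" "LL y x = w" "LL x (tau y) = w" "LL (tau y) x = 0" using Lw L0 by auto
      then show ?thesis unfolding mx top p by (simp add: algebra_simps)
    next
      case mid
      show ?thesis unfolding mx mid by (simp add: algebra_simps)
    next
      case bot
      have "x < y" "tau y < x" using mx bot by linarith+
      then have "LL x y = w" "LL y x = 0" "LL x (tau y) = 0" "LL (tau y) x = w" using Lw L0 by auto
      then show ?thesis unfolding mx bot p by (simp add: algebra_simps)
    qed
  next
    case bx: bot
    show ?thesis
    using y proof (cases rule: position_cases)
      case top
      have "y < x" using bx top m_le by linarith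
      then have "LL x y = 0" "LL y x = w" using Lw L0 by auto
      then show ?thesis unfolding l bx top using xt by (elim disjE) (simp_all)
    next
      case mid
      have "y < x" "tau x < y" using bx mid by linarith+
      then have "LL x y = 0" "LL y x = w" "LL y (tau x) = 0" using Lw L0 by auto
      then show ?thesis unfolding bx mid p by (simp add: algebra_simps)
    next
      case bot
      have "tau y < x" using bx bot m_le by linarith
      then have "LL x (tau y) = 0" "LL (tau y) x = w" using Lw L0 by auto
      then show ?thesis unfolding l bx bot using xy by (elim disjE) (simp_all)
    qed
  qed
  then show ?E1 ?E2 ?E3 ?E4 by blast+
qed

text \<open>The exclusions ensure that no index of \<open>{x, tau x}\<close> equals or mirrors one
  of \<open>{y, tau y}\<close>. On the eight entries formed from the two orbits \<open>S\<close> is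
  then a signed exchange plus the term \<open>LL\<close>, with one common sign since
  \<open>tau\<close> preserves parity.\<close>

lemma reflection_generic:
  assumes x: "1 \<le> x" "x \<le> D" and y: "1 \<le> y" "y \<le> D"
    and n: "y \<noteq> x" "y \<noteq> si x" "y \<noteq> pm x" "y \<noteq> tau x"
  shows "Sop (Kop (Sop (Kop F))) x y = Kop (Sop (Kop (Sop F))) x y"
proof -
  define s :: complex where "s = (if od x \<and> od y then -1 else 1)"
  note gt = generic_tau[OF assms]
  have pt: "pm (tau x) = si x" using si_range[OF x] by simp
  have S: "Sop G u v = s * G v u + LL u v * G u v \<and> Sop G v u = s * G u v + LL v u * G v u"
    if "u = x \<or> u = tau x" "v = y \<or> v = tau y" for u v G
  proof -
    have uv: "1 \<le> u" "u \<le> D" "1 \<le> v" "v \<le> D" "od u = od x" "od v = od y"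
      using that tau_range x y od_tau by auto
    have "v \<noteq> u \<and> v \<noteq> pm u" using that n gt pt by metis
    then have "v \<noteq> u" "v \<noteq> pm u" by auto
    moreover have "u \<noteq> v" "u \<noteq> pm v" using calculation uv by linarith+
    ultimately show ?thesis using Sop_off dd_off uv(5,6) unfolding s_def by simp
  qed
  note S1 = S[of x y] S[of x "tau y"] S[of "tau x" y] S[of "tau x" "tau y"]
  note E = generic_coefficients[OF assms]
  have K: "Kop G u y = al y * G u y + be y * G u (tau y)" "Kop G u (tau y) = al (tau y) * G u (tau y) + be (tau y) * G u y"
     "Kop G u x = al x * G u x + be x * G u (tau x)" "Kop G u (tau x) = al (tau x) * G u (tau x) + be (tau x) * G u x" for G u
    unfolding Kop_def tau_tau[OF x] tau_tau[OF y] by simp_all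
  have "Sop (Kop (Sop (Kop F))) x y - Kop (Sop (Kop (Sop F))) x y
    = s * F y x * ((al x * al x * LL y x + be x * be (tau x) * LL y (tau x) + LL x y * al x * al y)
      - (al x * al y * LL y x + al y * al y * LL x y + be y * be (tau y) * LL x (tau y)))
    + F x (tau y) * (be y * (LL x y - LL x (tau y)) * (LL x y * al y + al (tau y) * LL x (tau y)))
    + s * F (tau y) x * (be y * (LL x y * al x - al y * LL x y - al x * LL (tau y) x - LL x (tau y) * al (tau y)))
    + s * F y (tau x) * (be x * (al x * LL y x + LL y (tau x) * al (tau x) + LL x y * al y - al y * LL y (tau x)))
    + s * F (tau y) (tau x) * (be x * be y * (LL x y - LL (tau y) (tau x)))"
    using S1 unfolding K by (simp only: simp_thms K) (simp only: algebra_simps)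
  also have "\<dots> = 0" unfolding E by simp
  finally show ?thesis by simp
qed

text \<open>Both indices lie in one orbit \<open>{x, tau x}\<close> of odd indices, where
  \<open>S\<close> has the scalar \<open>-1/q\<close> on equal indices and a Hecke block with
  exchange coefficient -1 on the other two entries.\<close>

lemma reflection_orbit:
  assumes x: "1 \<le> x" "x \<le> D" and sx: "si x \<noteq> x"
  shows "Sop (Kop (Sop (Kop F))) x x = Kop (Sop (Kop (Sop F))) x x"
    and "Sop (Kop (Sop (Kop F))) x (tau x) = Kop (Sop (Kop (Sop F))) x (tau x)"
proof -
  define e where "e = - inverse q"
  let ?a = "al x" and ?a' = "al (tau x)" and ?b = "be x" and ?b' = "be (tau x)"
    and ?L = "LL x (tau x)" and ?M = "LL (tau x) x"
  have ox: "outer x" using si_mid[of x] sx unfolding outer_def by linarith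
  have tr: "1 \<le> tau x" "tau x \<le> D" "tau (tau x) = x" using tau_range[OF x] tau_tau[OF x] by auto
  have od: "od x" "od (tau x)" using swap_od[OF x sx] od_tau[OF x] by auto
  have pt: "pm (tau x) = si x" using si_range[OF x] by simp
  have ne: "x \<noteq> pm x" "tau x \<noteq> x" "tau x \<noteq> pm x" "x \<noteq> tau x" "x \<noteq> pm (tau x)" "tau x \<noteq> pm (tau x)"
    using si_neq_pm[OF x ox] si_neq_pm[of "si x"] outer_si[OF x] ox si_range[OF x] x sx si_si[OF x] pt by (simp_all)
  have S: "Sop G x x = e * G x x" "Sop G (tau x) (tau x) = e * G (tau x) (tau x)"
    "Sop G x (tau x) = - G (tau x) x + ?L * G x (tau x)" "Sop G (tau x) x = - G x (tau x) + ?M * G (tau x) x" for G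
    using ne od Sop_off[of x x G] Sop_off[of "tau x" "tau x" G] Sop_off[of "tau x" x G] Sop_off[of x "tau x" G] unfolding e_def dd_def LL_def by simp_all
  have K: "Kop G u x = ?a * G u x + ?b * G u (tau x)" "Kop G u (tau x) = ?a' * G u (tau x) + ?b' * G u x" for G u
    unfolding Kop_def tr(3) by simp_all
  have e: "e * e = 1 + w * e" unfolding e_def w_eq using q_nz by (simp add: field_simps)
  \<comment> \<open>At the top \<open>x < tau x\<close> gives \<open>?M = 0\<close> and
    \<open>?L = w\<close>, while \<open>al (tau x) = 0\<close>; the last factor is then the
    quadratic relation for \<open>e\<close>. At the bottom \<open>al x = 0\<close> and
    \<open>?L = 0\<close>.\<close>
  have Z: "?a * ?M = 0 \<and> ?L * ?a' = 0 \<and> ?a * (1 + ?L * e - e * e) = 0"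
    using x
  proof (cases rule: position_cases)
    case top
    have "x < tau x" using top m_le by linarith
    then show ?thesis unfolding e LL_def using top by simp
  next
    case mid then show ?thesis using ox unfolding outer_def by linarith
  next
    case bot
    have "tau x < x" using bot m_le by linarith
    then show ?thesis unfolding LL_def using bot by simp
  qed
  note z = Z[THEN conjunct1] Z[THEN conjunct2, THEN conjunct1] Z[THEN conjunct2, THEN conjunct2]
  have "Sop (Kop (Sop (Kop F))) x x - Kop (Sop (Kop (Sop F))) x x =
      - (?b * F x (tau x)) * (?a * (1 + ?L * e - e * e)) + ?b * F x (tau x) * (e - ?L) * (?L * ?a')
      + ?b * F (tau x) x * (?a * ?M + ?L * ?a')"
    unfolding S K unfolding S K unfolding S K unfolding S K by (simp add: algebra_simps)
  then show "Sop (Kop (Sop (Kop F))) x x = Kop (Sop (Kop (Sop F))) x x" unfolding z by simp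
  have "Sop (Kop (Sop (Kop F))) x (tau x) - Kop (Sop (Kop (Sop F))) x (tau x) =
      ?b' * F x x * (?a * (1 + ?L * e - e * e) + (?L - e) * (?L * ?a'))
      - F (tau x) x * ((?a * ?M) * (?a - ?a') + (?L * ?a') * (?a - ?a'))
      - F (tau x) (tau x) * ?b * (?a * ?M + ?L * ?a')"
    unfolding S K unfolding S K unfolding S K unfolding S K by (simp add: algebra_simps)
  then show "Sop (Kop (Sop (Kop F))) x (tau x) = Kop (Sop (Kop (Sop F))) x (tau x)" unfolding z by simp
qed

lemma reflection_pointwise:
  assumes x: "1 \<le> x" "x \<le> D" and y: "1 \<le> y" "y \<le> D"
  shows "Sop (Kop (Sop (Kop F))) x y = Kop (Sop (Kop (Sop F))) x y"
proof -
  \<comment> \<open>For \<open>si x = x\<close> the partner \<open>tau x\<close> is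
    \<open>pm x\<close>, so the equal-orbit entries are already covered by the first three
    cases.\<close>
  consider "y = pm x" | "y = si x" "outer x" | "y = x" "si x = x" "\<not> outer x" "y \<noteq> pm x"
    | "si x \<noteq> x" "y = x \<or> y = tau x" | "y \<noteq> x" "y \<noteq> si x" "y \<noteq> pm x" "y \<noteq> tau x"
    using si_mid[of x] unfolding outer_def by (metis not_le)
  then show ?thesis
  proof cases
    case 1 then show ?thesis using reflection_fv[OF x] unfolding fv_def by simp
  next
    case 2
    have "eps x \<noteq> 0" unfolding eps_def by simp
    then show ?thesis using reflection_gv[OF x 2(2)] 2(1) unfolding gv_def by simp
  next
    case 3
    then have "be x = 0" using be_mid[of x] unfolding outer_def by simp
    then have K: "Kop G x x = al x * G x x" for G unfolding Kop_def by simp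
    have S: "Sop G x x = dd x x * G x x" for G using Sop_off[of x x G] 3 unfolding LL_def by simp
    show ?thesis unfolding 3(1) S K by simp
  next
    case 4 then show ?thesis using reflection_orbit[OF x 4(1)] by auto
  next
    case 5 then show ?thesis by (rule reflection_generic[OF x y])
  qed
qed

end

section \<open>Removing the grading\<close>

text \<open>\<open>e_xb\<close> tensor \<open>e_yd\<close> sends \<open>v_b\<close> tensor
  \<open>v_d\<close> to \<open>v_x\<close> tensor \<open>v_y\<close>, with the sign from moving
  \<open>e_yd\<close> past \<open>v_b\<close>; \<open>F\<close> holds the coordinates of a
  tensor.\<close>

definition opr :: "nat \<Rightarrow> (nat \<Rightarrow> nat) \<Rightarrow> (nat \<Rightarrow> nat \<Rightarrow> nat \<Rightarrow> nat \<Rightarrow> complex)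
    \<Rightarrow> (nat \<Rightarrow> nat \<Rightarrow> complex) \<Rightarrow> nat \<Rightarrow> nat \<Rightarrow> complex" where
  "opr D p X F x y = (\<Sum>b\<in>{1..D}. \<Sum>d\<in>{1..D}. (-1) ^ ((p y + p d) * p b) * X x b y d * F b d)"

lemma opr_cong:
  assumes "\<And>b d. \<lbrakk>1 \<le> b; b \<le> D; 1 \<le> d; d \<le> D\<rbrakk> \<Longrightarrow> F b d = G b d"
  shows "opr D p X F x y = opr D p X G x y"
  unfolding opr_def using assms by (intro sum.cong refl) simp

text \<open>The signs agree because the two exponents have the same parity; the rest is a
  rearrangement of finite sums.\<close>

lemma opr_gmul: "opr D p (gmul D p X Y) F x y = opr D p X (opr D p Y F) x y"
proof -
  have sgn: "(-1::complex) ^ ((p y + p d) * p b) * (-1) ^ ((p y + p l) * (p j + p b))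
      = (-1) ^ ((p y + p l) * p j) * (-1) ^ ((p l + p d) * p b)" for b d j l
  proof -
    have "even ((p y + p d) * p b + (p y + p l) * (p j + p b)) = even ((p y + p l) * p j + (p l + p d) * p b)"
      by (cases "even (p y)"; cases "even (p d)"; cases "even (p b)"; cases "even (p l)"; cases "even (p j)"; simp)
    then show ?thesis unfolding power_add[symmetric] by (simp add: minus_one_power_iff)
  qed
  have "opr D p (gmul D p X Y) F x y = (\<Sum>b\<in>{1..D}. \<Sum>d\<in>{1..D}. \<Sum>j\<in>{1..D}. \<Sum>l\<in>{1..D}.
      ((-1) ^ ((p y + p d) * p b) * (-1) ^ ((p y + p l) * (p j + p b))) * (X x j y l * Y j b l d * F b d))"
    unfolding opr_def gmul_def sum_distrib_left sum_distrib_right by (intro sum.cong refl) (simp only: ac_simps)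
  also have "\<dots> = (\<Sum>b\<in>{1..D}. \<Sum>j\<in>{1..D}. \<Sum>d\<in>{1..D}. \<Sum>l\<in>{1..D}.
      ((-1) ^ ((p y + p l) * p j) * (-1) ^ ((p l + p d) * p b)) * (X x j y l * Y j b l d * F b d))"
    unfolding sgn by (intro sum.cong refl sum.swap)
  also have "\<dots> = (\<Sum>j\<in>{1..D}. \<Sum>b\<in>{1..D}. \<Sum>l\<in>{1..D}. \<Sum>d\<in>{1..D}.
      ((-1) ^ ((p y + p l) * p j) * (-1) ^ ((p l + p d) * p b)) * (X x j y l * Y j b l d * F b d))"
    by (subst sum.swap) (intro sum.cong refl sum.swap)
  also have "\<dots> = (\<Sum>j\<in>{1..D}. \<Sum>l\<in>{1..D}. \<Sum>b\<in>{1..D}. \<Sum>d\<in>{1..D}.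
      ((-1) ^ ((p y + p l) * p j) * (-1) ^ ((p l + p d) * p b)) * (X x j y l * Y j b l d * F b d))"
    by (intro sum.cong refl sum.swap)
  also have "\<dots> = opr D p X (opr D p Y F) x y"
    unfolding opr_def sum_distrib_left sum_distrib_right by (intro sum.cong refl) (simp only: ac_simps)
  finally show ?thesis .
qed

lemma opr_unit:
  assumes "1 \<le> j" "j \<le> D" "1 \<le> l" "l \<le> D"
  shows "opr D p X (\<lambda>b d. if b = j \<and> d = l then 1 else 0) i k = (-1) ^ ((p k + p l) * p j) * X i j k l"
proof -
  have "opr D p X (\<lambda>b d. if b = j \<and> d = l then 1 else 0) i k
    = (\<Sum>b\<in>{1..D}. if b = j then \<Sum>d\<in>{1..D}. if d = l then (-1) ^ ((p k + p d) * p b) * X i b k d else 0 else 0)"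
    unfolding opr_def by (intro sum.cong refl) (auto simp del: sum.delta sum.delta' intro!: sum.cong sum.neutral)
  then show ?thesis using assms by simp
qed

text \<open>The action is faithful: basis tensors recover each coefficient up to a sign independent
  of the operator.\<close>

lemma opr_eqD:
  assumes "\<And>F. opr D p X F i k = opr D p Y F i k" "1 \<le> j" "j \<le> D" "1 \<le> l" "l \<le> D"
  shows "X i j k l = Y i j k l"
  using assms(1)[of "\<lambda>b d. if b = j \<and> d = l then 1 else 0"] unfolding opr_unit[OF assms(2-5)] by simp

text \<open>\<open>SS\<close> and \<open>KK\<close> need to match the actions only inside the index
  range, since \<open>opr\<close> never reads entries outside it.\<close>

lemma reflection_eqI:
  assumes "\<And>F x y. \<lbrakk>1 \<le> x; x \<le> dimV g nb mb; 1 \<le> y; y \<le> dimV g nb mb\<rbrakk> \<Longrightarrow>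
      opr (dimV g nb mb) (par g nb mb) (Smat g nb mb s) F x y = SS F x y"
    and "\<And>F x y. \<lbrakk>1 \<le> x; x \<le> dimV g nb mb; 1 \<le> y; y \<le> dimV g nb mb\<rbrakk> \<Longrightarrow>
      opr (dimV g nb mb) (par g nb mb) (K2 K) F x y = KK F x y"
    and "\<And>F x y. \<lbrakk>1 \<le> x; x \<le> dimV g nb mb; 1 \<le> y; y \<le> dimV g nb mb\<rbrakk> \<Longrightarrow>
      SS (KK (SS (KK F))) x y = KK (SS (KK (SS F))) x y"
  shows "reflection_eq g nb mb s K"
proof -
  let ?D = "dimV g nb mb" and ?p = "par g nb mb"
  let ?o = "opr ?D ?p" let ?S = "?o (Smat g nb mb s)" let ?K = "?o (K2 K)"
  have "gmul ?D ?p (gmul ?D ?p (gmul ?D ?p (Smat g nb mb s) (K2 K)) (Smat g nb mb s)) (K2 K) i j k l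
      = gmul ?D ?p (gmul ?D ?p (gmul ?D ?p (K2 K) (Smat g nb mb s)) (K2 K)) (Smat g nb mb s) i j k l"
    if i: "1 \<le> i" "i \<le> ?D" and j: "1 \<le> j" "j \<le> ?D" and k: "1 \<le> k" "k \<le> ?D" and l: "1 \<le> l" "l \<le> ?D" for i j k l
  proof (rule opr_eqD[OF _ j l])
    fix F
    have "?S (?K (?S (?K F))) i k = SS (KK (SS (KK F))) i k"
    proof -
      have "?S (?K (?S (?K F))) i k = ?S (?K (?S (KK F))) i k" by (intro opr_cong assms(2))
      also have "\<dots> = ?S (?K (SS (KK F))) i k" by (intro opr_cong assms(1))
      also have "\<dots> = ?S (KK (SS (KK F))) i k" by (intro opr_cong assms(2))
      also have "\<dots> = SS (KK (SS (KK F))) i k" by (intro assms(1) i k)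
      finally show ?thesis .
    qed
    moreover have "?K (?S (?K (?S F))) i k = KK (SS (KK (SS F))) i k"
    proof -
      have "?K (?S (?K (?S F))) i k = ?K (?S (?K (SS F))) i k" by (intro opr_cong assms(1))
      also have "\<dots> = ?K (?S (KK (SS F))) i k" by (intro opr_cong assms(2))
      also have "\<dots> = ?K (SS (KK (SS F))) i k" by (intro opr_cong assms(1))
      also have "\<dots> = KK (SS (KK (SS F))) i k" by (intro assms(2) i k)
      finally show ?thesis .
    qed
    ultimately show "?o (gmul ?D ?p (gmul ?D ?p (gmul ?D ?p (Smat g nb mb s) (K2 K)) (Smat g nb mb s)) (K2 K)) F i k
      = ?o (gmul ?D ?p (gmul ?D ?p (gmul ?D ?p (K2 K) (Smat g nb mb s)) (K2 K)) (Smat g nb mb s)) F i k"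
      unfolding opr_gmul using assms(3)[OF i k] by simp
  qed
  then show ?thesis unfolding reflection_eq_def Let_def by simp
qed

lemma opr_K2:
  assumes x: "1 \<le> x" "x \<le> D" and "\<And>d. \<lbrakk>1 \<le> d; d \<le> D; K y d \<noteq> 0\<rbrakk> \<Longrightarrow> p y = p d"
  shows "opr D p (K2 K) F x y = (\<Sum>d\<in>{1..D}. K y d * F x d)"
proof -
  have "opr D p (K2 K) F x y = (\<Sum>b\<in>{1..D}. if b = x then \<Sum>d\<in>{1..D}. (-1) ^ ((p y + p d) * p b) * K y d * F b d else 0)"
    unfolding opr_def K2_def by (intro sum.cong refl) (auto simp del: sum.delta sum.delta' intro!: sum.neutral sum.cong)
  also have "\<dots> = (\<Sum>d\<in>{1..D}. (-1) ^ ((p y + p d) * p x) * K y d * F x d)" using x by simp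
  also have "\<dots> = (\<Sum>d\<in>{1..D}. K y d * F x d)"
  proof (intro sum.cong refl)
    fix d assume "d \<in> {1..D}"
    then have "K y d = 0 \<or> p y = p d" using assms(3)[of d] by auto
    then show "(-1) ^ ((p y + p d) * p x) * K y d * F x d = K y d * F x d" by auto
  qed
  finally show ?thesis .
qed

lemma par01: "par g nb mb i = 0 \<or> par g nb mb i = 1"
  unfolding par_def by simp

lemma par_pr: "\<lbrakk>1 \<le> i; i \<le> dimV g nb mb\<rbrakk> \<Longrightarrow> par g nb mb (pr g nb mb i) = par g nb mb i"
  unfolding par_def pr_def dimV_def by auto

lemma opr_Pmat:
  assumes "1 \<le> x" "x \<le> dimV g nb mb" "1 \<le> y" "y \<le> dimV g nb mb"
  shows "opr (dimV g nb mb) (par g nb mb) (Pmat g nb mb) G x y = (-1) ^ (par g nb mb x * par g nb mb y) * G y x"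
proof -
  let ?D = "dimV g nb mb" and ?p = "par g nb mb"
  have "opr ?D ?p (Pmat g nb mb) G x y = (\<Sum>b\<in>{1..?D}. if b = y then \<Sum>d\<in>{1..?D}.
      if d = x then (-1) ^ ((?p y + ?p x) * ?p y) * (-1) ^ ?p y * G y x else 0 else 0)"
    unfolding opr_def Pmat_def by (intro sum.cong refl) (auto simp del: sum.delta sum.delta' intro!: sum.neutral sum.cong)
  then show ?thesis using assms par01[of g nb mb x] par01[of g nb mb y] by auto
qed

lemma opr_Rmat:
  assumes x: "1 \<le> x" "x \<le> dimV g nb mb" and y: "1 \<le> y" "y \<le> dimV g nb mb" and s: "s \<noteq> 0"
  shows "opr (dimV g nb mb) (par g nb mb) (Rmat g nb mb s) F x y
    = s\<^sup>2 powi ((-1) ^ par g nb mb y * ((if x = y then 1 else 0) - (if x = pr g nb mb y then 1 else 0))) * F x y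
      + (if y < x then (s\<^sup>2 - inverse (s\<^sup>2)) * (-1) ^ (par g nb mb x * par g nb mb y) * F y x else 0)
      - (if y = pr g nb mb x then (s\<^sup>2 - inverse (s\<^sup>2)) * (-1) ^ par g nb mb x * (kappa g nb mb x * s powi rho2 g nb mb x)
          * (\<Sum>j\<in>{1..<x}. kappa g nb mb j * s powi (- rho2 g nb mb j) * F j (pr g nb mb j)) else 0)"
proof -
  let ?D = "dimV g nb mb" and ?p = "par g nb mb" and ?c = "pr g nb mb" and ?w = "s\<^sup>2 - inverse (s\<^sup>2)"
  let ?k = "kappa g nb mb" and ?r = "rho2 g nb mb"
  let ?q = "s\<^sup>2 powi ((-1) ^ ?p y * ((if x = y then 1 else 0) - (if x = ?c y then 1 else 0)))"
  define sg where "sg b d = (-1::complex) ^ ((?p y + ?p d) * ?p b)" for b d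
  have split: "(\<Sum>b\<in>{1..?D}. \<Sum>d\<in>{1..?D}. sg b d * (X b d + Y b d - Z b d) * F b d)
    = (\<Sum>b\<in>{1..?D}. \<Sum>d\<in>{1..?D}. sg b d * X b d * F b d) + (\<Sum>b\<in>{1..?D}. \<Sum>d\<in>{1..?D}. sg b d * Y b d * F b d)
    - (\<Sum>b\<in>{1..?D}. \<Sum>d\<in>{1..?D}. sg b d * Z b d * F b d)" for X Y Z
    unfolding sum.distrib[symmetric] sum_subtractf[symmetric] by (intro sum.cong refl) (simp only: algebra_simps)
  have t1: "(\<Sum>b\<in>{1..?D}. \<Sum>d\<in>{1..?D}. sg b d * (if x = b \<and> y = d then ?q else 0) * F b d) = ?q * F x y"
  proof -
    have "(\<Sum>b\<in>{1..?D}. \<Sum>d\<in>{1..?D}. sg b d * (if x = b \<and> y = d then ?q else 0) * F b d)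
      = (\<Sum>b\<in>{1..?D}. if b = x then \<Sum>d\<in>{1..?D}. if d = y then sg x y * ?q * F x y else 0 else 0)"
      by (intro sum.cong refl) (auto simp del: sum.delta sum.delta' intro!: sum.neutral sum.cong)
    moreover have "sg x y = 1" unfolding sg_def using par01[of g nb mb y] by auto
    ultimately show ?thesis using x y by simp
  qed
  have t2: "(\<Sum>b\<in>{1..?D}. \<Sum>d\<in>{1..?D}. sg b d * (if b < x \<and> y = b \<and> d = x then ?w * (-1) ^ ?p b else 0) * F b d)
    = (if y < x then ?w * (-1) ^ (?p x * ?p y) * F y x else 0)"
  proof -
    have "(\<Sum>b\<in>{1..?D}. \<Sum>d\<in>{1..?D}. sg b d * (if b < x \<and> y = b \<and> d = x then ?w * (-1) ^ ?p b else 0) * F b d)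
      = (\<Sum>b\<in>{1..?D}. if b = y then \<Sum>d\<in>{1..?D}. if d = x then (if y < x then sg y x * (?w * (-1) ^ ?p y) * F y x else 0) else 0 else 0)"
      by (intro sum.cong refl) (auto simp del: sum.delta sum.delta' intro!: sum.neutral sum.cong)
    moreover have "sg y x * (?w * (-1) ^ ?p y) = ?w * (-1) ^ (?p x * ?p y)"
      unfolding sg_def using par01[of g nb mb y] par01[of g nb mb x] by auto
    ultimately show ?thesis using x y by simp
  qed
  have t3: "(\<Sum>b\<in>{1..?D}. \<Sum>d\<in>{1..?D}. sg b d * (if b < x \<and> y = ?c x \<and> d = ?c b then
        ?w * (-1) ^ (?p x + ?p b + ?p x * ?p b) * ?k x * ?k b * s powi (?r x - ?r b) else 0) * F b d)
    = (if y = ?c x then ?w * (-1) ^ ?p x * (?k x * s powi ?r x) * (\<Sum>j\<in>{1..<x}. ?k j * s powi (- ?r j) * F j (?c j)) else 0)"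
  proof (cases "y = ?c x")
    case True
    have py: "?p y = ?p x" using True par_pr[OF x] by simp
    have "(\<Sum>b\<in>{1..?D}. \<Sum>d\<in>{1..?D}. sg b d * (if b < x \<and> y = ?c x \<and> d = ?c b then
        ?w * (-1) ^ (?p x + ?p b + ?p x * ?p b) * ?k x * ?k b * s powi (?r x - ?r b) else 0) * F b d)
      = (\<Sum>b\<in>{1..?D}. if b < x then \<Sum>d\<in>{1..?D}. if d = ?c b then
        sg b (?c b) * (?w * (-1) ^ (?p x + ?p b + ?p x * ?p b) * ?k x * ?k b * s powi (?r x - ?r b)) * F b (?c b) else 0 else 0)"
      using True by (intro sum.cong refl) (auto simp del: sum.delta sum.delta' intro!: sum.neutral sum.cong)
    also have "\<dots> = (\<Sum>b\<in>{1..<x}. \<Sum>d\<in>{1..?D}. if d = ?c b then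
        sg b (?c b) * (?w * (-1) ^ (?p x + ?p b + ?p x * ?p b) * ?k x * ?k b * s powi (?r x - ?r b)) * F b (?c b) else 0)"
      by (rule sum.mono_neutral_cong_right) (use x in auto)
    also have "\<dots> = (\<Sum>b\<in>{1..<x}. ?w * (-1) ^ ?p x * (?k x * s powi ?r x) * (?k b * s powi (- ?r b) * F b (?c b)))"
    proof (intro sum.cong refl)
      fix b assume b: "b \<in> {1..<x}"
      then have bD: "1 \<le> b" "b \<le> ?D" using x by auto
      have cb: "?c b \<in> {1..?D}" using bD unfolding pr_def by auto
      \<comment> \<open>Modulo 2 the exponents add up to \<open>p x\<close>, because
        \<open>p b * p b + p b\<close> is even.\<close>
      have sgn: "sg b (?c b) * (-1) ^ (?p x + ?p b + ?p x * ?p b) = (-1) ^ ?p x"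
        unfolding sg_def py par_pr[OF bD] using par01[of g nb mb b] par01[of g nb mb x] by auto
      have pw: "s powi (?r x - ?r b) = s powi ?r x * s powi (- ?r b)" using s power_int_add[of s "?r x" "- ?r b"] by simp
      show "(\<Sum>d\<in>{1..?D}. if d = ?c b then sg b (?c b) * (?w * (-1) ^ (?p x + ?p b + ?p x * ?p b) * ?k x * ?k b * s powi (?r x - ?r b)) * F b (?c b) else 0)
        = ?w * (-1) ^ ?p x * (?k x * s powi ?r x) * (?k b * s powi (- ?r b) * F b (?c b))"
        unfolding pw sgn[symmetric] using cb by (simp only: sum.delta finite_atLeastAtMost if_True) (simp only: ac_simps)
    qed
    finally show ?thesis unfolding if_P[OF True] sum_distrib_left .
  next
    case False then show ?thesis by simp
  qed
  show ?thesis unfolding opr_def Rmat_def Let_def sg_def[symmetric] split t1 t2 t3 by (rule refl)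
qed

text \<open>The flip exchanges \<open>x\<close> and \<open>y\<close> and contributes
  \<open>(-1)^(|x||y|)\<close>, which cancels the signs of the second and third terms of
  \<open>R\<close>. Only the exchange coefficient keeps a sign.\<close>

lemma opr_Smat:
  assumes x: "1 \<le> x" "x \<le> dimV g nb mb" and y: "1 \<le> y" "y \<le> dimV g nb mb" and s: "s \<noteq> 0"
  shows "opr (dimV g nb mb) (par g nb mb) (Smat g nb mb s) F x y
    = (-1) ^ (par g nb mb x * par g nb mb y)
        * s\<^sup>2 powi ((-1) ^ par g nb mb x * ((if y = x then 1 else 0) - (if y = pr g nb mb x then 1 else 0))) * F y x
      + (if x < y then (s\<^sup>2 - inverse (s\<^sup>2)) * F x y else 0)
      - (if y = pr g nb mb x then (s\<^sup>2 - inverse (s\<^sup>2)) * (kappa g nb mb y * s powi rho2 g nb mb y)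
          * (\<Sum>j\<in>{1..<y}. kappa g nb mb j * s powi (- rho2 g nb mb j) * F j (pr g nb mb j)) else 0)"
proof -
  let ?p = "par g nb mb"
  have e: "x = pr g nb mb y \<longleftrightarrow> y = pr g nb mb x" using x y unfolding pr_def by auto
  have sq: "(-1::complex) ^ (?p x * ?p y) * (-1) ^ (?p y * ?p x) = 1"
    using par01[of g nb mb y] par01[of g nb mb x] by auto
  have sp: "(-1::complex) ^ (?p x * ?p y) * (-1) ^ ?p y = 1" if "y = pr g nb mb x"
    using par_pr[OF x] that par01[of g nb mb x] by auto
  have B: "(-1) ^ (?p x * ?p y) * (if x < y then W * (-1) ^ (?p y * ?p x) * Z else 0) = (if x < y then W * Z else 0)" for W Z :: complex
    using sq by (simp add: mult.left_commute mult.assoc[symmetric])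
  have C: "(-1) ^ (?p x * ?p y) * (if y = pr g nb mb x then W * (-1) ^ ?p y * Y * Z else 0) = (if y = pr g nb mb x then W * Y * Z else 0)" for W Y Z :: complex
  proof (cases "y = pr g nb mb x")
    case True
    have "(-1) ^ (?p x * ?p y) * (W * (-1) ^ ?p y * Y * Z) = ((-1) ^ (?p x * ?p y) * (-1) ^ ?p y) * (W * Y * Z)" by (simp only: ac_simps)
    then show ?thesis using True sp[OF True] by simp
  qed simp
  show ?thesis unfolding Smat_def opr_gmul opr_Pmat[OF x y] opr_Rmat[OF y x s] e
    by (subst right_diff_distrib, subst distrib_left, unfold B C, simp only: mult.assoc)
qed

section \<open>The weights of the natural representation\<close>

lemma rho2_OspOdd:
  assumes "t < 2 * nb + 1 + 2 * mb"
  shows "rho2 OspOdd nb mb (Suc t) = (let t' = int t; n = int nb; k = int mb in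
    if t < mb then 2 * n + 1 - 2 * k + 2 * t' else if t < mb + nb then 2 * n - 1 - 2 * (t' - k)
    else if t = mb + nb then 0 else if t < mb + 2 * nb + 1 then - (2 * (t' - k - n - 1) + 1)
    else 1 - 2 * n + 2 * (t' - k - 2 * n - 1))"
  using assms unfolding rho2_def rho2_list_def Let_def
  by (simp add: nth_append of_nat_diff) (auto simp: nth_append of_nat_diff nth_Cons')

lemma rho2_OspEven:
  assumes "t < 2 * nb + 2 * mb"
  shows "rho2 OspEven nb mb (Suc t) = (let t' = int t; n = int nb; k = int mb in
    if t < mb then 2 * (n - k + t') else if t < mb + nb then 2 * (n - 1 - (t' - k))
    else if t < mb + 2 * nb then - 2 * (t' - k - n) else 2 * (1 - n + (t' - k - 2 * n)))"
  using assms unfolding rho2_def rho2_list_def Let_def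
  by (simp add: nth_append of_nat_diff) auto

lemma rho2_Spo:
  assumes "t < 2 * nb + 2 * mb"
  shows "rho2 Spo nb mb (Suc t) = (let t' = int t; n = int nb; k = int mb in
    if t < mb then 2 * (n - k + 1 + t') else if t < mb + nb then 2 * (n - (t' - k))
    else if t < mb + 2 * nb then - 2 * (t' - k - n + 1) else 2 * ((t' - k - 2 * n) - n))"
  using assms unfolding rho2_def rho2_list_def Let_def
  by (simp add: nth_append of_nat_diff) auto

lemma rho2_pr:
  assumes "1 \<le> i" "i \<le> dimV g nb mb"
  shows "rho2 g nb mb (pr g nb mb i) = - rho2 g nb mb i"
proof -
  obtain t where i: "i = Suc t" using assms by (cases i) auto
  define u where "u = dimV g nb mb - i"
  have p: "pr g nb mb i = Suc u" "t + u + 1 = dimV g nb mb" using assms i unfolding pr_def u_def by auto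
  show ?thesis
  proof (cases g)
    case OspOdd
    then have d: "t + u = 2 * nb + 2 * mb" using p unfolding dimV_def NN_def by simp
    then have "u < 2 * nb + 1 + 2 * mb" "t < 2 * nb + 1 + 2 * mb" "int u = 2 * int nb + 2 * int mb - int t" by auto
    then show ?thesis unfolding p(1) unfolding i OspOdd using rho2_OspOdd[of t nb mb] rho2_OspOdd[of u nb mb] d unfolding Let_def
      by (auto split: if_splits)
  next
    case OspEven
    then have d: "t + u + 1 = 2 * nb + 2 * mb" using p unfolding dimV_def NN_def by simp
    then have "u < 2 * nb + 2 * mb" "t < 2 * nb + 2 * mb" "int u = 2 * int nb + 2 * int mb - int t - 1" by auto
    then show ?thesis unfolding p(1) unfolding i OspEven using rho2_OspEven[of t nb mb] rho2_OspEven[of u nb mb] d unfolding Let_def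
      by (auto split: if_splits)
  next
    case Spo
    then have d: "t + u + 1 = 2 * nb + 2 * mb" using p unfolding dimV_def NN_def by simp
    then have "u < 2 * nb + 2 * mb" "t < 2 * nb + 2 * mb" "int u = 2 * int nb + 2 * int mb - int t - 1" by auto
    then show ?thesis unfolding p(1) unfolding i Spo using rho2_Spo[of t nb mb] rho2_Spo[of u nb mb] d unfolding Let_def
      by (auto split: if_splits)
  qed
qed

lemma kappa_kappa: "kappa g nb mb i * kappa g nb mb i = 1"
  unfolding kappa_def by simp

lemma kappa_pr:
  assumes "1 \<le> i" "i \<le> dimV g nb mb"
  shows "kappa g nb mb i * kappa g nb mb (pr g nb mb i)
    = (if g = Spo then 1 else -1) * (if par g nb mb i = 1 then 1 else -1)"
  using assms unfolding kappa_def par_def pr_def dimV_def NN_def by (cases g) auto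

lemma rho2_Suc_odd:
  assumes "1 \<le> i" "i < dimV g nb mb" "i < mb \<or> mb + NN g nb < i"
  shows "rho2 g nb mb (Suc i) = rho2 g nb mb i + 2"
proof -
  obtain t where i: "i = Suc t" using assms by (cases i) auto
  show ?thesis using assms rho2_OspOdd[of t nb mb] rho2_OspOdd[of "Suc t" nb mb] rho2_OspEven[of t nb mb] rho2_OspEven[of "Suc t" nb mb]
     rho2_Spo[of t nb mb] rho2_Spo[of "Suc t" nb mb] unfolding i dimV_def NN_def Let_def by (cases g) auto
qed

section \<open>The telescoping function\<close>

definition crossing_ratio :: "galg \<Rightarrow> nat \<Rightarrow> nat \<Rightarrow> complex \<Rightarrow> nat \<Rightarrow> complex" where
  "crossing_ratio g nb mb s z = kappa g nb mb z * kappa g nb mb (pr g nb mb z) * s powi (- 2 * rho2 g nb mb z)"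

definition crossing_de :: "galg \<Rightarrow> nat \<Rightarrow> nat \<Rightarrow> complex \<Rightarrow> nat \<Rightarrow> complex" where
  "crossing_de g nb mb s z = (if z = pr g nb mb z then 1 else if par g nb mb z = 1 then - (s\<^sup>2) else inverse (s\<^sup>2))"

text \<open>A discrete antiderivative of \<open>w * crossing_ratio\<close>. The first summand is the
  antiderivative on each half, and the added \<open>w\<close> compensates its jump at the
  centre.\<close>

definition crossing_sum :: "galg \<Rightarrow> nat \<Rightarrow> nat \<Rightarrow> complex \<Rightarrow> nat \<Rightarrow> complex" where
  "crossing_sum g nb mb s z = crossing_de g nb mb s z * crossing_ratio g nb mb s z
     + (if pr g nb mb z < z then s\<^sup>2 - inverse (s\<^sup>2) else 0)"

lemma powi_add4: "s \<noteq> 0 \<Longrightarrow> (s::complex) powi (e + 4) = s powi e * (s\<^sup>2 * s\<^sup>2)"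
  by (simp add: power_int_add power2_eq_square power4_eq_xxxx)

text \<open>In an odd block \<rho> rises by 1, so the ratio is divided by \<open>q^2\<close>, and
  the prefactor is \<open>- q\<close>. In either half of the even block \<rho> falls by 1, the ratio
  is multiplied by \<open>q^2\<close>, and the prefactor is \<open>1/q\<close>. Between blocks
  \<rho> is constant while \<open>\<kappa>\<^sub>z \<kappa>\<^sub>z\<^sub>'\<close> and hence the
  ratio change sign. All three give the increment \<open>w\<close> times the ratio; the steps at the
  centre are checked with explicit values.\<close>

lemma crossing_sum_Suc:
  assumes s: "s \<noteq> 0" and z: "1 \<le> z" "z < dimV g nb mb"
  shows "crossing_sum g nb mb s (Suc z) = crossing_sum g nb mb s z + (s\<^sup>2 - inverse (s\<^sup>2)) * crossing_ratio g nb mb s z"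
proof -
  define q where "q = s\<^sup>2"
  have q: "q \<noteq> 0" using s unfolding q_def by simp
  let ?p = "par g nb mb" and ?c = "pr g nb mb" and ?r = "rho2 g nb mb" 
  define \<sigma> :: complex where "\<sigma> = (if g = Spo then 1 else -1)"
  have cr: "crossing_ratio g nb mb s x = \<sigma> * (if ?p x = 1 then 1 else -1) * s powi (- 2 * ?r x)" if "1 \<le> x" "x \<le> dimV g nb mb" for x
    unfolding crossing_ratio_def kappa_pr[OF that] \<sigma>_def by simp
  note c1 = cr[of z] and c2 = cr[of "Suc z"]
  \<comment> \<open>The names record the parities of \<open>z\<close> and its successor;
    \<open>eo\<close> covers both orders.\<close>
  have oo: ?thesis if "?p z = 1" "?p (Suc z) = 1" "?r (Suc z) = ?r z + 2" "z \<noteq> ?c z" "Suc z \<noteq> ?c (Suc z)" "?c z < z \<longleftrightarrow> ?c (Suc z) < Suc z"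
  proof -
    have "s powi (- 2 * ?r z) = s powi (- 2 * ?r (Suc z)) * (q * q)" using powi_add4[OF s, of "- 2 * ?r (Suc z)"] that(3) unfolding q_def by simp
    then show ?thesis unfolding crossing_sum_def crossing_de_def using c1 c2 z that q unfolding q_def[symmetric] by (simp add: field_simps)
  qed
  have ee: ?thesis if "?p z = 0" "?p (Suc z) = 0" "?r z = ?r (Suc z) + 2" "z \<noteq> ?c z" "Suc z \<noteq> ?c (Suc z)" "?c z < z \<longleftrightarrow> ?c (Suc z) < Suc z"
  proof -
    have "s powi (- 2 * ?r (Suc z)) = s powi (- 2 * ?r z) * (q * q)" using powi_add4[OF s, of "- 2 * ?r z"] that(3) unfolding q_def by simp
    then show ?thesis unfolding crossing_sum_def crossing_de_def using c1 c2 z that q unfolding q_def[symmetric] by (simp add: field_simps)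
  qed
  have eo: ?thesis if "?p z + ?p (Suc z) = 1" "?r z = ?r (Suc z)" "z \<noteq> ?c z" "Suc z \<noteq> ?c (Suc z)" "?c z < z \<longleftrightarrow> ?c (Suc z) < Suc z"
  proof -
    have "?p z = 0 \<and> ?p (Suc z) = 1 \<or> ?p z = 1 \<and> ?p (Suc z) = 0" using that by auto
    then show ?thesis unfolding crossing_sum_def crossing_de_def using c1 c2 z that q unfolding q_def[symmetric] by (auto simp: field_simps)
  qed
  have pw: "s powi 2 = q" "s powi (- 2) = inverse q" "s powi 4 = q * q" "s powi (- 4) = inverse (q * q)"
    unfolding q_def by (simp_all add: power_int_minus power2_eq_square power4_eq_xxxx)
  obtain t where t: "z = Suc t" using z by (cases z) auto
  have px: "?p x = (if x \<le> mb \<or> mb + NN g nb < x then 1 else 0)" for x unfolding par_def by simp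
  have pc: "?c x = NN g nb + 2 * mb + 1 - x" for x unfolding pr_def dimV_def by simp
  show ?thesis
  proof (cases g)
    case OspOdd
    have N: "NN g nb = 2 * nb + 1" unfolding NN_def OspOdd by simp
    have z': "z < 2 * nb + 1 + 2 * mb" using z(2) N unfolding dimV_def by simp
    note R = rho2_OspOdd[of t nb mb, folded OspOdd t] rho2_OspOdd[of "Suc t" nb mb, folded OspOdd t]
    \<comment> \<open>For \<open>nb = 0\<close> the odd blocks border directly on the single middle
      index, so the boundary step and the central step coincide.\<close>
    consider "z < mb \<or> mb + 2 * nb + 1 < z" | "nb \<noteq> 0" "z = mb \<or> z = mb + 2 * nb + 1"
      | "mb < z" "z < mb + nb" | "mb + nb + 1 < z" "z < mb + 2 * nb + 1"
      | "nb = 0" "z = mb" | "nb = 0" "z = mb + 1" | "nb \<noteq> 0" "z = mb + nb" | "nb \<noteq> 0" "z = mb + nb + 1"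
      using z' by linarith
    then show ?thesis
    proof cases
      case 1 then show ?thesis by (intro oo) (use R z' t in \<open>auto simp: px pc N Let_def\<close>)
    next
      case 2 then show ?thesis by (intro eo) (use R z' t in \<open>auto simp: px pc N Let_def\<close>)
    next
      case 3 then show ?thesis by (intro ee) (use R z' t in \<open>auto simp: px pc N Let_def\<close>)
    next
      case 4 then show ?thesis by (intro ee) (use R z' t in \<open>auto simp: px pc N Let_def\<close>)
    next
      case 5
      have f: "?p z = 1" "?p (Suc z) = 0" "?r z = -1" "?r (Suc z) = 0" "z \<noteq> ?c z" "Suc z = ?c (Suc z)" "\<not> ?c z < z" "\<not> ?c (Suc z) < Suc z" "\<sigma> = -1"
        using 5 R z' t by (auto simp: par_def pr_def dimV_def NN_def Let_def \<sigma>_def OspOdd)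
      show ?thesis unfolding crossing_sum_def crossing_de_def using c1 c2 z f pw q unfolding q_def[symmetric] by (simp add: field_simps)
    next
      case 6
      have f: "?p z = 0" "?p (Suc z) = 1" "?r z = 0" "?r (Suc z) = 1" "z = ?c z" "Suc z \<noteq> ?c (Suc z)" "\<not> ?c z < z" "?c (Suc z) < Suc z" "\<sigma> = -1"
        using 6 R z' t by (auto simp: par_def pr_def dimV_def NN_def Let_def \<sigma>_def OspOdd)
      show ?thesis unfolding crossing_sum_def crossing_de_def using c1 c2 z f pw q unfolding q_def[symmetric] by (simp add: field_simps)
    next
      case 7
      have f: "?p z = 0" "?p (Suc z) = 0" "?r z = 1" "?r (Suc z) = 0" "z \<noteq> ?c z" "Suc z = ?c (Suc z)" "\<not> ?c z < z" "\<not> ?c (Suc z) < Suc z" "\<sigma> = -1"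
        using 7 R z' t by (auto simp: par_def pr_def dimV_def NN_def Let_def \<sigma>_def OspOdd)
      show ?thesis unfolding crossing_sum_def crossing_de_def using c1 c2 z f pw q unfolding q_def[symmetric] by (simp add: field_simps)
    next
      case 8
      have f: "?p z = 0" "?p (Suc z) = 0" "?r z = 0" "?r (Suc z) = -1" "z = ?c z" "Suc z \<noteq> ?c (Suc z)" "\<not> ?c z < z" "?c (Suc z) < Suc z" "\<sigma> = -1"
        using 8 R z' t by (auto simp: par_def pr_def dimV_def NN_def Let_def \<sigma>_def OspOdd)
      show ?thesis unfolding crossing_sum_def crossing_de_def using c1 c2 z f pw q unfolding q_def[symmetric] by (simp add: field_simps)
    qed
  next
    case OspEven
    have N: "NN g nb = 2 * nb" unfolding NN_def OspEven by simp
    have z': "z < 2 * nb + 2 * mb" using z(2) N unfolding dimV_def by simp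
    note R = rho2_OspEven[of t nb mb, folded OspEven t] rho2_OspEven[of "Suc t" nb mb, folded OspEven t]
    consider "z < mb \<or> mb + 2 * nb < z" | "nb \<noteq> 0" "z = mb \<or> z = mb + 2 * nb"
      | "mb < z" "z < mb + nb" | "mb + nb < z" "z < mb + 2 * nb"
      | "nb = 0" "z = mb" | "nb \<noteq> 0" "z = mb + nb"
      using z' by linarith
    then show ?thesis
    proof cases
      case 1 then show ?thesis by (intro oo) (use R z' t in \<open>auto simp: px pc N Let_def\<close>)
    next
      case 2 then show ?thesis by (intro eo) (use R z' t in \<open>auto simp: px pc N Let_def\<close>)
    next
      case 3 then show ?thesis by (intro ee) (use R z' t in \<open>auto simp: px pc N Let_def\<close>)
    next
      case 4 then show ?thesis by (intro ee) (use R z' t in \<open>auto simp: px pc N Let_def\<close>)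
    next
      case 5
      have f: "?p z = 1" "?p (Suc z) = 1" "?r z = -2" "?r (Suc z) = 2" "z \<noteq> ?c z" "Suc z \<noteq> ?c (Suc z)" "\<not> ?c z < z" "?c (Suc z) < Suc z" "\<sigma> = -1"
        using 5 R z' t by (auto simp: par_def pr_def dimV_def NN_def Let_def \<sigma>_def OspEven)
      show ?thesis unfolding crossing_sum_def crossing_de_def using c1 c2 z f pw q unfolding q_def[symmetric] by (simp add: field_simps)
    next
      case 6
      have f: "?p z = 0" "?p (Suc z) = 0" "?r z = 0" "?r (Suc z) = 0" "z \<noteq> ?c z" "Suc z \<noteq> ?c (Suc z)" "\<not> ?c z < z" "?c (Suc z) < Suc z" "\<sigma> = -1"
        using 6 R z' t by (auto simp: par_def pr_def dimV_def NN_def Let_def \<sigma>_def OspEven)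
      show ?thesis unfolding crossing_sum_def crossing_de_def using c1 c2 z f pw q unfolding q_def[symmetric] by (simp add: field_simps)
    qed
  next
    case Spo
    have N: "NN g nb = 2 * nb" unfolding NN_def Spo by simp
    have z': "z < 2 * nb + 2 * mb" using z(2) N unfolding dimV_def by simp
    note R = rho2_Spo[of t nb mb, folded Spo t] rho2_Spo[of "Suc t" nb mb, folded Spo t]
    consider "z < mb \<or> mb + 2 * nb < z" | "nb \<noteq> 0" "z = mb \<or> z = mb + 2 * nb"
      | "mb < z" "z < mb + nb" | "mb + nb < z" "z < mb + 2 * nb"
      | "nb = 0" "z = mb" | "nb \<noteq> 0" "z = mb + nb"
      using z' by linarith
    then show ?thesis
    proof cases
      case 1 then show ?thesis by (intro oo) (use R z' t in \<open>auto simp: px pc N Let_def\<close>)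
    next
      case 2 then show ?thesis by (intro eo) (use R z' t in \<open>auto simp: px pc N Let_def\<close>)
    next
      case 3 then show ?thesis by (intro ee) (use R z' t in \<open>auto simp: px pc N Let_def\<close>)
    next
      case 4 then show ?thesis by (intro ee) (use R z' t in \<open>auto simp: px pc N Let_def\<close>)
    next
      case 5
      have f: "?p z = 1" "?p (Suc z) = 1" "?r z = 0" "?r (Suc z) = 0" "z \<noteq> ?c z" "Suc z \<noteq> ?c (Suc z)" "\<not> ?c z < z" "?c (Suc z) < Suc z" "\<sigma> = 1"
        using 5 R z' t by (auto simp: par_def pr_def dimV_def NN_def Let_def \<sigma>_def Spo)
      show ?thesis unfolding crossing_sum_def crossing_de_def using c1 c2 z f pw q unfolding q_def[symmetric] by (simp add: field_simps)
    next
      case 6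
      have f: "?p z = 0" "?p (Suc z) = 0" "?r z = 2" "?r (Suc z) = -2" "z \<noteq> ?c z" "Suc z \<noteq> ?c (Suc z)" "\<not> ?c z < z" "?c (Suc z) < Suc z" "\<sigma> = 1"
        using 6 R z' t by (auto simp: par_def pr_def dimV_def NN_def Let_def \<sigma>_def Spo)
      show ?thesis unfolding crossing_sum_def crossing_de_def using c1 c2 z f pw q unfolding q_def[symmetric] by (simp add: field_simps)
    qed
  qed
qed

section \<open>The three families of K-matrices\<close>

lemma reflection_eq_of_data:
  fixes g nb mb
  defines "D \<equiv> dimV g nb mb"
  assumes s: "s \<noteq> 0"
    and rd: "reflection_data D m si (\<lambda>x. par g nb mb x = 1) (s\<^sup>2) (s\<^sup>2 - inverse (s\<^sup>2)) th mu lam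
      (\<lambda>i. kappa g nb mb i * s powi rho2 g nb mb i) (\<lambda>i. kappa g nb mb i * s powi (- rho2 g nb mb i)) be p"
    and K: "\<And>y d. \<lbrakk>1 \<le> y; y \<le> D; 1 \<le> d; d \<le> D\<rbrakk> \<Longrightarrow>
      K y d = (if d = y then if y \<le> m then mu else if y \<le> D - m then lam else 0 else 0)
        + (if d = D + 1 - si y then be y else 0)"
  shows "even_mat g nb mb K \<and> reflection_eq g nb mb s K"
proof -
  interpret rd: reflection_data D m si "\<lambda>x. par g nb mb x = 1" "s\<^sup>2" "s\<^sup>2 - inverse (s\<^sup>2)" th mu lam
      "\<lambda>i. kappa g nb mb i * s powi rho2 g nb mb i" "\<lambda>i. kappa g nb mb i * s powi (- rho2 g nb mb i)" be p
    by (rule rd)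
  let ?p = "par g nb mb"
  have even: "?p y = ?p d" if "1 \<le> y" "y \<le> D" "1 \<le> d" "d \<le> D" "K y d \<noteq> 0" for y d
  proof -
    have "d = y \<or> d = D + 1 - si y" using K[OF that(1-4)] that(5) by (auto split: if_splits)
    then have "?p d = 1 \<longleftrightarrow> ?p y = 1" using rd.od_tau[OF that(1,2)] by auto
    then show ?thesis using par01[of g nb mb y] par01[of g nb mb d] by auto
  qed
  have "even_mat g nb mb K" unfolding even_mat_def using even unfolding D_def by auto
  moreover have "reflection_eq g nb mb s K"
  proof (rule reflection_eqI[of g nb mb s rd.Sop K rd.Kop, folded D_def])
    fix F x y assume x: "1 \<le> x" "x \<le> D" and y: "1 \<le> y" "y \<le> D"
    show "rd.Sop (rd.Kop (rd.Sop (rd.Kop F))) x y = rd.Kop (rd.Sop (rd.Kop (rd.Sop F))) x y"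
      by (rule rd.reflection_pointwise[OF x y])
    have "opr D ?p (K2 K) F x y = (\<Sum>d\<in>{1..D}. K y d * F x d)"
      by (rule opr_K2[OF x]) (use even y in auto)
    also have "\<dots> = (\<Sum>d\<in>{1..D}. (if d = y then rd.al y * F x y else 0) + (if d = D + 1 - si y then be y * F x (D + 1 - si y) else 0))"
      using K[OF y] unfolding rd.al_def by (intro sum.cong) (auto simp: algebra_simps)
    also have "\<dots> = rd.Kop F x y" unfolding rd.Kop_def sum.distrib using y rd.tau_range[OF y] by simp
    finally show "opr D ?p (K2 K) F x y = rd.Kop F x y" .
    have pr: "pr g nb mb j = D + 1 - j" for j unfolding pr_def D_def by simp
    have pp: "?p (D + 1 - x) = ?p x" using par_pr[OF x[unfolded D_def]] unfolding pr .
    have "(-1) ^ (?p x * ?p y) * s\<^sup>2 powi ((-1) ^ ?p x * ((if y = x then 1 else 0) - (if y = D + 1 - x then 1 else 0))) = rd.dd x y"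
      unfolding rd.dd_def using par01[of g nb mb x] par01[of g nb mb y] pp by (auto simp: power_int_minus)
    then show "opr D ?p (Smat g nb mb s) F x y = rd.Sop F x y"
      unfolding rd.Sop_def using opr_Smat[OF x[unfolded D_def] y[unfolded D_def] s, folded D_def] unfolding pr by simp
  qed
  ultimately show ?thesis ..
qed

section \<open>Exchanging neighbours at both ends\<close>

definition swap_pair :: "nat \<Rightarrow> nat" where "swap_pair x = (if odd x then x + 1 else x - 1)"

text \<open>Used with \<open>l = 0\<close> in (A), \<open>l = m\<close> in (B) and
  \<open>l = M\<close> in (C). In (C) the outer blocks have size \<open>M + 1\<close>, so the two
  even indices in the centre are outer but fixed.\<close>

definition swap_ends :: "nat \<Rightarrow> nat \<Rightarrow> nat \<Rightarrow> nat" where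
  "swap_ends D l x = (if x \<le> l then swap_pair x else if D - l < x then D + 1 - swap_pair (D + 1 - x) else x)"

lemma swap_pair_range: "\<lbrakk>even l; 1 \<le> x; x \<le> l\<rbrakk> \<Longrightarrow> 1 \<le> swap_pair x \<and> swap_pair x \<le> l"
  unfolding swap_pair_def by presburger

lemma swap_pair_invol: "1 \<le> x \<Longrightarrow> swap_pair (swap_pair x) = x"
  unfolding swap_pair_def by auto

lemma swap_pair_mono: "\<lbrakk>1 \<le> x; x < y; y \<noteq> swap_pair x\<rbrakk> \<Longrightarrow> swap_pair x < swap_pair y"
  unfolding swap_pair_def by presburger

lemma swap_pair_neq: "1 \<le> x \<Longrightarrow> swap_pair x \<noteq> x"
  unfolding swap_pair_def by auto

context
  fixes D l :: nat
  assumes l: "even l" "2 * l \<le> D"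
begin

lemma swap_ends_top: "\<lbrakk>1 \<le> x; x \<le> l\<rbrakk> \<Longrightarrow> swap_ends D l x = swap_pair x \<and> 1 \<le> swap_pair x \<and> swap_pair x \<le> l"
  using swap_pair_range[OF l(1)] unfolding swap_ends_def by simp

lemma swap_ends_mid: "\<lbrakk>l < x; x \<le> D - l\<rbrakk> \<Longrightarrow> swap_ends D l x = x"
  unfolding swap_ends_def by simp

lemma swap_ends_bot:
  assumes "D - l < x" "x \<le> D"
  shows "swap_ends D l x = D + 1 - swap_pair (D + 1 - x) \<and> D - l < swap_ends D l x \<and> swap_ends D l x \<le> D"
proof -
  have "1 \<le> swap_pair (D + 1 - x) \<and> swap_pair (D + 1 - x) \<le> l" by (rule swap_pair_range[OF l(1)]) (use assms l in auto)
  moreover have "\<not> x \<le> l" using assms l by linarith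
  ultimately show ?thesis unfolding swap_ends_def using assms l(2) by (simp only: if_True if_False) linarith
qed

lemma swap_ends_pm:
  assumes "1 \<le> x" "x \<le> D"
  shows "swap_ends D l (D + 1 - x) = D + 1 - swap_ends D l x"
proof -
  consider "x \<le> l" | "l < x" "x \<le> D - l" | "D - l < x" by linarith
  then show ?thesis
  proof cases
    case 1
    then show ?thesis using swap_ends_top[of x] swap_ends_bot[of "D + 1 - x"] assms l by simp
  next
    case 2
    then show ?thesis using swap_ends_mid[of x] swap_ends_mid[of "D + 1 - x"] assms by simp
  next
    case 3
    have "swap_ends D l (D + 1 - x) = swap_pair (D + 1 - x)" "swap_pair (D + 1 - x) \<le> l"
      using swap_ends_top[of "D + 1 - x"] 3 assms by auto
    then show ?thesis using swap_ends_bot[OF 3 assms(2)] l by simp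
  qed
qed

lemma swap_ends_invol:
  assumes "1 \<le> x" "x \<le> D"
  shows "swap_ends D l (swap_ends D l x) = x"
proof -
  have top: "swap_ends D l (swap_ends D l x) = x" if "1 \<le> x" "x \<le> l" for x
    using swap_ends_top[of x] swap_ends_top[of "swap_pair x"] swap_pair_invol[of x] that by simp
  consider "x \<le> l" | "l < x" "x \<le> D - l" | "D - l < x" by linarith
  then show ?thesis
  proof cases
    case 1 then show ?thesis using top assms by simp
  next
    case 2 then show ?thesis using swap_ends_mid by simp
  next
    case 3
    let ?y = "D + 1 - x"
    have y: "1 \<le> ?y" "?y \<le> l" using 3 assms by auto
    have e: "swap_ends D l x = D + 1 - swap_ends D l ?y" using swap_ends_pm[of ?y] assms by simp
    have "1 \<le> swap_ends D l ?y" "swap_ends D l ?y \<le> D" using swap_ends_top[OF y] l by auto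
    then show ?thesis unfolding e using swap_ends_pm[of "swap_ends D l ?y"] top[OF y] assms by simp
  qed
qed

lemma swap_ends_mono:
  assumes "1 \<le> x" "y \<le> D" "x < y" "y \<noteq> swap_ends D l x"
  shows "swap_ends D l x < swap_ends D l y"
proof -
  have r: "swap_ends D l z \<le> l" if "1 \<le> z" "z \<le> l" for z using swap_ends_top[OF that] by simp
  have r': "D - l < swap_ends D l z" if "D - l < z" "z \<le> D" for z using swap_ends_bot[OF that] by simp
  consider "y \<le> l" | "x \<le> l" "l < y" | "l < x" "y \<le> D - l" | "l < x" "x \<le> D - l" "D - l < y" | "D - l < x" by linarith
  then show ?thesis
  proof cases
    case 1
    then show ?thesis using swap_pair_mono[of x y] swap_ends_top[of x] swap_ends_top[of y] assms by simp
  next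
    case 2
    have "l < swap_ends D l y" using r'[of y] swap_ends_mid[of y] 2 assms l by (cases "D - l < y") simp_all
    then show ?thesis using r[of x] 2 assms by simp
  next
    case 3 then show ?thesis using swap_ends_mid assms by simp
  next
    case 4 then show ?thesis using swap_ends_mid[of x] r'[of y] assms by simp
  next
    case 5
    let ?x = "D + 1 - x" and ?y = "D + 1 - y"
    have b: "D - l < y" using 5 assms by simp
    have n: "swap_pair ?y \<noteq> ?x"
    proof
      assume "swap_pair ?y = ?x"
      then have "swap_pair ?x = ?y" using swap_pair_invol[of ?y] assms by simp
      then show False using swap_ends_bot[of x] 5 assms by simp
    qed
    have "swap_pair ?y < swap_pair ?x" by (rule swap_pair_mono) (use n assms in auto)
    moreover have "swap_pair ?x \<le> l" using swap_pair_range[OF l(1), of ?x] 5 assms l by simp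
    ultimately have "D + 1 - swap_pair ?x < D + 1 - swap_pair ?y" using l(2) by linarith
    then show ?thesis using swap_ends_bot[of x] swap_ends_bot[OF b] 5 assms by simp
  qed
qed

end

lemma crossing_instance:
  fixes g nb mb
  defines "D \<equiv> dimV g nb mb"
  assumes s: "s \<noteq> 0" and l: "even l" "l \<le> m" "l \<le> mb" and m: "2 * m \<le> D"
    and th: "l \<noteq> 0 \<Longrightarrow> th = s\<^sup>2"
      "\<And>x. \<lbrakk>l < x; x \<le> m\<rbrakk> \<Longrightarrow> th = (if par g nb mb x = 1 then - inverse (s\<^sup>2) else s\<^sup>2)"
  shows "crossing_matrix D m (swap_ends D l) (\<lambda>x. par g nb mb x = 1) (s\<^sup>2) (s\<^sup>2 - inverse (s\<^sup>2)) th
      (\<lambda>i. kappa g nb mb i * s powi rho2 g nb mb i) (\<lambda>i. kappa g nb mb i * s powi (- rho2 g nb mb i))"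
proof -
  have l2: "2 * l \<le> D" using l m by simp
  note tops = swap_ends_top[OF l(1) l2] and mids = swap_ends_mid[OF l(1) l2] and bots = swap_ends_bot[OF l(1) l2]
  have pr: "pr g nb mb j = D + 1 - j" for j unfolding pr_def D_def by simp
  have DN: "D = NN g nb + 2 * mb" unfolding D_def dimV_def ..
  have ends: "par g nb mb x = 1" if "x \<le> l \<or> D - l < x" for x using that l DN unfolding par_def by auto
  show ?thesis
  proof (unfold_locales, goal_cases)
    case 1 show ?case using s by simp
  next
    case 2 show ?case ..
  next
    case 3 show ?case by (rule m)
  next
    case (4 x)
    then show ?case using tops[of x] mids[of x] l m by (cases "x \<le> l") auto
  next
    case (5 x)
    then show ?case using mids[of x] l m by auto
  next
    case (6 x) then show ?case by (rule swap_ends_invol[OF l(1) l2])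
  next
    case (7 x) then show ?case by (rule swap_ends_pm[OF l(1) l2])
  next
    case (8 x y) then show ?case by (rule swap_ends_mono[OF l(1) l2])
  next
    case (9 x) then show ?case using par_pr[of x g nb mb] unfolding pr D_def by simp
  next
    case (10 x)
    consider "x \<le> l" | "l < x" "x \<le> D - l" | "D - l < x" by linarith
    then show ?case using tops[of x] mids[of x] bots[of x] ends[of x] ends[of "swap_ends D l x"] 10 by cases simp_all
  next
    case (11 x)
    have "x \<le> l \<or> D - l < x" using mids[of x] 11 by force
    then show ?case using ends[of x] th(1) 11 l2 by force
  next
    case (12 x)
    have "\<not> x \<le> l" using tops[of x] swap_pair_neq[of x] 12 by auto
    then show ?case using th(2)[of x] 12 by simp
  next
    case (13 x)
    have "s powi rho2 g nb mb x * s powi (- rho2 g nb mb x) = 1" using s power_int_add[of s "rho2 g nb mb x" "- rho2 g nb mb x"] by simp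
    then show ?case using kappa_kappa[of g nb mb x] by (simp add: ac_simps mult.assoc[symmetric])
  next
    \<comment> \<open>Swapped neighbours \<open>x < x + 1\<close> lie in one odd block, where
      \<kappa> is constant and \<rho> rises by 1; hence the ratio of the weights is
      \<open>q\<close>.\<close>
    case (14 x)
    have e: "x \<le> l \<or> D - l < x" using mids[of x] 14 by force
    have nz: "l \<noteq> 0" using e 14 by auto
    have sp: "swap_pair y = y + 1 \<or> swap_pair y = y - 1" for y unfolding swap_pair_def by auto
    have Suc: "swap_ends D l x = Suc x"
    proof (cases "x \<le> l")
      case True then show ?thesis using tops[of x] sp[of x] 14 by auto
    next
      case False
      then have "D - l < x" using e by simp
      then show ?thesis using bots[of x] sp[of "D + 1 - x"] 14 by auto
    qed
    have b: "x < mb \<or> mb + NN g nb < x"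
    proof (cases "x \<le> l")
      case True then show ?thesis using tops[of x] 14 Suc l by auto
    next
      case False then show ?thesis using e l DN by auto
    qed
    have r: "rho2 g nb mb (Suc x) = rho2 g nb mb x + 2" using rho2_Suc_odd[of x g nb mb] b 14 Suc unfolding D_def by simp
    have k: "kappa g nb mb (Suc x) = kappa g nb mb x" using b unfolding kappa_def NN_def by (auto split: if_splits)
    have "s powi (- rho2 g nb mb x) = s\<^sup>2 * s powi (- 2 - rho2 g nb mb x)"
      using s power_int_add[of s 2 "- 2 - rho2 g nb mb x"] by simp
    then show ?case unfolding Suc r k th(1)[OF nz] by (simp add: ac_simps)
  qed
qed

text \<open>The boundary values needed for telescoping. The second is stated with a factor
  \<open>crossing_ratio\<close> at \<open>m\<close>, whose product with the ratio at the mirror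
  index is 1.\<close>

lemma crossing_sum_odd_block:
  assumes s: "s \<noteq> 0" and m: "1 \<le> m" "m \<le> mb"
  shows "crossing_sum g nb mb s (Suc m) = - inverse (s\<^sup>2) * crossing_ratio g nb mb s m"
    and "crossing_ratio g nb mb s m * crossing_sum g nb mb s (dimV g nb mb + 1 - m)
      = (s\<^sup>2 - inverse (s\<^sup>2)) * crossing_ratio g nb mb s m - s\<^sup>2"
proof -
  let ?D = "dimV g nb mb"
  have mD: "m \<le> ?D" "m < ?D" using m unfolding dimV_def by auto
  have p: "par g nb mb m = 1" "m \<noteq> pr g nb mb m" "\<not> pr g nb mb m < m" using m unfolding par_def pr_def dimV_def by auto
  have c: "pr g nb mb m = ?D + 1 - m" unfolding pr_def ..
  have "crossing_sum g nb mb s m = - (s\<^sup>2) * crossing_ratio g nb mb s m"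
    unfolding crossing_sum_def crossing_de_def using p by simp
  then show "crossing_sum g nb mb s (Suc m) = - inverse (s\<^sup>2) * crossing_ratio g nb mb s m"
    using crossing_sum_Suc[OF s m(1) mD(2)] by (simp add: algebra_simps)
  let ?c = "pr g nb mb m"
  have pc: "par g nb mb ?c = 1" "?c \<noteq> pr g nb mb ?c" "pr g nb mb ?c < ?c" "pr g nb mb ?c = m"
    using m par_pr[OF m(1) mD(1)] p unfolding pr_def dimV_def by auto
  have "crossing_ratio g nb mb s m * crossing_ratio g nb mb s ?c = 1"
  proof -
    have r: "rho2 g nb mb ?c = - rho2 g nb mb m" by (rule rho2_pr[OF m(1) mD(1)])
    have "s powi (- 2 * rho2 g nb mb m) * s powi (2 * rho2 g nb mb m) = 1"
      using s power_int_add[of s "- 2 * rho2 g nb mb m" "2 * rho2 g nb mb m"] by simp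
    moreover have "crossing_ratio g nb mb s m * crossing_ratio g nb mb s ?c
      = (kappa g nb mb m * kappa g nb mb m) * (kappa g nb mb ?c * kappa g nb mb ?c) * (s powi (- 2 * rho2 g nb mb m) * s powi (2 * rho2 g nb mb m))"
      unfolding crossing_ratio_def pc(4) r by simp
    ultimately show ?thesis unfolding kappa_kappa by simp
  qed
  then show "crossing_ratio g nb mb s m * crossing_sum g nb mb s (?D + 1 - m)
      = (s\<^sup>2 - inverse (s\<^sup>2)) * crossing_ratio g nb mb s m - s\<^sup>2"
    unfolding c[symmetric] crossing_sum_def crossing_de_def using pc(1,2,3) by (simp add: algebra_simps)
qed

text \<open>\<open>hh\<close> is zero up to \<open>m + 1\<close>, then grows by \<open>lam\<close>
  times the increments of \<open>crossing_sum\<close>, and by \<open>mu\<close> times them in the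
  bottom block. \<open>base\<close> and \<open>base'\<close> are the matching conditions at the two
  ends of the middle block.\<close>

lemma reflection_instance:
  fixes g nb mb s
  defines "D \<equiv> dimV g nb mb" and "r \<equiv> crossing_ratio g nb mb s" and "w \<equiv> s\<^sup>2 - inverse (s\<^sup>2)"
  assumes s: "s \<noteq> 0" and m: "1 \<le> m" "m \<le> mb"
    and cm: "crossing_matrix D m si (\<lambda>x. par g nb mb x = 1) (s\<^sup>2) (s\<^sup>2 - inverse (s\<^sup>2)) th
      (\<lambda>i. kappa g nb mb i * s powi rho2 g nb mb i) (\<lambda>i. kappa g nb mb i * s powi (- rho2 g nb mb i))"
    and be_mid: "\<And>x. \<lbrakk>m < x; x \<le> D - m\<rbrakk> \<Longrightarrow> be x = 0"
    and be_be: "\<And>x. \<lbrakk>1 \<le> x; x \<le> D; x \<le> m \<or> D - m < x\<rbrakk> \<Longrightarrow> be x * be (D + 1 - si x) = p"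
    and be_si: "\<And>x. \<lbrakk>1 \<le> x; x \<le> D; si x \<noteq> x\<rbrakk> \<Longrightarrow> be (si x) = - be x"
    and lam: "lam * lam = mu * lam + p"
    and base: "(lam - mu) * th = - (inverse (s\<^sup>2) * r m * lam)"
    and base': "(lam - mu) * crossing_sum g nb mb s (D + 1 - m) = lam * th - mu * w"
  shows "reflection_data D m si (\<lambda>x. par g nb mb x = 1) (s\<^sup>2) (s\<^sup>2 - inverse (s\<^sup>2)) th mu lam
      (\<lambda>i. kappa g nb mb i * s powi rho2 g nb mb i) (\<lambda>i. kappa g nb mb i * s powi (- rho2 g nb mb i)) be p"
proof -
  interpret cm: crossing_matrix D m si "\<lambda>x. par g nb mb x = 1" "s\<^sup>2" "s\<^sup>2 - inverse (s\<^sup>2)" th mu lam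
      "\<lambda>i. kappa g nb mb i * s powi rho2 g nb mb i" "\<lambda>i. kappa g nb mb i * s powi (- rho2 g nb mb i)"
    by (rule cm)
  let ?G = "crossing_sum g nb mb s"
  have pr: "pr g nb mb j = D + 1 - j" for j unfolding pr_def D_def by simp
  have rr: "cm.rr z = r z" if "1 \<le> z" "z \<le> D" for z
  proof -
    have "rho2 g nb mb (D + 1 - z) = - rho2 g nb mb z" using rho2_pr[of z g nb mb] that unfolding pr D_def by simp
    moreover have "s powi (- rho2 g nb mb z) * s powi (- rho2 g nb mb z) = s powi (- 2 * rho2 g nb mb z)"
      using s power_int_add[of s "- rho2 g nb mb z" "- rho2 g nb mb z"] by simp
    ultimately show ?thesis unfolding cm.rr_def r_def crossing_ratio_def pr by (simp add: ac_simps)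
  qed
  have de: "cm.dd z (D + 1 - z) = crossing_de g nb mb s z" if "1 \<le> z" "z \<le> D" for z
  proof -
    have "par g nb mb (D + 1 - z) = par g nb mb z" using par_pr[of z g nb mb] that unfolding pr D_def by simp
    moreover have "par g nb mb z = 0" if "z = D + 1 - z" using that unfolding par_def D_def dimV_def by auto
    ultimately show ?thesis unfolding cm.dd_def crossing_de_def pr by auto
  qed
  have G: "?G z = cm.dd z (D + 1 - z) * cm.rr z + (if D + 1 - z < z then w else 0)" if "1 \<le> z" "z \<le> D" for z
    unfolding crossing_sum_def de[OF that] rr[OF that] pr r_def w_def ..
  have hh_Suc: "cm.hh (Suc z) = cm.hh z + cm.al (D + 1 - z) * (?G (Suc z) - ?G z)" if "1 \<le> z" "z < D" for z
  proof -
    have "?G (Suc z) - ?G z = w * r z" using crossing_sum_Suc[OF s that(1), of g nb mb] that(2) unfolding D_def w_def r_def by simp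
    moreover have "cm.hh (Suc z) = cm.hh z + w * (r z * cm.al (D + 1 - z))"
      unfolding cm.hh_def w_def using that rr[of z] by (simp add: algebra_simps)
    ultimately show ?thesis by (simp add: algebra_simps)
  qed
  have mD: "2 * m \<le> D" by (rule cm.m_le)
  \<comment> \<open>The range includes the first bottom index: its \<open>hh\<close> only sums over
    \<open>k \<le> D - m\<close>, and it is the starting value for the bottom block.\<close>
  have mid: "cm.hh z = lam * (?G z - ?G (Suc m))" if "Suc m \<le> z" "z \<le> D - m + 1" for z
    using that
  proof (induction z rule: dec_induct)
    case base then show ?case using cm.hh_top by simp
  next
    case (step z)
    have "cm.al (D + 1 - z) = lam" "z < D" unfolding cm.al_def using step m mD by auto
    moreover have "cm.hh z = lam * (?G z - ?G (Suc m))" "1 \<le> z" using step.IH step by auto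
    ultimately show ?case using hh_Suc[of z] by (simp add: right_diff_distrib)
  qed
  have bot: "cm.hh z = cm.hh (D + 1 - m) + mu * (?G z - ?G (D + 1 - m))" if "D + 1 - m \<le> z" "z \<le> D" for z
    using that
  proof (induction z rule: dec_induct)
    case base then show ?case by simp
  next
    case (step z)
    have "cm.al (D + 1 - z) = mu" "z < D" "1 \<le> z" unfolding cm.al_def using step m mD by auto
    moreover have "cm.hh z = cm.hh (D + 1 - m) + mu * (?G z - ?G (D + 1 - m))" using step.IH step by auto
    ultimately show ?case using hh_Suc[of z] by (simp add: right_diff_distrib)
  qed
  have b: "lam * ?G (Suc m) = (lam - mu) * th"
    unfolding crossing_sum_odd_block(1)[OF s m] base r_def by (simp add: algebra_simps)
  show ?thesis
  proof (unfold_locales, goal_cases)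
    case (1 x) then show ?case by (rule be_mid)
  next
    case (2 x) then show ?case using be_be unfolding cm.outer_def by blast
  next
    case (3 x) then show ?case by (rule be_si)
  next
    case 4 show ?case by (rule lam)
  next
    case (5 z)
    have z: "1 \<le> z" "z \<le> D" "D + 1 - m \<le> z" "D + 1 - z < z" using 5 m mD by auto
    have "cm.hh z = lam * ?G (D + 1 - m) - lam * ?G (Suc m) + mu * (?G z - ?G (D + 1 - m))"
      using bot[OF z(3,2)] mid[of "D + 1 - m"] m mD by (simp add: algebra_simps)
    also have "\<dots> = (lam - mu) * ?G (D + 1 - m) - (lam - mu) * th + mu * ?G z"
      unfolding b by (simp add: algebra_simps)
    also have "\<dots> = mu * (?G z - w + th)" unfolding base' by (simp add: algebra_simps)
    finally show ?case unfolding G[OF z(1,2)] using z(4) by simp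
  next
    case (6 z)
    have z: "1 \<le> z" "z \<le> D" using 6 by auto
    have "cm.hh z = lam * ?G z - lam * ?G (Suc m)" using mid[of z] 6 by (simp add: algebra_simps)
    then show ?case unfolding b G[OF z] w_def .
  qed
qed

section \<open>From sums of matrix units to entries\<close>

lemma sum_emat:
  assumes "finite I" "\<And>i. i \<in> I \<Longrightarrow> a i = k \<longleftrightarrow> i = k0"
  shows "(\<Sum>i\<in>I. f i * emat (a i) (b i) k d) = (if k0 \<in> I \<and> d = b k0 then f k0 else 0)"
proof -
  have "(\<Sum>i\<in>I. f i * emat (a i) (b i) k d) = (\<Sum>i\<in>I. if i = k0 then if d = b k0 then f k0 else 0 else 0)"
  proof (intro sum.cong refl)
    fix i assume "i \<in> I"
    from assms(2)[OF this] show "f i * emat (a i) (b i) k d = (if i = k0 then if d = b k0 then f k0 else 0 else 0)"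
      unfolding emat_def by (cases "i = k0") auto
  qed
  then show ?thesis using assms(1) by simp
qed

lemma sum_emat_diag: "(\<Sum>i\<in>{a..b}. c * emat i i k d) = (if k \<in> {a..b} \<and> d = k then c else 0)"
  "(\<Sum>i\<in>{a<..<b}. c * emat i i k d) = (if k \<in> {a<..<b} \<and> d = k then c else 0)"
  by (rule sum_emat; auto)+

text \<open>The entry of the block sum in row \<open>x\<close> and column
  \<open>D + 1 - swap_ends D l x\<close>. In the bottom block, an even mirror index marks a row
  \<open>i' - 1\<close> and an odd one a row \<open>i'\<close>, for odd \<open>i\<close>.\<close>

definition block_coeff :: "nat \<Rightarrow> nat \<Rightarrow> (nat \<Rightarrow> complex) \<Rightarrow> nat \<Rightarrow> complex" where
  "block_coeff D l z x = (if x \<le> l then if odd x then z x else - z (x - 1)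
     else if even (D + 1 - x) then z x else - z (x - 1))"

context
  fixes D l :: nat and z :: "nat \<Rightarrow> complex"
  assumes l: "even l" "2 * l \<le> D"
begin

lemma sum_blocks:
  assumes k: "1 \<le> k" "k \<le> D" and d: "1 \<le> d" "d \<le> D"
  shows "(\<Sum>i\<in>{i\<in>{1..l}. odd i}. z i * (emat i (D - i) k d - emat (i + 1) (D + 1 - i) k d)
        + z (D - i) * (emat (D - i) i k d - emat (D + 1 - i) (i + 1) k d))
    = (if (k \<le> l \<or> D - l < k) \<and> d = D + 1 - swap_ends D l k then block_coeff D l z k else 0)"
proof -
  define I where "I = {i\<in>{1..l}. odd i}"
  have mem: "x \<in> I \<longleftrightarrow> 1 \<le> x \<and> x \<le> l \<and> odd x" for x unfolding I_def by auto
  have fin: "finite I" unfolding I_def by simp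
  have "(\<Sum>i\<in>I. z i * (emat i (D - i) k d - emat (i + 1) (D + 1 - i) k d)
        + z (D - i) * (emat (D - i) i k d - emat (D + 1 - i) (i + 1) k d))
    = (\<Sum>i\<in>I. z i * emat i (D - i) k d) - (\<Sum>i\<in>I. z i * emat (i + 1) (D + 1 - i) k d)
      + (\<Sum>i\<in>I. z (D - i) * emat (D - i) i k d) - (\<Sum>i\<in>I. z (D - i) * emat (D + 1 - i) (i + 1) k d)"
    unfolding sum.distrib[symmetric] sum_subtractf[symmetric] by (intro sum.cong refl) (simp add: algebra_simps)
  \<comment> \<open>Row \<open>k\<close> is met by each of the four families for at most one
    \<open>i\<close>, namely \<open>k\<close>, \<open>k - 1\<close>, \<open>D - k\<close> and
    \<open>D + 1 - k\<close> in turn.\<close>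
  also have "(\<Sum>i\<in>I. z i * emat i (D - i) k d) = (if k \<in> I \<and> d = D - k then z k else 0)"
    by (rule sum_emat[OF fin]) auto
  also have "(\<Sum>i\<in>I. z i * emat (i + 1) (D + 1 - i) k d) = (if k - 1 \<in> I \<and> d = D + 1 - (k - 1) then z (k - 1) else 0)"
    by (rule sum_emat[OF fin]) (use k in \<open>auto simp: mem\<close>)
  also have "(\<Sum>i\<in>I. z (D - i) * emat (D - i) i k d) = (if D - k \<in> I \<and> d = D - k then z (D - (D - k)) else 0)"
    by (rule sum_emat[OF fin]) (use k l in \<open>auto simp: mem\<close>)
  also have "(\<Sum>i\<in>I. z (D - i) * emat (D + 1 - i) (i + 1) k d)
      = (if D + 1 - k \<in> I \<and> d = (D + 1 - k) + 1 then z (D - (D + 1 - k)) else 0)"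
    by (rule sum_emat[OF fin]) (use k l in \<open>auto simp: mem\<close>)
  finally have S: "(\<Sum>i\<in>I. z i * (emat i (D - i) k d - emat (i + 1) (D + 1 - i) k d)
        + z (D - i) * (emat (D - i) i k d - emat (D + 1 - i) (i + 1) k d))
    = (if k \<in> I \<and> d = D - k then z k else 0) - (if k - 1 \<in> I \<and> d = D + 1 - (k - 1) then z (k - 1) else 0)
      + (if D - k \<in> I \<and> d = D - k then z (D - (D - k)) else 0)
      - (if D + 1 - k \<in> I \<and> d = (D + 1 - k) + 1 then z (D - (D + 1 - k)) else 0)" .
  have e: "D - (D - k) = k" "D - (D + 1 - k) = k - 1" using k by auto
  consider (top) "k \<le> l" | (mid) "l < k" "k \<le> D - l" | (bot) "D - l < k" by linarith
  then show ?thesis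
  proof cases
    case top
    \<comment> \<open>The bound \<open>2 * l \<le> D\<close> leaves only \<open>D - k = l\<close>,
      which has the wrong parity.\<close>
    have n: "D - k \<notin> I"
    proof
      assume "D - k \<in> I"
      then have "D - k = l" "odd (D - k)" using top l(2) unfolding mem by auto
      then show False using l(1) by simp
    qed
    have n': "D + 1 - k \<notin> I" using top l unfolding mem by auto
    show ?thesis
    proof (cases "odd k")
      case True
      then have "k \<in> I" "k - 1 \<notin> I" "D + 1 - swap_ends D l k = D - k" "block_coeff D l z k = z k"
        using top k unfolding swap_ends_def swap_pair_def block_coeff_def mem by auto
      then show ?thesis unfolding I_def[symmetric] S using n n' top by simp
    next
      case False
      then have "k \<notin> I" "k - 1 \<in> I" "D + 1 - swap_ends D l k = D + 1 - (k - 1)" "block_coeff D l z k = - z (k - 1)"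
        using top k unfolding swap_ends_def swap_pair_def block_coeff_def mem by (auto elim!: evenE)
      then show ?thesis unfolding I_def[symmetric] S using n n' top by simp
    qed
  next
    case mid
    have "k \<notin> I" "D + 1 - k \<notin> I" using mid l unfolding mem by auto
    moreover have "k - 1 \<notin> I"
    proof
      assume "k - 1 \<in> I"
      then have "k - 1 = l" "odd (k - 1)" using mid unfolding mem by auto
      then show False using l by simp
    qed
    moreover have "D - k \<notin> I"
    proof
      assume "D - k \<in> I"
      then have "D - k = l" "odd (D - k)" using mid unfolding mem by auto
      then show False using l by simp
    qed
    ultimately show ?thesis unfolding I_def[symmetric] S using mid by simp
  next
    case bot
    have kl: "\<not> k \<le> l" using bot l by linarith
    have n: "k \<notin> I" using kl unfolding mem by auto
    have n': "k - 1 \<notin> I"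
    proof
      assume "k - 1 \<in> I"
      then have "k - 1 = l" "odd (k - 1)" using kl unfolding mem by auto
      then show False using l by simp
    qed
    have r: "1 \<le> D + 1 - k" "D + 1 - k \<le> l" using bot k by auto
    show ?thesis
    proof (cases "even (D + 1 - k)")
      case True
      have o: "odd (D - k)" using True k by (simp add: Suc_diff_le)
      then have "1 \<le> D - k" by (cases "D - k") auto
      then have "D - k \<in> I" using o r unfolding mem by auto
      moreover have "D + 1 - k \<notin> I" using True unfolding mem by auto
      moreover have "D + 1 - swap_ends D l k = D - k"
        unfolding swap_ends_def swap_pair_def using True kl bot k by simp
      moreover have "block_coeff D l z k = z k" unfolding block_coeff_def using True kl by simp
      ultimately show ?thesis unfolding I_def[symmetric] S e using n n' bot by simp
    next
      case False
      have "D - k \<notin> I" using False k unfolding mem by (auto simp: Suc_diff_le)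
      moreover have "D + 1 - k \<in> I" using False r unfolding mem by auto
      moreover have "D + 1 - swap_ends D l k = (D + 1 - k) + 1"
      proof -
        have "D + 1 - (D + 1 - (D + 1 - k + 1)) = (D + 1 - k) + 1" using r l by linarith
        then show ?thesis unfolding swap_ends_def swap_pair_def using False kl bot by (simp only: if_True if_False simp_thms)
      qed
      moreover have "block_coeff D l z k = - z (k - 1)" unfolding block_coeff_def using False kl by simp
      ultimately show ?thesis unfolding I_def[symmetric] S e using n n' bot by simp
    qed
  qed
qed

lemma block_coeff_top:
  assumes "1 \<le> x" "x \<le> l"
  shows "block_coeff D l z x = (if odd x then z x else - z (x - 1))"
    and "block_coeff D l z (D + 1 - x) = (if even x then z (D + 1 - x) else - z (D - x))"
proof -
  have "\<not> D + 1 - x \<le> l" using assms l(2) by linarith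
  then show "block_coeff D l z (D + 1 - x) = (if even x then z (D + 1 - x) else - z (D - x))"
    unfolding block_coeff_def using assms l(2) by simp
qed (use assms in \<open>simp add: block_coeff_def\<close>)

lemma block_coeff_swap:
  assumes x: "1 \<le> x" "x \<le> D" "x \<le> l \<or> D - l < x"
  shows "block_coeff D l z (swap_ends D l x) = - block_coeff D l z x"
proof (cases "x \<le> l")
  case True
  show ?thesis using block_coeff_top(1)[OF x(1) True] block_coeff_top(1)[of "swap_pair x"] swap_ends_top[OF l x(1) True]
    unfolding swap_pair_def by (auto split: if_splits)
next
  case False
  define y where "y = D + 1 - x"
  have y: "1 \<le> y" "y \<le> l" "x = D + 1 - y" using x False unfolding y_def by auto
  have e: "swap_ends D l x = D + 1 - swap_pair y" using swap_ends_bot[OF l, of x] x False unfolding y_def by simp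
  show ?thesis unfolding e using block_coeff_top(2)[OF y(1,2), folded y(3)] block_coeff_top(2)[of "swap_pair y"] swap_pair_range[OF l(1) y(1,2)] y x
    unfolding swap_pair_def by (auto split: if_splits)
qed

lemma block_coeff_tau:
  assumes x: "1 \<le> x" "x \<le> D" "x \<le> l \<or> D - l < x"
    and z: "\<And>i. \<lbrakk>1 \<le> i; i \<le> l; odd i\<rbrakk> \<Longrightarrow> z i * z (D - i) = p"
  shows "block_coeff D l z x * block_coeff D l z (D + 1 - swap_ends D l x) = p"
proof -
  have top: "block_coeff D l z x * block_coeff D l z (D + 1 - swap_pair x) = p" if t: "1 \<le> x" "x \<le> l" for x
  proof (cases "odd x")
    case True
    have "swap_pair x = x + 1" unfolding swap_pair_def using True by simp
    then show ?thesis using block_coeff_top(1)[OF t] block_coeff_top(2)[of "swap_pair x"] swap_pair_range[OF l(1) t] z[OF t True] True by simp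
  next
    case False
    have sx: "swap_pair x = x - 1" "1 \<le> x - 1" "odd (x - 1)" using False t swap_pair_range[OF l(1) t] unfolding swap_pair_def by auto
    have "z (x - 1) * z (D - (x - 1)) = p" by (rule z) (use sx t in auto)
    then show ?thesis using block_coeff_top(1)[OF t] block_coeff_top(2)[of "x - 1"] sx t False by simp
  qed
  show ?thesis
  proof (cases "x \<le> l")
    case True then show ?thesis using top[OF x(1)] swap_ends_top[OF l x(1)] by simp
  next
    case False
    define y where "y = D + 1 - x"
    have y: "1 \<le> y" "y \<le> l" "x = D + 1 - y" using x False unfolding y_def by auto
    have sy: "1 \<le> swap_pair y" "swap_pair y \<le> l" "swap_pair (swap_pair y) = y"
      using swap_pair_range[OF l(1) y(1,2)] swap_pair_invol[OF y(1)] by auto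
    have e: "D + 1 - swap_ends D l x = swap_pair y" using swap_ends_bot[OF l, of x] x False sy l unfolding y_def by simp
    show ?thesis using top[OF sy(1,2)] unfolding e sy(3) y(3)[symmetric] by (simp add: mult.commute)
  qed
qed

end

section \<open>Verification for (A), (B) and (C)\<close>

theorem mainTheorem1:
  fixes g :: galg and nb mb m :: nat and q s lam :: complex
  assumes hq: "q \<noteq> 0" "\<forall>k::nat. k > 0 \<longrightarrow> q ^ k \<noteq> 1"
    and hs: "s\<^sup>2 = q"
    and hlam: "lam \<noteq> 0"
    and hm: "1 \<le> m" "m \<le> mb"
  shows
    "(\<forall>y :: nat \<Rightarrow> complex.
        (\<forall>i\<in>{1..m}. y i * y (pr g nb mb i)
           = kappa g nb mb m * kappa g nb mb (pr g nb mb m) * lam\<^sup>2 * s powi (- 2 * rho2 g nb mb m))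
        \<longrightarrow> even_mat g nb mb (KA g nb mb s m lam y)
            \<and> reflection_eq g nb mb s (KA g nb mb s m lam y))
   \<and> (even m \<longrightarrow> (\<forall>z :: nat \<Rightarrow> complex.
        (\<forall>i\<in>{1..m}. odd i \<longrightarrow> z i * z (pr g nb mb i - 1)
           = - kappa g nb mb (m - 1) * kappa g nb mb (pr g nb mb m + 1) * lam\<^sup>2
               * s powi (- 2 * (rho2 g nb mb m + 2)))
        \<longrightarrow> even_mat g nb mb (KB g nb mb s m lam z)
            \<and> reflection_eq g nb mb s (KB g nb mb s m lam z)))
   \<and> (\<forall>(M :: nat) (x :: nat \<Rightarrow> complex). even M \<longrightarrow>
        (\<forall>i\<in>{1..2 * (M + 1) - 1}. odd i \<and> i \<noteq> M + 1 \<longrightarrow>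
           x i * x (pr OspEven 1 M i - 1) = x (M + 1) * x (pr OspEven 1 M (M + 1)))
        \<longrightarrow> even_mat OspEven 1 M (KC M x) \<and> reflection_eq OspEven 1 M s (KC M x))"
proof -
  define D where "D = dimV g nb mb"
  define r where "r = crossing_ratio g nb mb s"
  have s: "s \<noteq> 0" using hq hs by auto
  have pr: "pr g nb mb j = D + 1 - j" for j unfolding pr_def D_def by simp
  have mD: "2 * m \<le> D" "2 * mb \<le> D" using hm unfolding D_def dimV_def by auto
  have par: "par g nb mb x = 1" if "x \<le> m" for x using that hm unfolding par_def by simp
  have rm: "kappa g nb mb m * kappa g nb mb (D + 1 - m) * s powi (- 2 * rho2 g nb mb m) = r m"
    unfolding r_def crossing_ratio_def pr ..
  have G: "r m * crossing_sum g nb mb s (D + 1 - m) = (s\<^sup>2 - inverse (s\<^sup>2)) * r m - s\<^sup>2"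
    using crossing_sum_odd_block(2)[OF s hm] unfolding r_def D_def .
  have A: "even_mat g nb mb (KA g nb mb s m lam y) \<and> reflection_eq g nb mb s (KA g nb mb s m lam y)"
    if "\<forall>i\<in>{1..m}. y i * y (pr g nb mb i) = kappa g nb mb m * kappa g nb mb (pr g nb mb m) * lam\<^sup>2 * s powi (- 2 * rho2 g nb mb m)" for y
  proof -
    define mu where "mu = lam * (1 - r m)"
    define be where "be x = (if x \<le> m \<or> D - m < x then y x else 0)" for x
    have si: "swap_ends D 0 x = x" if "1 \<le> x" "x \<le> D" for x using swap_ends_mid[of 0 D x] that by simp
    have yy: "y i * y (D + 1 - i) = r m * (lam * lam)" if "1 \<le> i" "i \<le> m" for i
    proof -
      have "y i * y (D + 1 - i) = kappa g nb mb m * kappa g nb mb (D + 1 - m) * lam\<^sup>2 * s powi (- 2 * rho2 g nb mb m)"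
        using \<open>\<forall>i\<in>{1..m}. _\<close> that unfolding pr by simp
      then show ?thesis unfolding rm[symmetric] by (simp add: power2_eq_square ac_simps)
    qed
    have cm: "crossing_matrix D m (swap_ends D 0) (\<lambda>x. par g nb mb x = 1) (s\<^sup>2) (s\<^sup>2 - inverse (s\<^sup>2)) (- inverse (s\<^sup>2))
      (\<lambda>i. kappa g nb mb i * s powi rho2 g nb mb i) (\<lambda>i. kappa g nb mb i * s powi (- rho2 g nb mb i))"
      unfolding D_def by (rule crossing_instance[OF s]) (use mD par in \<open>auto simp: D_def\<close>)
    have rd: "reflection_data D m (swap_ends D 0) (\<lambda>x. par g nb mb x = 1) (s\<^sup>2) (s\<^sup>2 - inverse (s\<^sup>2)) (- inverse (s\<^sup>2)) mu lam
      (\<lambda>i. kappa g nb mb i * s powi rho2 g nb mb i) (\<lambda>i. kappa g nb mb i * s powi (- rho2 g nb mb i)) be (r m * (lam * lam))"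
    proof (rule reflection_instance[OF s hm cm[unfolded D_def], folded D_def r_def])
      fix x assume "m < x" "x \<le> D - m"
      then show "be x = 0" unfolding be_def by simp
    next
      fix x assume x: "1 \<le> x" "x \<le> D" "x \<le> m \<or> D - m < x"
      have "be x * be (D + 1 - x) = y x * y (D + 1 - x)" unfolding be_def using x mD by auto
      also have "\<dots> = r m * (lam * lam)" using yy[of x] yy[of "D + 1 - x"] x by (cases "x \<le> m") (auto simp: mult.commute)
      finally show "be x * be (D + 1 - swap_ends D 0 x) = r m * (lam * lam)" unfolding si[OF x(1,2)] .
    next
      fix x assume "1 \<le> x" "x \<le> D" "swap_ends D 0 x \<noteq> x"
      then show "be (swap_ends D 0 x) = - be x" using si by simp
    next
      show "lam * lam = mu * lam + r m * (lam * lam)" unfolding mu_def by (simp add: algebra_simps)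
      show "(lam - mu) * - inverse (s\<^sup>2) = - (inverse (s\<^sup>2) * r m * lam)" unfolding mu_def by (simp add: algebra_simps)
      have "(lam - mu) * crossing_sum g nb mb s (D + 1 - m) = lam * (r m * crossing_sum g nb mb s (D + 1 - m))"
        unfolding mu_def by (simp add: algebra_simps)
      then show "(lam - mu) * crossing_sum g nb mb s (D + 1 - m) = lam * - inverse (s\<^sup>2) - mu * (s\<^sup>2 - inverse (s\<^sup>2))"
        unfolding G mu_def by (simp add: algebra_simps)
    qed
    have muK: "lam * (1 - kappa g nb mb m * kappa g nb mb (D + 1 - m) * s powi (- 2 * rho2 g nb mb m)) = mu"
      unfolding rm mu_def ..
    show ?thesis
    proof (rule reflection_eq_of_data[OF s rd[unfolded D_def], folded D_def])
      fix k d assume k: "1 \<le> k" "k \<le> D" and d: "1 \<le> d" "d \<le> D"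
      have 3: "(\<Sum>i\<in>{1..m}. y i * emat i (D + 1 - i) k d + y (D + 1 - i) * emat (D + 1 - i) i k d)
        = (if d = D + 1 - k then be k else 0)"
      proof -
        have "(\<Sum>i\<in>{1..m}. y i * emat i (D + 1 - i) k d) = (if k \<in> {1..m} \<and> d = D + 1 - k then y k else 0)"
          by (rule sum_emat) auto
        moreover have "(\<Sum>i\<in>{1..m}. y (D + 1 - i) * emat (D + 1 - i) i k d)
            = (if D + 1 - k \<in> {1..m} \<and> d = D + 1 - k then y (D + 1 - (D + 1 - k)) else 0)"
          by (rule sum_emat) (use k mD in auto)
        moreover have "D + 1 - k \<in> {1..m} \<longleftrightarrow> D - m < k" "D + 1 - (D + 1 - k) = k" "k \<in> {1..m} \<longleftrightarrow> k \<le> m" "\<not> (k \<le> m \<and> D - m < k)"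
          using k mD by auto
        ultimately show ?thesis unfolding sum.distrib be_def by auto
      qed
      have "m < k \<and> k < D + 1 - m \<longleftrightarrow> \<not> k \<le> m \<and> k \<le> D - m" using mD by auto
      then show "KA g nb mb s m lam y k d = (if d = k then if k \<le> m then mu else if k \<le> D - m then lam else 0 else 0)
        + (if d = D + 1 - swap_ends D 0 k then be k else 0)"
        unfolding KA_def Let_def pr muK 3 sum_emat_diag si[OF k] using k by auto
    qed
  qed
  have B: "even_mat g nb mb (KB g nb mb s m lam z) \<and> reflection_eq g nb mb s (KB g nb mb s m lam z)"
    if ev: "even m" and zz: "\<forall>i\<in>{1..m}. odd i \<longrightarrow> z i * z (pr g nb mb i - 1)
           = - kappa g nb mb (m - 1) * kappa g nb mb (pr g nb mb m + 1) * lam\<^sup>2 * s powi (- 2 * (rho2 g nb mb m + 2))" for z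
  proof -
    \<comment> \<open>This is \<open>q^(-2) r m\<close>, the ratio with \<rho> raised by 1 as in
      (B); the indices \<open>m - 1\<close> and \<open>m\<close> share the same \<kappa>, and so do
      their mirrors.\<close>
    define r' where "r' = inverse (s\<^sup>2) * inverse (s\<^sup>2) * r m"
    define mu where "mu = lam * (1 + r')"
    define be where "be x = (if x \<le> m \<or> D - m < x then block_coeff D m z x else 0)" for x
    have m2: "2 \<le> m" using ev hm by (cases "m = 1") auto
    have DN: "D = NN g nb + 2 * mb" unfolding D_def dimV_def ..
    have kap: "kappa g nb mb (m - 1) = kappa g nb mb m" "kappa g nb mb (D + 1 - m + 1) = kappa g nb mb (D + 1 - m)"
      using hm m2 DN unfolding kappa_def NN_def by (auto split: if_splits)
    have r': "kappa g nb mb (m - 1) * kappa g nb mb (D + 1 - m + 1) * s powi (- 2 * (rho2 g nb mb m + 2)) = r'"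
    proof -
      have "s powi (- 2 * rho2 g nb mb m) = s powi (- 2 * (rho2 g nb mb m + 2)) * (s\<^sup>2 * s\<^sup>2)"
        using powi_add4[OF s, of "- 2 * (rho2 g nb mb m + 2)"] by simp
      then show ?thesis unfolding r'_def rm[symmetric] kap using s by (simp add: field_simps)
    qed
    have zz': "z i * z (D - i) = - (r' * (lam * lam))" if "1 \<le> i" "i \<le> m" "odd i" for i
    proof -
      have "z i * z (D + 1 - i - 1) = - kappa g nb mb (m - 1) * kappa g nb mb (D + 1 - m + 1) * lam\<^sup>2 * s powi (- 2 * (rho2 g nb mb m + 2))"
        using zz that unfolding pr by simp
      then show ?thesis unfolding r'[symmetric] by (simp add: power2_eq_square ac_simps)
    qed
    have cm: "crossing_matrix D m (swap_ends D m) (\<lambda>x. par g nb mb x = 1) (s\<^sup>2) (s\<^sup>2 - inverse (s\<^sup>2)) (s\<^sup>2)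
      (\<lambda>i. kappa g nb mb i * s powi rho2 g nb mb i) (\<lambda>i. kappa g nb mb i * s powi (- rho2 g nb mb i))"
      unfolding D_def by (rule crossing_instance[OF s]) (use mD par ev hm in \<open>auto simp: D_def\<close>)
    have rd: "reflection_data D m (swap_ends D m) (\<lambda>x. par g nb mb x = 1) (s\<^sup>2) (s\<^sup>2 - inverse (s\<^sup>2)) (s\<^sup>2) mu lam
      (\<lambda>i. kappa g nb mb i * s powi rho2 g nb mb i) (\<lambda>i. kappa g nb mb i * s powi (- rho2 g nb mb i)) be (- (r' * (lam * lam)))"
    proof (rule reflection_instance[OF s hm cm[unfolded D_def], folded D_def r_def])
      fix x assume "m < x" "x \<le> D - m"
      then show "be x = 0" unfolding be_def by simp
    next
      fix x assume x: "1 \<le> x" "x \<le> D" "x \<le> m \<or> D - m < x"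
      have "1 \<le> swap_ends D m x \<and> swap_ends D m x \<le> m \<or> D - m < swap_ends D m x \<and> swap_ends D m x \<le> D"
        using swap_ends_top[OF ev mD(1) x(1)] swap_ends_bot[OF ev mD(1) _ x(2)] x(3) by (cases "x \<le> m") simp_all
      then have "D + 1 - swap_ends D m x \<le> m \<or> D - m < D + 1 - swap_ends D m x" using mD by linarith
      then show "be x * be (D + 1 - swap_ends D m x) = - (r' * (lam * lam))"
        unfolding be_def using block_coeff_tau[OF ev mD(1) x, where z = z, OF zz'] x(3) by simp
    next
      fix x assume x: "1 \<le> x" "x \<le> D" "swap_ends D m x \<noteq> x"
      then have o: "x \<le> m \<or> D - m < x" using swap_ends_mid[OF ev mD(1), of x] by linarith
      have "swap_ends D m x \<le> m \<or> D - m < swap_ends D m x"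
        using swap_ends_top[OF ev mD(1) x(1)] swap_ends_bot[OF ev mD(1) _ x(2)] o by auto
      then show "be (swap_ends D m x) = - be x"
        unfolding be_def using block_coeff_swap[OF ev mD(1) x(1,2) o] o by simp
    next
      show "lam * lam = mu * lam + - (r' * (lam * lam))" unfolding mu_def by (simp add: algebra_simps)
      show "(lam - mu) * s\<^sup>2 = - (inverse (s\<^sup>2) * r m * lam)" unfolding mu_def r'_def using s by (simp add: field_simps)
      have "(lam - mu) * crossing_sum g nb mb s (D + 1 - m) = - (lam * inverse (s\<^sup>2) * inverse (s\<^sup>2)) * (r m * crossing_sum g nb mb s (D + 1 - m))"
        unfolding mu_def r'_def by (simp add: algebra_simps)
      then show "(lam - mu) * crossing_sum g nb mb s (D + 1 - m) = lam * s\<^sup>2 - mu * (s\<^sup>2 - inverse (s\<^sup>2))"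
        unfolding G mu_def r'_def using s by (simp add: field_simps)
    qed
    have muK: "lam * (1 + kappa g nb mb (m - 1) * kappa g nb mb (D + 1 - m + 1) * s powi (- 2 * (rho2 g nb mb m + 2))) = mu"
      unfolding r' mu_def ..
    show ?thesis
    proof (rule reflection_eq_of_data[OF s rd[unfolded D_def], folded D_def])
      fix k d assume k: "1 \<le> k" "k \<le> D" and d: "1 \<le> d" "d \<le> D"
      have e: "D + 1 - i - 1 = D - i" for i by simp
      have "m < k \<and> k < D + 1 - m \<longleftrightarrow> \<not> k \<le> m \<and> k \<le> D - m" using mD by auto
      then show "KB g nb mb s m lam z k d = (if d = k then if k \<le> m then mu else if k \<le> D - m then lam else 0 else 0)
        + (if d = D + 1 - swap_ends D m k then be k else 0)"
        unfolding KB_def Let_def pr muK e sum_blocks[OF ev mD(1) k d] sum_emat_diag be_def using k by auto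
    qed
  qed
  have C: "even_mat OspEven 1 M (KC M x) \<and> reflection_eq OspEven 1 M s (KC M x)"
    if ev: "even M" and xx: "\<forall>i\<in>{1..2 * (M + 1) - 1}. odd i \<and> i \<noteq> M + 1 \<longrightarrow>
           x i * x (pr OspEven 1 M i - 1) = x (M + 1) * x (pr OspEven 1 M (M + 1))" for M x
  proof -
    define D where "D = dimV OspEven 1 M"
    have D: "D = 2 * M + 2" unfolding D_def dimV_def NN_def by simp
    have MD: "2 * M \<le> D" "D - M = M + 2" "D - (M + 1) = M + 1" using D by auto
    have pr: "pr OspEven 1 M j = D + 1 - j" for j unfolding pr_def D_def by simp
    have cn: "D + 1 - (M + 1) = M + 2" "D + 1 - (M + 2) = M + 1" using D by auto
    define p where "p = x (M + 1) * x (M + 2)"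
    \<comment> \<open>With \<open>mu = 0\<close> the relation \<open>lam_sq\<close> asks for a
      square root of \<open>p\<close>; the middle block is empty, so either root will do.\<close>
    define lam where "lam = csqrt p"
    define be where "be k = (if k = M + 1 \<or> k = M + 2 then x k else block_coeff D M x k)" for k
    note tops = swap_ends_top[OF ev MD(1)] and mids = swap_ends_mid[OF ev MD(1)] and bots = swap_ends_bot[OF ev MD(1)]
    have xx': "x i * x (D - i) = p" if "1 \<le> i" "i \<le> M" "odd i" for i
      using xx[rule_format, of i] that cn unfolding pr p_def by simp
    have cm: "crossing_matrix D (M + 1) (swap_ends D M) (\<lambda>x. par OspEven 1 M x = 1) (s\<^sup>2) (s\<^sup>2 - inverse (s\<^sup>2)) (s\<^sup>2)
      (\<lambda>i. kappa OspEven 1 M i * s powi rho2 OspEven 1 M i) (\<lambda>i. kappa OspEven 1 M i * s powi (- rho2 OspEven 1 M i))"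
      unfolding D_def by (rule crossing_instance[OF s]) (use ev D in \<open>auto simp: D_def par_def NN_def\<close>)
    interpret cm: crossing_matrix D "M + 1" "swap_ends D M" "\<lambda>x. par OspEven 1 M x = 1" "s\<^sup>2" "s\<^sup>2 - inverse (s\<^sup>2)" "s\<^sup>2" 0 lam
      "\<lambda>i. kappa OspEven 1 M i * s powi rho2 OspEven 1 M i" "\<lambda>i. kappa OspEven 1 M i * s powi (- rho2 OspEven 1 M i)"
      by (rule cm)
    have ends: "1 \<le> swap_ends D M k \<and> swap_ends D M k \<le> M \<or> M + 2 < swap_ends D M k \<and> swap_ends D M k \<le> D"
      if "1 \<le> k" "k \<le> D" "k \<le> M \<or> M + 2 < k" for k
      using tops[of k] bots[of k] that MD(2) by (cases "k \<le> M") simp_all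
    have rd: "reflection_data D (M + 1) (swap_ends D M) (\<lambda>x. par OspEven 1 M x = 1) (s\<^sup>2) (s\<^sup>2 - inverse (s\<^sup>2)) (s\<^sup>2) 0 lam
      (\<lambda>i. kappa OspEven 1 M i * s powi rho2 OspEven 1 M i) (\<lambda>i. kappa OspEven 1 M i * s powi (- rho2 OspEven 1 M i)) be p"
    proof (unfold_locales, goal_cases)
      case (1 k) then show ?case using MD by simp
    next
      case (2 k)
      show ?case
      proof (cases "k = M + 1 \<or> k = M + 2")
        case True
        then have "swap_ends D M k = k" using mids[of k] MD(2) by auto
        then show ?thesis using True cn unfolding be_def p_def by (auto simp: mult.commute)
      next
        case False
        then have k: "k \<le> M \<or> M + 2 < k" by linarith
        have "D + 1 - swap_ends D M k \<noteq> M + 1" "D + 1 - swap_ends D M k \<noteq> M + 2" using ends[OF 2(1,2) k] D by linarith+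
        then show ?thesis using block_coeff_tau[OF ev MD(1) 2(1,2), where z = x, OF _ xx'] k MD(2) False unfolding be_def by simp
      qed
    next
      case (3 k)
      have k: "k \<le> M \<or> M + 2 < k" using 3 mids[of k] MD(2) by linarith
      then show ?case using ends[OF 3(1,2) k] block_coeff_swap[OF ev MD(1) 3(1,2), of x] MD(2) unfolding be_def by auto
    next
      case 4 show ?case using power2_csqrt[of p] unfolding lam_def by (simp add: power2_eq_square)
    next
      case (5 z)
      \<comment> \<open>With \<open>mu = 0\<close> and no middle index the diagonal of
        \<open>K\<close> is zero, so the condition on \<open>hh\<close> reads
        \<open>0 = 0\<close>.\<close>
      have "cm.al j = 0" for j unfolding cm.al_def using MD by simp
      then show ?case unfolding cm.hh_def by simp
    next
      case (6 z) then show ?case using MD by simp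
    qed
    show ?thesis
    proof (rule reflection_eq_of_data[OF s rd[unfolded D_def], folded D_def])
      fix k d assume k: "1 \<le> k" "k \<le> D" and d: "1 \<le> d" "d \<le> D"
      let ?J = "{i\<in>{1..M}. odd i}"
      let ?f = "\<lambda>i. x i * (emat i (D + 1 - i - 1) k d - emat (i + 1) (D + 1 - i) k d)"
      \<comment> \<open>As \<open>M\<close> is even, the odd indices other than \<open>M + 1\<close>
        fall into those up to \<open>M\<close> and their images \<open>D - i = i' - 1\<close>.
        Pairing them gives the block sum of (B) with \<open>l = M\<close>.\<close>
      have I: "{i\<in>{1..2 * (M + 1) - 1}. odd i \<and> i \<noteq> M + 1} = ?J \<union> (\<lambda>i. D - i) ` ?J"
      proof (intro set_eqI iffI)
        fix i assume i: "i \<in> {i\<in>{1..2 * (M + 1) - 1}. odd i \<and> i \<noteq> M + 1}"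
        show "i \<in> ?J \<union> (\<lambda>i. D - i) ` ?J"
        proof (cases "i \<le> M")
          case False
          have "i \<noteq> M + 2" using i ev by auto
          then have "D - i \<in> ?J" "i = D - (D - i)" using i False D by auto
          then show ?thesis by blast
        qed (use i in auto)
      qed (use D ev in auto)
      have "sum ?f {i\<in>{1..2 * (M + 1) - 1}. odd i \<and> i \<noteq> M + 1} = sum ?f ?J + sum ?f ((\<lambda>i. D - i) ` ?J)"
        unfolding I by (rule sum.union_disjoint) (use D in auto)
      also have "sum ?f ((\<lambda>i. D - i) ` ?J) = (\<Sum>i\<in>?J. ?f (D - i))"
        by (subst sum.reindex) (use D in \<open>auto simp: inj_on_def\<close>)
      also have "sum ?f ?J + (\<Sum>i\<in>?J. ?f (D - i)) = (\<Sum>i\<in>?J. x i * (emat i (D - i) k d - emat (i + 1) (D + 1 - i) k d)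
        + x (D - i) * (emat (D - i) i k d - emat (D + 1 - i) (i + 1) k d))"
        unfolding sum.distrib[symmetric]
      proof (intro sum.cong refl)
        fix i assume "i \<in> ?J"
        then have "D + 1 - (D - i) - 1 = i" "D - i + 1 = D + 1 - i" "D + 1 - (D - i) = i + 1" "D + 1 - i - 1 = D - i" using D by auto
        then show "?f i + ?f (D - i) = x i * (emat i (D - i) k d - emat (i + 1) (D + 1 - i) k d)
          + x (D - i) * (emat (D - i) i k d - emat (D + 1 - i) (i + 1) k d)" by simp
      qed
      also note sum_blocks[OF ev MD(1) k d]
      finally have S: "sum ?f {i\<in>{1..2 * (M + 1) - 1}. odd i \<and> i \<noteq> M + 1} =
        (if (k \<le> M \<or> D - M < k) \<and> d = D + 1 - swap_ends D M k then block_coeff D M x k else 0)" .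
      have KC: "KC M x k d = sum ?f {i\<in>{1..2 * (M + 1) - 1}. odd i \<and> i \<noteq> M + 1} + x (M + 1) * emat (M + 1) (M + 2) k d + x (M + 2) * emat (M + 2) (M + 1) k d"
        unfolding KC_def Let_def pr cn ..
      show "KC M x k d = (if d = k then if k \<le> M + 1 then 0 else if k \<le> D - (M + 1) then lam else 0 else 0)
        + (if d = D + 1 - swap_ends D M k then be k else 0)"
      proof (cases "k = M + 1 \<or> k = M + 2")
        case True
        then have "swap_ends D M k = k" using mids[of k] MD(2) by auto
        then show ?thesis unfolding KC S using True cn MD unfolding be_def emat_def by auto
      next
        case False
        then have "k \<le> M \<or> D - M < k" using MD(2) by linarith
        then show ?thesis unfolding KC S using False MD unfolding be_def emat_def by auto
      qed
    qed
  qed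
  show ?thesis using A B C by blast
qed

end
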